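(* If a $\mathcal{C}$-orderable group $G$ has only finitely many $\mathcal{C}$-orderings, then its space of left-orderings $\mathcal{LO}(G)$ is either finite or homeomorphic to the Cantor set.
   Context: A left-ordering on $G$ is a total order invariant under left multiplication; a $\mathcal{C}$-ordering is a left-ordering $\preceq$ such that for all $f\succ id$, $g\succ id$ there is $n\in\mathbb{N}$ with $fg^n\succ g$. $\mathcal{LO}(G)$ is the set of all left-orderings of $G$, topologized as a subspace of $\{0,1\}^G$ (product topology) by identifying a left-ordering with the characteristic function of its set of positive elements. *)

theory Defs
  imports "HOL-Analysis.Analysis" "HOL-Algebra.Group"
begin

definition left_ordering :: "('a, 'b) monoid_scheme \<Rightarrow> 'a rel \<Rightarrow> bool" where
  "left_ordering G r \<longleftrightarrow>
     partial_order_on (carrier G) r \<and> total_on (carrier G) r \<and>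
     (\<forall>f\<in>carrier G. \<forall>g\<in>carrier G. \<forall>h\<in>carrier G.
        (g, h) \<in> r \<longrightarrow> (f \<otimes>\<^bsub>G\<^esub> g, f \<otimes>\<^bsub>G\<^esub> h) \<in> r)"

definition strictly :: "'a rel \<Rightarrow> 'a \<Rightarrow> 'a \<Rightarrow> bool" where
  "strictly r x y \<longleftrightarrow> (x, y) \<in> r \<and> x \<noteq> y"

definition C_ordering :: "('a, 'b) monoid_scheme \<Rightarrow> 'a rel \<Rightarrow> bool" where
  "C_ordering G r \<longleftrightarrow> left_ordering G r \<and>
     (\<forall>f\<in>carrier G. \<forall>g\<in>carrier G.
        strictly r \<one>\<^bsub>G\<^esub> f \<and> strictly r \<one>\<^bsub>G\<^esub> g \<longrightarrow>
        (\<exists>n::nat. n \<ge> 1 \<and> strictly r g (f \<otimes>\<^bsub>G\<^esub> (g [^]\<^bsub>G\<^esub> n))))"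

definition pos_char :: "('a, 'b) monoid_scheme \<Rightarrow> 'a rel \<Rightarrow> ('a \<Rightarrow> bool)" where
  "pos_char G r = (\<lambda>g\<in>carrier G. strictly r \<one>\<^bsub>G\<^esub> g)"

definition LO_space :: "('a, 'b) monoid_scheme \<Rightarrow> ('a \<Rightarrow> bool) topology" where
  "LO_space G = subtopology
     (product_topology (\<lambda>_. discrete_topology (UNIV :: bool set)) (carrier G))
     (pos_char G ` {r. left_ordering G r})"

definition cantor_set :: "real set" where
  "cantor_set = {x. \<exists>a::nat \<Rightarrow> nat. (\<forall>n. a n \<in> {0, 2}) \<and> x = (\<Sum>n. real (a n) / 3 ^ Suc n)}"

end

theory Submission
  imports Defs
begin

text \<open>A left-ordering is \<open>isolated\<close> if finitely many of its positive elements determine it. The space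
  of left-orderings is a closed subset of a power of two points; when the group is countable and no
  left-ordering is isolated, it is a nonempty compact metrizable zero-dimensional space without
  isolated points, that is, a Cantor set.

  In a Conradian order the jumps of convex subgroups are Archimedean, and each convex subgroup may be
  reversed. Hence a group with finitely many Conradian orders has finitely many convex subgroups; they
  form a normal series whose quotients have rank one, since an Archimedean order of higher rank can be
  perturbed. In particular the group is countable.

  Suppose that some left-ordering of a subgroup of such a group is isolated, and let \<open>S\<close> be the largest
  proper convex subgroup. By induction \<open>S\<close> has a chain of convex subgroups with rank one jumps on
  which elements act by negative factors. Intersecting with the normal series gives a normal subgroup
  \<open>A\<close> not inside \<open>S\<close> on which the order is Archimedean modulo \<open>S\<close>; either the group acts on the line by
  affine maps with \<open>S\<close> the stabilizer of a point, or \<open>A\<close> may be replaced by the next term. This shows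
  that \<open>S\<close> is normal. The top quotient then has rank one and acts on the jump below it by a negative
  factor, since otherwise affine actions would approximate the lexicographic order. Finally, a group
  with such a chain has only finitely many left-orderings: all terms of the chain are convex in each of
  them (Tararin).\<close>

text \<open>The Conradian orders and an isolated left-ordering are a priori unrelated: the latter
  need not be Conradian, so its convex subgroups need not be normal. This is the obstacle. It is why
  cones live on coset spaces, and why the normal series, extracted from a Conradian order, is
  intersected with subgroups that carry other orders. Two facts join the two sides. A cone among
  finitely many is isolated, so the same perturbation lemmas exclude higher rank and jumps moved by
  conjugation for Conradian orders, and positive factors for isolated ones. And rank one makes
  unknown functions multiples of known ones: real homomorphisms vanishing below the jump are
  proportional, so scale factors become exponentials of the jump homomorphism. Negative factors act
  twice: they contradict the cofinality that would hold if a term of the chain were not convex, and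
  they kill every positive character below the top term, so the scale by which \<open>S\<close> acts
  on \<open>A\<close> can only be visible on the top jump of \<open>S\<close>.\<close>

section \<open>Groups as a type class, and integer powers\<close>

class grp = monoid_mult +
  fixes iv :: "'a \<Rightarrow> 'a"
  assumes left_iv [simp]: "iv a * a = 1"
begin

lemma iv_mult_cancel [simp]: "iv a * (a * b) = b"
  by (simp flip: mult_assoc)

lemma right_iv [simp]: "a * iv a = 1"
  by (metis iv_mult_cancel left_iv mult_1_right)

lemma mult_iv_cancel [simp]: "a * (iv a * b) = b"
  by (simp flip: mult_assoc)

lemma iv_one [simp]: "iv 1 = 1"
  by (metis mult_1_left right_iv)

lemma iv_iv [simp]: "iv (iv a) = a"
  by (metis iv_mult_cancel mult_1_right right_iv)

lemma iv_mult [simp]: "iv (a * b) = iv b * iv a"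
proof -
  have "iv (a * b) * (a * b * (iv b * iv a)) = iv b * iv a"
    by simp
  then show ?thesis
    by (simp add: mult_assoc)
qed

lemma iv_mult_eq_one: "iv a * b = 1 \<longleftrightarrow> a = b"
  by (metis left_iv mult_iv_cancel mult_1_right)

lemma iv_power: "iv (a ^ n) = iv a ^ n"
  by (induction n) (auto simp: power_commutes)

lemma conj_power: "(h * a * iv h) ^ n = h * a ^ n * iv h"
  by (induction n) (auto simp: mult_assoc)

end

definition ipow :: "'g::grp \<Rightarrow> int \<Rightarrow> 'g" where
  "ipow x i = (if 0 \<le> i then x ^ nat i else iv x ^ nat (- i))"

lemma ipow_of_nat [simp]: "ipow x (int n) = x ^ n"
  by (simp add: ipow_def)

lemma ipow_0 [simp]: "ipow x 0 = 1"
  by (simp add: ipow_def)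

lemma ipow_1 [simp]: "ipow x 1 = x"
  by (simp add: ipow_def)

lemma ipow_minus: "ipow x (- i) = iv (ipow x i)"
  by (auto simp: ipow_def iv_power)

lemma ipow_Suc: "ipow x (i + 1) = ipow x i * x"
proof (cases "0 \<le> i")
  case True
  then show ?thesis
    by (simp add: ipow_def nat_add_distrib power_Suc2 flip: power_commutes)
next
  case False
  then have n: "nat (- i) = Suc (nat (- (i + 1)))"
    by simp
  have "ipow x i = iv x ^ nat (- i)"
    using False by (simp add: ipow_def)
  also have "\<dots> = iv x ^ nat (- (i + 1)) * iv x"
    unfolding n by (simp only: power_Suc2)
  finally have e: "ipow x i * x = iv x ^ nat (- (i + 1))"
    by (simp add: mult.assoc)
  show ?thesis
  proof (cases "i = - 1")
    case True
    then show ?thesis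
      by (simp add: ipow_def)
  next
    case i: False
    then show ?thesis
      using False unfolding e by (simp add: ipow_def)
  qed
qed

lemma ipow_add_nat: "ipow x (i + int n) = ipow x i * x ^ n"
proof (induction n)
  case (Suc n)
  have "ipow x (i + int (Suc n)) = ipow x ((i + int n) + 1)"
    by (simp add: algebra_simps)
  also have "\<dots> = ipow x i * x ^ Suc n"
    using Suc by (simp add: ipow_Suc power_Suc2 mult.assoc del: power_Suc)
  finally show ?case .
qed simp

lemma ipow_add: "ipow x (i + j) = ipow x i * ipow x j"
proof (cases "0 \<le> j")
  case True
  then show ?thesis
    using ipow_add_nat[of x i "nat j"] by (simp add: ipow_def)
next
  case False
  then have "ipow x i = ipow x (i + j) * x ^ nat (- j)"
    using ipow_add_nat[of x "i + j" "nat (- j)"] by simp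
  moreover have "ipow x j = iv (x ^ nat (- j))"
    using False by (simp add: ipow_def iv_power)
  ultimately show ?thesis
    by (simp add: mult.assoc)
qed

section \<open>Cones, convex subgroups and isolation\<close>

text \<open>A cone of the pair \<open>(H, N)\<close> is the set of
  elements \<open>h\<close> of \<open>H\<close> with \<open>N < h N\<close> for a left-invariant total order on the coset space \<open>H/N\<close>
  (\<open>N\<close> need not be normal); \<open>x\<close> is below \<open>y\<close> iff \<open>iv x * y\<close> lies in the cone. This allows one to
  speak about orders of subquotients while staying in a fixed group.\<close>

definition subgrp :: "'g::grp set \<Rightarrow> bool" where
  "subgrp H \<longleftrightarrow> 1 \<in> H \<and> (\<forall>x\<in>H. \<forall>y\<in>H. x * y \<in> H) \<and> (\<forall>x\<in>H. iv x \<in> H)"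

definition normal_in :: "'g::grp set \<Rightarrow> 'g set \<Rightarrow> bool" where
  "normal_in H N \<longleftrightarrow> (\<forall>h\<in>H. \<forall>x\<in>N. h * x * iv h \<in> N)"

definition cone :: "'g::grp set \<Rightarrow> 'g set \<Rightarrow> 'g set \<Rightarrow> bool" where
  "cone H N P \<longleftrightarrow> subgrp H \<and> subgrp N \<and> N \<subseteq> H \<and> P \<subseteq> H \<and> P \<inter> N = {} \<and>
     (\<forall>x\<in>P. \<forall>y\<in>P. x * y \<in> P) \<and> (\<forall>x\<in>H. x \<in> P \<or> x \<in> N \<or> iv x \<in> P)"

text \<open>Since \<open>1 < x < x * y\<close> for positive \<open>x\<close> and \<open>y\<close>,
  the last clause is convexity of intervals that start at 1; left invariance makes these intervals
  sufficient.\<close>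

definition cvx :: "'g::grp set \<Rightarrow> 'g set \<Rightarrow> 'g set \<Rightarrow> 'g set \<Rightarrow> bool" where
  "cvx H N P C \<longleftrightarrow> subgrp C \<and> N \<subseteq> C \<and> C \<subseteq> H \<and> (\<forall>x\<in>P. \<forall>y\<in>P. x * y \<in> C \<longrightarrow> x \<in> C)"

definition isolated :: "'g::grp set \<Rightarrow> 'g set \<Rightarrow> 'g set \<Rightarrow> bool" where
  "isolated H N P \<longleftrightarrow> cone H N P \<and>
     (\<exists>F. finite F \<and> F \<subseteq> P \<and> (\<forall>Q. cone H N Q \<longrightarrow> F \<subseteq> Q \<longrightarrow> Q = P))"

lemma subgrp_one: "subgrp H \<Longrightarrow> 1 \<in> H"
  and subgrp_mult: "subgrp H \<Longrightarrow> x \<in> H \<Longrightarrow> y \<in> H \<Longrightarrow> x * y \<in> H"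
  and subgrp_iv: "subgrp H \<Longrightarrow> x \<in> H \<Longrightarrow> iv x \<in> H"
  by (auto simp: subgrp_def)

lemma subgrp_iv_iff: "subgrp H \<Longrightarrow> iv x \<in> H \<longleftrightarrow> x \<in> H"
  by (metis iv_iv subgrp_iv)

lemma subgrp_pow: "subgrp H \<Longrightarrow> x \<in> H \<Longrightarrow> x ^ n \<in> H"
  by (induction n) (auto simp: subgrp_def)

lemma subgrp_zp: "subgrp H \<Longrightarrow> x \<in> H \<Longrightarrow> ipow x i \<in> H"
  by (auto simp: ipow_def subgrp_pow subgrp_iv)

lemma subgrp_Int: "subgrp H \<Longrightarrow> subgrp K \<Longrightarrow> subgrp (H \<inter> K)"
  by (auto simp: subgrp_def)

lemma subgrp_triv: "subgrp {1}"
  by (auto simp: subgrp_def)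

lemma subgrp_cancel_left: "subgrp H \<Longrightarrow> x \<in> H \<Longrightarrow> x * y \<in> H \<longleftrightarrow> y \<in> H"
  by (metis iv_mult_cancel subgrp_iv subgrp_mult)

lemma subgrp_cancel_right: "subgrp H \<Longrightarrow> y \<in> H \<Longrightarrow> x * y \<in> H \<longleftrightarrow> x \<in> H"
  using subgrp_mult[of H "x * y" "iv y"] by (auto simp: mult.assoc subgrp_iv subgrp_mult)

lemma normal_inD: "normal_in H N \<Longrightarrow> h \<in> H \<Longrightarrow> x \<in> N \<Longrightarrow> h * x * iv h \<in> N"
  by (auto simp: normal_in_def)

lemma normal_inD2: "normal_in H N \<Longrightarrow> subgrp H \<Longrightarrow> h \<in> H \<Longrightarrow> x \<in> N \<Longrightarrow> iv h * x * h \<in> N"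
  by (metis iv_iv normal_inD subgrp_iv)

lemma normal_in_conj_iff: "normal_in H N \<Longrightarrow> subgrp H \<Longrightarrow> h \<in> H \<Longrightarrow> h * x * iv h \<in> N \<longleftrightarrow> x \<in> N"
  using normal_inD2[of H N h "h * x * iv h"] normal_inD[of H N h x] by (auto simp: mult.assoc)

lemma normal_in_mono: "normal_in H N \<Longrightarrow> K \<subseteq> H \<Longrightarrow> normal_in K N"
  by (auto simp: normal_in_def)

lemma normal_in_Int: "normal_in H N \<Longrightarrow> normal_in H M \<Longrightarrow> normal_in H (N \<inter> M)"
  by (auto simp: normal_in_def)

lemma normal_in_self: "subgrp H \<Longrightarrow> normal_in H H"
  by (auto simp: normal_in_def subgrp_def)

lemma normal_in_triv: "normal_in H {1}"
  by (auto simp: normal_in_def)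

lemma coneI:
  assumes "subgrp H" "subgrp N" "N \<subseteq> H" "P \<subseteq> H" "\<And>x. x \<in> P \<Longrightarrow> x \<notin> N"
    "\<And>x y. x \<in> P \<Longrightarrow> y \<in> P \<Longrightarrow> x * y \<in> P" "\<And>x. x \<in> H \<Longrightarrow> x \<in> P \<or> x \<in> N \<or> iv x \<in> P"
  shows "cone H N P"
  using assms by (auto simp: cone_def)

lemma cone_sg: "cone H N P \<Longrightarrow> subgrp H" "cone H N P \<Longrightarrow> subgrp N"
  and cone_sub: "cone H N P \<Longrightarrow> N \<subseteq> H" "cone H N P \<Longrightarrow> P \<subseteq> H"
  and cone_disj: "cone H N P \<Longrightarrow> x \<in> P \<Longrightarrow> x \<notin> N"
  and cone_mult: "cone H N P \<Longrightarrow> x \<in> P \<Longrightarrow> y \<in> P \<Longrightarrow> x * y \<in> P"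
  and cone_total: "cone H N P \<Longrightarrow> x \<in> H \<Longrightarrow> x \<in> P \<or> x \<in> N \<or> iv x \<in> P"
  and cone_mem: "cone H N P \<Longrightarrow> x \<in> P \<Longrightarrow> x \<in> H" "cone H N P \<Longrightarrow> x \<in> N \<Longrightarrow> x \<in> H"
  by (auto simp: cone_def)

lemma cone_iv: "cone H N P \<Longrightarrow> x \<in> P \<Longrightarrow> iv x \<notin> P"
  using cone_mult[of H N P x "iv x"] cone_disj[of H N P 1] cone_sg(2)[of H N P] subgrp_one[of N] by auto

text \<open>Left translation by \<open>n\<close> fixes the coset \<open>N\<close> and preserves the
  order, hence preserves the cosets above \<open>N\<close>. With \<open>cone_PN\<close> this makes
  \<open>P\<close> a union of double cosets of \<open>N\<close>, as an order on \<open>H/N\<close>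
  requires when \<open>N\<close> is not normal.\<close>

lemma cone_NP:
  assumes "cone H N P" "n \<in> N" "x \<in> P"
  shows "n * x \<in> P"
proof -
  have H: "n * x \<in> H" "iv n \<in> N"
    using assms by (auto simp: cone_mem subgrp_mult cone_sg subgrp_iv)
  show ?thesis
  proof (rule ccontr)
    assume c: "n * x \<notin> P"
    then consider "n * x \<in> N" | "iv (n * x) \<in> P"
      using cone_total[OF assms(1) H(1)] by blast
    then show False
    proof cases
      case 1
      then have "x \<in> N"
        using assms by (metis cone_sg(2) subgrp_cancel_left)
      then show False
        using assms cone_disj by blast
    next
      case 2
      then have "x * iv (n * x) \<in> P"
        using assms cone_mult by blast
      then have "iv n \<in> P"
        by (simp add: mult.assoc)
      then show False
        using assms H(2) cone_disj by blast
    qed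
  qed
qed

lemma cone_PN:
  assumes "cone H N P" "n \<in> N" "x \<in> P"
  shows "x * n \<in> P"
proof -
  have H: "x * n \<in> H" "iv n \<in> N"
    using assms by (auto simp: cone_mem subgrp_mult cone_sg subgrp_iv)
  show ?thesis
  proof (rule ccontr)
    assume c: "x * n \<notin> P"
    then consider "x * n \<in> N" | "iv (x * n) \<in> P"
      using cone_total[OF assms(1) H(1)] by blast
    then show False
    proof cases
      case 1
      then have "x \<in> N"
        using assms by (metis cone_sg(2) subgrp_cancel_right)
      then show False
        using assms cone_disj by blast
    next
      case 2
      then have "n * iv (x * n) \<in> P"
        using assms cone_NP by blast
      then have "iv x \<in> P"
        by simp
      then show False
        using assms cone_iv by blast
    qed
  qed
qed

lemma cone_pow: "cone H N P \<Longrightarrow> x \<in> P \<Longrightarrow> 0 < n \<Longrightarrow> x ^ n \<in> P"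
proof (induction n)
  case (Suc n)
  then show ?case
    by (cases "n = 0") (auto simp: cone_mult)
qed simp

lemma cone_pow_P_iff:
  assumes "cone H N P" "x \<in> H" "0 < n"
  shows "x ^ n \<in> P \<longleftrightarrow> x \<in> P"
proof
  assume p: "x ^ n \<in> P"
  show "x \<in> P"
  proof (rule ccontr)
    assume "x \<notin> P"
    then consider "x \<in> N" | "iv x \<in> P"
      using assms cone_total by blast
    then show False
    proof cases
      case 1
      then have "x ^ n \<in> N"
        using assms by (simp add: cone_sg subgrp_pow)
      then show False
        using assms p cone_disj by blast
    next
      case 2
      then have "iv (x ^ n) \<in> P"
        unfolding iv_power using assms by (intro cone_pow)
      then show False
        using assms p cone_iv by blast
    qed
  qed
qed (use assms cone_pow in blast)

lemma cone_pow_N_iff: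
  assumes "cone H N P" "x \<in> H" "0 < n"
  shows "x ^ n \<in> N \<longleftrightarrow> x \<in> N"
proof
  assume p: "x ^ n \<in> N"
  show "x \<in> N"
  proof (rule ccontr)
    assume "x \<notin> N"
    then consider "x \<in> P" | "iv x \<in> P"
      using assms cone_total by blast
    then show False
    proof cases
      case 1
      then show False
        using cone_pow_P_iff[OF assms] p cone_disj[OF assms(1)] by blast
    next
      case 2
      then have "iv (x ^ n) \<in> P"
        unfolding iv_power using assms by (intro cone_pow)
      then show False
        using assms p cone_disj by (metis cone_sg(2) subgrp_iv)
    qed
  qed
qed (use assms in \<open>simp add: cone_sg subgrp_pow\<close>)

lemma cone_eqI:
  assumes "cone H N P" "cone H N Q" "P \<subseteq> Q"
  shows "P = Q"
proof
  show "Q \<subseteq> P"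
  proof
    fix x assume x: "x \<in> Q"
    then have "x \<in> H" "x \<notin> N" "iv x \<notin> Q"
      using assms cone_mem cone_disj cone_iv by blast+
    then show "x \<in> P"
      using assms cone_total by blast
  qed
qed fact

lemma cvx_sg: "cvx H N P C \<Longrightarrow> subgrp C"
  and cvx_sub: "cvx H N P C \<Longrightarrow> N \<subseteq> C" "cvx H N P C \<Longrightarrow> C \<subseteq> H"
  by (auto simp: cvx_def)

lemma cvx_between: "cvx H N P C \<Longrightarrow> x \<in> P \<Longrightarrow> iv x * y \<in> P \<Longrightarrow> y \<in> C \<Longrightarrow> x \<in> C"
  unfolding cvx_def by (metis mult_iv_cancel)

text \<open>Convexity is exactly closure of \<open>P - C\<close> under products. The quotient is
  again a mere coset space; \<open>C\<close> need not be normal.\<close>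

lemma cvx_cone_above:
  assumes "cone H N P" "cvx H N P C"
  shows "cone H C (P - C)"
proof -
  have "x * y \<notin> C" if "x \<in> P - C" "y \<in> P - C" for x y
    using that assms(2) unfolding cvx_def by blast
  moreover have "iv x \<notin> C" if "x \<in> H" "x \<notin> C" for x
    using that assms(2) by (simp add: cvx_def subgrp_iv_iff)
  moreover have "x \<in> P \<or> x \<in> C \<or> iv x \<in> P" if "x \<in> H" for x
    using cone_total[OF assms(1) that] assms(2) by (auto simp: cvx_def)
  ultimately show ?thesis
    using assms by (intro coneI) (auto simp: cvx_sg cvx_sub cone_sg cone_mem cone_mult dest: cvx_sub)
qed

lemma cvx_cone_below:
  assumes "cone H N P" "cvx H N P C"
  shows "cone C N (P \<inter> C)"
proof (rule coneI)
  show "x \<in> P \<inter> C \<or> x \<in> N \<or> iv x \<in> P \<inter> C" if "x \<in> C" for x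
    using that assms cone_total[of H N P x] by (auto simp: subgrp_iv cvx_def)
qed (use assms in \<open>auto simp: cvx_sg cvx_sub cone_sg cone_mult cone_disj subgrp_mult dest: cvx_sub\<close>)

lemma cone_restrict:
  assumes "cone H N P" "subgrp K" "K \<subseteq> H"
  shows "cone K (N \<inter> K) (P \<inter> K)"
  using assms by (intro coneI) (auto simp: cone_sg subgrp_Int cone_mult subgrp_mult subgrp_iv cone_disj dest: cone_total)

text \<open>Lexicographic order: \<open>X\<close> decides outside \<open>C\<close> and
  \<open>Y\<close> inside. It inverts the splitting by \<open>cvx_cone_above\<close> and
  \<open>cvx_cone_below\<close>, which allows either part of an order to be replaced
  separately.\<close>

lemma cone_lex:
  assumes "cone H C X" "cone C N Y"
  shows "cone H N (X \<union> Y)" "cvx H N (X \<union> Y) C" "(X \<union> Y) - C = X" "(X \<union> Y) \<inter> C = Y"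
proof -
  have *: "X \<inter> C = {}" "Y \<subseteq> C" "N \<subseteq> C" "C \<subseteq> H" "Y \<inter> N = {}" "X \<subseteq> H" "subgrp H" "subgrp C" "subgrp N"
    using assms by (auto simp: cone_def)
  then show 3: "(X \<union> Y) - C = X" "(X \<union> Y) \<inter> C = Y"
    by auto
  have XY: "x * y \<in> X \<union> Y" if "x \<in> X \<union> Y" "y \<in> X \<union> Y" for x y
    using that subsetD[OF *(2)] by (elim UnE)
      (auto simp: cone_mult[OF assms(1)] cone_mult[OF assms(2)] cone_NP[OF assms(1)] cone_PN[OF assms(1)])
  have XN: "x * y \<in> C \<longrightarrow> x \<in> C" if "x \<in> X \<union> Y" "y \<in> X \<union> Y" for x y
    using that subsetD[OF *(2)] cone_disj[OF assms(1), of "x * y"]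
    by (elim UnE) (auto simp: cone_mult[OF assms(1)] cone_PN[OF assms(1)])
  show "cone H N (X \<union> Y)"
  proof (rule coneI)
    show "x \<in> X \<union> Y \<or> x \<in> N \<or> iv x \<in> X \<union> Y" if "x \<in> H" for x
      using cone_total[OF assms(1) that] cone_total[OF assms(2), of x] by blast
    show "x * y \<in> X \<union> Y" if "x \<in> X \<union> Y" "y \<in> X \<union> Y" for x y
      using XY that .
  qed (use * in auto)
  show "cvx H N (X \<union> Y) C"
    unfolding cvx_def using * XN by blast
qed

lemma cvx_trans:
  assumes "cone H N P" "cvx H N P C" "cvx C N (P \<inter> C) D"
  shows "cvx H N P D"
proof -
  have "x \<in> C \<and> y \<in> C" if "x \<in> P" "y \<in> P" "x * y \<in> D" for x y
    using that assms unfolding cvx_def by (metis subgrp_cancel_left subsetD)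
  then show ?thesis
    using assms unfolding cvx_def by blast
qed

text \<open>Of a positive element in \<open>C - D\<close> and one in \<open>D - C\<close>, the
  smaller lies below the larger and hence in both subgroups.\<close>

lemma cvx_chain:
  assumes "cone H N P" "cvx H N P C" "cvx H N P D"
  shows "C \<subseteq> D \<or> D \<subseteq> C"
proof (rule ccontr)
  assume "\<not> ?thesis"
  then obtain x y where xy: "x \<in> C" "x \<notin> D" "y \<in> D" "y \<notin> C"
    by blast
  have pos: "\<exists>x. x \<in> C' \<and> x \<notin> D' \<and> x \<in> P"
    if "cvx H N P C'" "cvx H N P D'" "x \<in> C'" "x \<notin> D'" for C' D' x
    using that cone_total[OF assms(1), of x] unfolding cvx_def
    by (metis subgrp_iv subgrp_iv_iff subsetD)
  obtain x where x: "x \<in> C" "x \<notin> D" "x \<in> P"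
    using pos assms xy by blast
  obtain y where y: "y \<in> D" "y \<notin> C" "y \<in> P"
    using pos assms xy by blast
  have "iv x * y \<in> H"
    using assms(1) x y by (simp add: cone_mem cone_sg subgrp_iv subgrp_mult)
  then consider "iv x * y \<in> P" | "iv x * y \<in> N" | "iv (iv x * y) \<in> P"
    using assms cone_total by blast
  then show False
  proof cases
    case 1
    then show False
      using cvx_between[OF assms(3) x(3) 1 y(1)] x by blast
  next
    case 2
    then have "x * (iv x * y) \<in> C"
      using assms x by (meson cvx_sg cvx_sub(1) subgrp_mult subsetD)
    then show False
      using y by simp
  next
    case 3
    then show False
      using cvx_between[OF assms(2) y(3) _ x(1)] y by simp
  qed
qed

text \<open>Convex subgroups are closed under roots because \<open>H/C\<close> is ordered. With rank
  one this lets membership spread from one element to all commensurable ones.\<close>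

lemma cvx_pow:
  assumes "cone H N P" "cvx H N P C" "x \<in> H" "0 < n" "x ^ n \<in> C"
  shows "x \<in> C"
  using cone_pow_N_iff[OF cvx_cone_above[OF assms(1,2)] assms(3,4)] assms(5) by blast

lemma cvx_triv: "cone H N P \<Longrightarrow> cvx H N P N"
  using cone_mult[of H N P] cone_disj[of H N P] by (auto simp: cone_sg cone_sub cvx_def)

lemma cvx_self: "cone H N P \<Longrightarrow> cvx H N P H"
  by (auto simp: cone_mem cone_sg cvx_def)

lemma isolated_cone: "isolated H N P \<Longrightarrow> cone H N P"
  by (simp add: isolated_def)

text \<open>A competitor on \<open>H/C\<close>, completed lexicographically by the given order on
  \<open>C\<close>, competes with \<open>P\<close> itself.\<close>

lemma isolated_above:
  assumes "isolated H N P" "cvx H N P C"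
  shows "isolated H C (P - C)"
proof -
  obtain F where F: "finite F" "F \<subseteq> P" "\<And>Q. cone H N Q \<Longrightarrow> F \<subseteq> Q \<Longrightarrow> Q = P"
    using assms(1) by (auto simp: isolated_def)
  note c = isolated_cone[OF assms(1)]
  have "Q = P - C" if Q: "cone H C Q" "F - C \<subseteq> Q" for Q
  proof -
    note l = cone_lex[OF Q(1) cvx_cone_below[OF c assms(2)]]
    have "Q \<union> (P \<inter> C) = P"
      using F(2) Q(2) by (intro F(3) l) blast
    then show ?thesis
      using l(3) by simp
  qed
  then show ?thesis
    unfolding isolated_def using cvx_cone_above[OF c assms(2)] F(1,2)
    by (intro conjI exI[of _ "F - C"]) auto
qed

lemma isolated_below:
  assumes "isolated H N P" "cvx H N P C"
  shows "isolated C N (P \<inter> C)"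
proof -
  obtain F where F: "finite F" "F \<subseteq> P" "\<And>Q. cone H N Q \<Longrightarrow> F \<subseteq> Q \<Longrightarrow> Q = P"
    using assms(1) by (auto simp: isolated_def)
  note c = isolated_cone[OF assms(1)]
  have "Q = P \<inter> C" if Q: "cone C N Q" "F \<inter> C \<subseteq> Q" for Q
  proof -
    note l = cone_lex[OF cvx_cone_above[OF c assms(2)] Q(1)]
    have "(P - C) \<union> Q = P"
      using F(2) Q(2) by (intro F(3) l) blast
    then show ?thesis
      using l(4) by simp
  qed
  then show ?thesis
    unfolding isolated_def using cvx_cone_below[OF c assms(2)] F(1,2)
    by (intro conjI exI[of _ "F \<inter> C"]) auto
qed

text \<open>One element of \<open>P\<close> missed by each competitor suffices. Through this lemma
  the perturbation results also apply to finite families of orders.\<close>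

lemma isolated_if_finite:
  assumes "cone H N P" "finite {Q. cone H N Q}"
  shows "isolated H N P"
proof -
  have "\<exists>x. x \<in> P \<and> x \<notin> Q" if "cone H N Q" "Q \<noteq> P" for Q
    using cone_eqI[OF assms(1) that(1)] that(2) by blast
  then obtain f where f: "\<And>Q. cone H N Q \<Longrightarrow> Q \<noteq> P \<Longrightarrow> f Q \<in> P \<and> f Q \<notin> Q"
    by metis
  have "finite (f ` {Q. cone H N Q \<and> Q \<noteq> P})"
    using assms(2) by (auto intro: finite_subset)
  moreover have "f ` {Q. cone H N Q \<and> Q \<noteq> P} \<subseteq> P"
    using f by auto
  moreover have "Q = P" if "cone H N Q" "f ` {Q. cone H N Q \<and> Q \<noteq> P} \<subseteq> Q" for Q
    using f that by blast
  ultimately show ?thesis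
    unfolding isolated_def using assms(1) by blast
qed

section \<open>Convex hulls of normal subgroups, and conjugation of positive elements\<close>

definition chull :: "'g::grp set \<Rightarrow> 'g set \<Rightarrow> 'g set \<Rightarrow> 'g set" where
  "chull H P A = {h\<in>H. (\<exists>a\<in>A. iv h * a \<in> P) \<and> (\<exists>a\<in>A. iv a * h \<in> P)}"

lemma chullI:
  "h \<in> H \<Longrightarrow> a \<in> A \<Longrightarrow> iv h * a \<in> P \<Longrightarrow> b \<in> A \<Longrightarrow> iv b * h \<in> P \<Longrightarrow> h \<in> chull H P A"
  unfolding chull_def by blast

text \<open>Normality of \<open>A\<close> bounds products: if \<open>x < a\<close> and
  \<open>y < b\<close>, then \<open>x * y < x * b = (x * b * iv x) * x < (x * b * iv x) * a\<close>.
  The positive \<open>p\<close> compensates for the strict inequalities in \<open>chull\<close>,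
  since \<open>a * iv p < a < a * p\<close>.\<close>

lemma chull_cvx:
  assumes c: "cone H N P" and A: "subgrp A" "A \<subseteq> H" "normal_in H A" and p: "p \<in> A" "p \<in> P"
  shows "cvx H N P (chull H P A)" "A \<subseteq> chull H P A"
proof -
  note sH = cone_sg(1)[OF c]
  have mul: "x * y \<in> chull H P A" if xy: "x \<in> chull H P A" "y \<in> chull H P A" for x y
  proof -
    obtain a b where ab: "a \<in> A" "b \<in> A" "iv x * a \<in> P" "iv y * b \<in> P"
      using xy by (auto simp: chull_def)
    obtain a' b' where ab': "a' \<in> A" "b' \<in> A" "iv a' * x \<in> P" "iv b' * y \<in> P"
      using xy by (auto simp: chull_def)
    have xH: "x \<in> H" "y \<in> H"
      using xy by (auto simp: chull_def)
    have "x * b * iv x * a \<in> A" "x * b' * iv x * a' \<in> A"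
      using A ab ab' xH by (meson normal_inD subgrp_mult)+
    moreover have "iv (x * y) * (x * b * iv x * a) \<in> P"
      using cone_mult[OF c ab(4,3)] by (simp add: mult.assoc)
    moreover have "iv (x * b' * iv x * a') * (x * y) \<in> P"
      using cone_mult[OF c ab'(3,4)] by (simp add: mult.assoc)
    ultimately show ?thesis
      by (intro chullI[of "x * y"]) (use xH sH in \<open>simp_all only: subgrp_mult\<close>)
  qed
  have inv: "iv x \<in> chull H P A" if xy: "x \<in> chull H P A" for x
  proof -
    obtain a a' where a: "a \<in> A" "a' \<in> A" "iv x * a \<in> P" "iv a' * x \<in> P" "x \<in> H"
      using xy by (auto simp: chull_def)
    have "iv x * iv a * x \<in> A" "iv x * iv a' * x \<in> A"
      using a A sH by (meson normal_inD2 subgrp_iv)+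
    moreover have "iv (iv x * iv a * x) * iv x \<in> P" "iv (iv x) * (iv x * iv a' * x) \<in> P"
      using a by (auto simp: mult.assoc)
    ultimately show ?thesis
      by (intro chullI[of "iv x"]) (use a sH in \<open>simp_all only: subgrp_iv\<close>)
  qed
  show sub: "A \<subseteq> chull H P A"
  proof
    fix a assume a: "a \<in> A"
    then have "a * p \<in> A" "a * iv p \<in> A"
      using A p by (auto simp: subgrp_mult subgrp_iv)
    moreover have "iv a * (a * p) \<in> P" "iv (a * iv p) * a \<in> P"
      using p by (auto simp: mult.assoc)
    ultimately show "a \<in> chull H P A"
      by (intro chullI[of a]) (use a A in \<open>auto simp only:\<close>)
  qed
  have "subgrp (chull H P A)"
    unfolding subgrp_def using mul inv sub subgrp_one[OF A(1)] by blast
  moreover have "N \<subseteq> chull H P A"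
  proof
    fix n assume n: "n \<in> N"
    have "iv n * p \<in> P" "iv (iv p) * n \<in> P" "iv p \<in> A"
      using n p c A by (auto simp: cone_NP cone_PN cone_sg subgrp_iv)
    then show "n \<in> chull H P A"
      by (intro chullI[of n]) (use n p c in \<open>auto simp only: cone_mem\<close>)
  qed
  moreover have "x \<in> chull H P A" if xy: "x \<in> P" "y \<in> P" "x * y \<in> chull H P A" for x y
  proof -
    obtain a where a: "a \<in> A" "iv (x * y) * a \<in> P"
      using xy by (auto simp: chull_def)
    have "y * (iv (x * y) * a) \<in> P"
      using a that c cone_mult by blast
    then have "iv x * a \<in> P"
      by (simp add: mult.assoc)
    moreover have "iv (iv p) * x \<in> P" "iv p \<in> A"
      using xy p c A by (auto simp: cone_mult subgrp_iv)
    ultimately show ?thesis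
      by (intro chullI[of x]) (use a xy c in \<open>auto simp only: cone_mem\<close>)
  qed
  moreover have "chull H P A \<subseteq> H"
    by (auto simp: chull_def)
  ultimately show "cvx H N P (chull H P A)"
    unfolding cvx_def by blast
qed

text \<open>If \<open>x\<close> is positive and \<open>b = iv x * a * x\<close> is negative, then \<open>a ^ n * x = x * b ^ n < x\<close> for
  all \<open>n\<close>, so that the powers of \<open>a\<close> are not cofinal.\<close>

lemma conj_pos:
  assumes c: "cone H N P" and Y: "Y \<subseteq> H" "\<And>y. y \<in> Y \<Longrightarrow> y \<in> P \<or> iv y \<in> P"
    "\<And>y. y \<in> Y \<Longrightarrow> iv y \<in> Y" "\<And>h y. h \<in> H \<Longrightarrow> y \<in> Y \<Longrightarrow> h * y * iv h \<in> Y"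
    and cof: "\<And>a h. a \<in> Y \<Longrightarrow> a \<in> P \<Longrightarrow> h \<in> H \<Longrightarrow> \<exists>n. iv h * a ^ n \<in> P"
    and a: "a \<in> Y" "a \<in> P" and h: "h \<in> H"
  shows "h * a * iv h \<in> P"
proof -
  have key: "iv x * a * x \<in> P" if a: "a \<in> Y" "a \<in> P" and x: "x \<in> P" for a x
  proof (rule ccontr)
    assume n: "iv x * a * x \<notin> P"
    have xH: "x \<in> H" "iv x \<in> H"
      using x c by (auto simp: cone_mem cone_sg subgrp_iv)
    then have "iv (iv x * a * x) \<in> P"
      using Y(4)[of "iv x" a] Y(2) a n by fastforce
    moreover obtain n where n: "iv x * a ^ n \<in> P"
      using cof a xH by blast
    have "n \<noteq> 0"
      using n x c cone_iv by (intro notI) auto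
    ultimately have "iv (iv x * a * x) ^ n \<in> P"
      using c cone_pow by blast
    then have "x * iv (iv x * a * x) ^ n \<in> P"
      using c x cone_mult by blast
    moreover have "iv (iv x * a * x) ^ n = iv x * iv (a ^ n) * x"
      using conj_power[of "iv x" "iv a" n] by (simp add: iv_power mult.assoc)
    ultimately have "iv (iv x * a ^ n) \<in> P"
      by (simp add: mult.assoc)
    then show False
      using n c cone_iv by blast
  qed
  consider "h \<in> P" | "h \<in> N" | "iv h \<in> P"
    using c h cone_total by blast
  then show ?thesis
  proof cases
    case 1
    show ?thesis
    proof (rule ccontr)
      assume "h * a * iv h \<notin> P"
      then have "iv (h * a * iv h) \<in> P" "iv (h * a * iv h) \<in> Y"
        using Y a h by blast+
      then have "iv h * iv (h * a * iv h) * h \<in> P"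
        using key 1 by blast
      then show False
        using a c cone_iv by (simp add: mult.assoc) blast
    qed
  next
    case 2
    then show ?thesis
      using c a by (simp add: cone_NP cone_PN cone_sg subgrp_iv)
  next
    case 3
    then show ?thesis
      using key[OF a 3] by simp
  qed
qed

section \<open>Homomorphisms to the reals and the cones they induce\<close>

definition hm :: "'g::grp set \<Rightarrow> ('g \<Rightarrow> real) \<Rightarrow> bool" where
  "hm H \<phi> \<longleftrightarrow> (\<forall>x\<in>H. \<forall>y\<in>H. \<phi> (x * y) = \<phi> x + \<phi> y)"

definition ohom :: "'g::grp set \<Rightarrow> 'g set \<Rightarrow> 'g set \<Rightarrow> ('g \<Rightarrow> real) \<Rightarrow> bool" where
  "ohom H N P \<phi> \<longleftrightarrow> subgrp H \<and> hm H \<phi> \<and> P = {x\<in>H. 0 < \<phi> x} \<and> N = {x\<in>H. \<phi> x = 0}"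

text \<open>This expresses that \<open>H/N\<close> is torsion-free abelian of rank at most one,
  without choosing an order on it; \<open>qhom_orient\<close> relates it to a given cone.\<close>

definition qhom :: "'g::grp set \<Rightarrow> 'g set \<Rightarrow> ('g \<Rightarrow> real) \<Rightarrow> bool" where
  "qhom H N \<phi> \<longleftrightarrow> subgrp H \<and> hm H \<phi> \<and> N = {x\<in>H. \<phi> x = 0} \<and> \<phi> ` H \<subseteq> \<rat>"

lemma hm_mult: "hm H \<phi> \<Longrightarrow> x \<in> H \<Longrightarrow> y \<in> H \<Longrightarrow> \<phi> (x * y) = \<phi> x + \<phi> y"
  by (auto simp: hm_def)

lemma hm_one: "hm H \<phi> \<Longrightarrow> subgrp H \<Longrightarrow> \<phi> 1 = 0"
  using hm_mult[of H \<phi> 1 1] by (simp add: subgrp_one)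

lemma hm_iv: "hm H \<phi> \<Longrightarrow> subgrp H \<Longrightarrow> x \<in> H \<Longrightarrow> \<phi> (iv x) = - \<phi> x"
  using hm_mult[of H \<phi> x "iv x"] by (simp add: subgrp_iv hm_one)

lemma hm_pow: "hm H \<phi> \<Longrightarrow> subgrp H \<Longrightarrow> x \<in> H \<Longrightarrow> \<phi> (x ^ n) = real n * \<phi> x"
  by (induction n) (auto simp: hm_mult subgrp_pow hm_one algebra_simps)

lemma hm_zp: "hm H \<phi> \<Longrightarrow> subgrp H \<Longrightarrow> x \<in> H \<Longrightarrow> \<phi> (ipow x i) = real_of_int i * \<phi> x"
  by (auto simp: ipow_def hm_pow hm_iv subgrp_iv)

lemma hm_conj: "hm H \<phi> \<Longrightarrow> subgrp H \<Longrightarrow> x \<in> H \<Longrightarrow> h \<in> H \<Longrightarrow> \<phi> (h * x * iv h) = \<phi> x"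
  by (simp add: hm_mult hm_iv subgrp_iv subgrp_mult)

lemma hm_mono: "hm H \<phi> \<Longrightarrow> K \<subseteq> H \<Longrightarrow> hm K \<phi>"
  by (auto simp: hm_def)

lemmas hm_simps = hm_mult hm_iv hm_pow hm_zp hm_one subgrp_mult subgrp_iv subgrp_pow subgrp_zp

lemma ohomD:
  assumes "ohom H N P \<phi>"
  shows "subgrp H" "hm H \<phi>" "\<And>x. x \<in> P \<longleftrightarrow> x \<in> H \<and> 0 < \<phi> x" "\<And>x. x \<in> N \<longleftrightarrow> x \<in> H \<and> \<phi> x = 0"
  using assms by (auto simp: ohom_def)

lemma qhomD:
  assumes "qhom H N \<phi>"
  shows "subgrp H" "hm H \<phi>" "\<And>x. x \<in> N \<longleftrightarrow> x \<in> H \<and> \<phi> x = 0" "\<And>x. x \<in> H \<Longrightarrow> \<phi> x \<in> \<rat>"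
  using assms by (auto simp: qhom_def)

lemma kernel_sg: "subgrp H \<Longrightarrow> hm H \<phi> \<Longrightarrow> subgrp {x\<in>H. \<phi> x = 0}"
  by (auto simp: subgrp_def hm_simps)

lemma ohom_cone:
  assumes "ohom H N P \<phi>"
  shows "cone H N P"
  using assms kernel_sg[of H \<phi>] unfolding ohom_def
  by (intro coneI) (auto simp: hm_simps)

lemma hm_conj':
  assumes "hm H \<phi>" "subgrp H" "x \<in> H" "h \<in> H" "\<phi> x = c"
  shows "h * x * iv h \<in> H \<and> \<phi> (h * x * iv h) = c"
  using assms by (simp add: hm_conj subgrp_mult subgrp_iv)

lemma ohom_normal: "ohom H N P \<phi> \<Longrightarrow> normal_in H N"
  using hm_conj'[of H \<phi>] by (simp add: normal_in_def ohom_def)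

lemma qhom_normal: "qhom H N \<phi> \<Longrightarrow> normal_in H N"
  using hm_conj'[of H \<phi>] by (simp add: normal_in_def qhom_def)

lemma ohom_commutator:
  "ohom H N P \<phi> \<Longrightarrow> x \<in> H \<Longrightarrow> y \<in> H \<Longrightarrow> x * y * iv x * iv y \<in> N"
  by (simp add: ohom_def hm_mult[of H] hm_iv[of H] subgrp_mult subgrp_iv)

lemma qhom_restrict: "qhom H N \<phi> \<Longrightarrow> subgrp K \<Longrightarrow> K \<subseteq> H \<Longrightarrow> qhom K (N \<inter> K) \<phi>"
  by (auto simp: qhom_def hm_def image_subset_iff)

section \<open>Archimedean orders\<close>

text \<open>The factors can be sorted one exchange at a time, each exchange moving the product in
  the same direction. The relation is left abstract so that the case \<open>y * x\<close> below
  \<open>x * y\<close> is covered by the reversed relation.\<close>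

lemma pow_commute_le:
  fixes le :: "'g::grp \<Rightarrow> 'g \<Rightarrow> bool"
  assumes H: "subgrp H" "x \<in> H" "y \<in> H"
    and refl: "\<And>u. u \<in> H \<Longrightarrow> le u u"
    and trans: "\<And>u v w. u \<in> H \<Longrightarrow> v \<in> H \<Longrightarrow> w \<in> H \<Longrightarrow> le u v \<Longrightarrow> le v w \<Longrightarrow> le u w"
    and left: "\<And>u v w. u \<in> H \<Longrightarrow> v \<in> H \<Longrightarrow> w \<in> H \<Longrightarrow> le u v \<Longrightarrow> le (w * u) (w * v)"
    and right: "\<And>u v w. u \<in> H \<Longrightarrow> v \<in> H \<Longrightarrow> w \<in> H \<Longrightarrow> le u v \<Longrightarrow> le (u * w) (v * w)"
    and xy: "le (x * y) (y * x)"
  shows "le (x ^ n * y ^ n) ((x * y) ^ n)" "le ((x * y) ^ n) (y ^ n * x ^ n)"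
proof -
  note [simp] = H subgrp_mult subgrp_pow
  have 1: "le (x ^ n * y) (y * x ^ n)" for n
  proof (induction n)
    case (Suc n)
    have "le (x * (x ^ n * y)) (x * (y * x ^ n))"
      using Suc by (intro left) auto
    moreover have "le ((x * y) * x ^ n) ((y * x) * x ^ n)"
      using xy by (intro right) auto
    ultimately show ?case
      using trans[of "x * (x ^ n * y)" "x * (y * x ^ n)" "y * x * x ^ n"] by (simp add: mult.assoc)
  qed (simp add: refl subgrp_one[OF H(1)])
  have 2: "le (x * y ^ n) (y ^ n * x)" for n
  proof (induction n)
    case (Suc n)
    have "le (y * (x * y ^ n)) (y * (y ^ n * x))"
      using Suc by (intro left) auto
    moreover have "le ((x * y) * y ^ n) ((y * x) * y ^ n)"
      using xy by (intro right) auto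
    ultimately show ?case
      using trans[of "x * y * y ^ n" "y * (x * y ^ n)" "y * (y ^ n * x)"] by (simp add: mult.assoc)
  qed (simp add: refl subgrp_one[OF H(1)])
  show "le (x ^ n * y ^ n) ((x * y) ^ n)"
  proof (induction n)
    case (Suc n)
    have "le (x * ((x ^ n * y) * y ^ n)) (x * ((y * x ^ n) * y ^ n))"
      using 1 by (intro left right) auto
    moreover have "le ((x * y) * (x ^ n * y ^ n)) ((x * y) * (x * y) ^ n)"
      using Suc by (intro left) auto
    ultimately show ?case
      using trans[of "x * (x ^ n * y * y ^ n)" "x * (y * x ^ n * y ^ n)" "(x * y) * (x * y) ^ n"]
      by (simp add: mult.assoc)
  qed (simp add: refl subgrp_one[OF H(1)])
  show "le ((x * y) ^ n) (y ^ n * x ^ n)"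
  proof (induction n)
    case (Suc n)
    have "le ((x * y) * (x * y) ^ n) ((x * y) * (y ^ n * x ^ n))"
      using Suc by (intro left) auto
    moreover have "le ((x * y ^ Suc n) * x ^ n) ((y ^ Suc n * x) * x ^ n)"
      using 2[of "Suc n"] by (intro right) auto
    ultimately show ?case
      using trans[of "(x * y) * (x * y) ^ n" "(x * y) * (y ^ n * x ^ n)" "y ^ Suc n * x * x ^ n"]
      by (simp add: mult.assoc)
  qed (simp add: refl subgrp_one[OF H(1)])
qed

lemma int_greatest_ex:
  fixes Q :: "int \<Rightarrow> bool"
  assumes "Q p0" "\<And>p. Q p \<Longrightarrow> p \<le> b"
  shows "\<exists>p. Q p \<and> (\<forall>q. Q q \<longrightarrow> q \<le> p)"
proof -
  define S where "S = {p. Q p \<and> p0 \<le> p}"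
  have S: "finite S" "S \<noteq> {}"
    using assms by (auto simp: S_def intro: finite_subset[of _ "{p0..b}"])
  then have "Q (Max S)" and m: "\<And>p. p \<in> S \<Longrightarrow> p \<le> Max S" "p0 \<le> Max S"
    using Max_in[OF S] by (auto simp: S_def)
  moreover have "q \<le> Max S" if "Q q" for q
    using that m(1)[of q] m(2) by (cases "p0 \<le> q") (auto simp: S_def)
  ultimately show ?thesis
    by blast
qed

text \<open>The map \<open>f\<close> sends \<open>x\<close> to the largest \<open>p\<close> with \<open>a ^ p \<le> x\<close>; it is
  additive up to a bounded error, and \<open>\<phi>\<close> is its homogenization.\<close>

theorem hoelder:
  assumes c: "cone H N P" and n: "normal_in H N"
    and arch: "\<And>a h. a \<in> P \<Longrightarrow> h \<in> H \<Longrightarrow> \<exists>n. iv h * a ^ n \<in> P"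
  shows "\<exists>\<phi>. ohom H N P \<phi>"
proof (cases "P = {}")
  case True
  then have "N = H"
    using c cone_total[OF c] cone_sub[OF c] by auto
  then show ?thesis
    using True c by (intro exI[of _ "\<lambda>_. 0"]) (auto simp: ohom_def hm_def cone_sg)
next
  case False
  then obtain a where a: "a \<in> P"
    by blast
  note sH = cone_sg(1)[OF c] and sN = cone_sg(2)[OF c]
  have PH: "x \<in> P \<Longrightarrow> x \<in> H" and NH: "x \<in> N \<Longrightarrow> x \<in> H" for x
    using cone_mem[OF c] by blast+
  note mem = subgrp_mult[OF sH] subgrp_iv[OF sH] subgrp_pow[OF sH] subgrp_zp[OF sH]
  have aH: "a \<in> H"
    using a PH by blast
  \<comment> \<open>An Archimedean left order is bi-invariant: powers of positive elements are
    cofinal, so \<open>conj_pos\<close> applies to all elements outside \<open>N\<close>.\<close>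
  have biP: "h * x * iv h \<in> P" if "h \<in> H" "x \<in> P" for h x
  proof (rule conj_pos[OF c, of "H - N"])
    show "h * y * iv h \<in> H - N" if "h \<in> H" "y \<in> H - N" for h y
      using that normal_in_conj_iff[OF n sH, of h y] by (auto simp: mem)
    show "y \<in> P \<or> iv y \<in> P" if "y \<in> H - N" for y
      using cone_total[OF c] that by blast
  qed (use that arch PH cone_disj[OF c] subgrp_iv_iff[OF sN] mem in auto)
  have biP': "iv h * x * h \<in> P" if "h \<in> H" "x \<in> P" for h x
    using biP[of "iv h" x] that by (simp add: mem)
  define le :: "'a \<Rightarrow> 'a \<Rightarrow> bool" where "le x y \<longleftrightarrow> iv x * y \<in> P \<or> iv x * y \<in> N" for x y
  have refl: "le u u" for u
    by (simp add: le_def subgrp_one[OF sN])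
  have trans: "le u w" if "le u v" "le v w" for u v w
  proof -
    have e: "iv u * w = (iv u * v) * (iv v * w)"
      by (simp add: mult.assoc)
    show ?thesis
      using that unfolding le_def e
      by (auto intro: cone_mult[OF c] cone_NP[OF c] cone_PN[OF c] subgrp_mult[OF sN])
  qed
  have left: "le (w * u) (w * v)" if "le u v" for u v w
    using that by (simp add: le_def mult.assoc)
  have right: "le (u * w) (v * w)" if "w \<in> H" "le u v" for u v w
    using that biP'[of w "iv u * v"] normal_inD2[OF n sH, of w "iv u * v"]
    by (auto simp: le_def mult.assoc)
  have nle: "\<not> le u v \<longleftrightarrow> iv v * u \<in> P" if "u \<in> H" "v \<in> H" for u v
  proof -
    have "iv u * v \<in> H"
      using that by (simp add: mem)
    moreover have "iv v * u = iv (iv u * v)"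
      by simp
    ultimately show ?thesis
      using cone_total[OF c, of "iv u * v"] cone_iv[OF c, of "iv u * v"] cone_disj[OF c, of "iv v * u"]
        subgrp_iv[OF sN, of "iv u * v"] by (auto simp: le_def)
  qed
  have ipow_pos: "ipow a i \<in> P" if "0 < i" for i
    using that a cone_pow[OF c a, of "nat i"] by (simp add: ipow_def)
  have ipow_le: "le (ipow a p) (ipow a q) \<longleftrightarrow> p \<le> q" for p q
  proof -
    have e: "iv (ipow a p) * ipow a q = ipow a (q - p)" for p q
      by (metis add.commute diff_conv_add_uminus ipow_add ipow_minus)
    show ?thesis
    proof (cases "p \<le> q")
      case True
      then show ?thesis
        using ipow_pos[of "q - p"] by (cases "p = q") (auto simp: le_def e subgrp_one[OF sN])
    next
      case False
      then show ?thesis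
        using nle[of "ipow a p" "ipow a q"] ipow_pos[of "p - q"] by (simp add: e mem aH)
    qed
  qed
  have "\<exists>p. le (ipow a p) x \<and> (\<forall>q. le (ipow a q) x \<longrightarrow> q \<le> p)" if x: "x \<in> H" for x
  proof -
    obtain n where n: "iv x * a ^ n \<in> P"
      using arch[OF a x] by blast
    obtain m where m: "iv (iv x) * a ^ m \<in> P"
      using arch[OF a, of "iv x"] x by (auto simp: mem)
    have "a ^ m * x \<in> P"
      using biP'[OF x m] by (simp add: mult.assoc)
    then have 1: "le (ipow a (- int m)) x"
      by (simp add: ipow_minus le_def)
    have 2: "le x (ipow a (int n))"
      using n by (simp add: le_def)
    show ?thesis
    proof (rule int_greatest_ex[of "\<lambda>p. le (ipow a p) x", OF 1])
      show "p \<le> int n" if "le (ipow a p) x" for p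
        using trans[OF that 2] unfolding ipow_le .
    qed
  qed
  then obtain f where f: "\<And>x. x \<in> H \<Longrightarrow> le (ipow a (f x)) x" "\<And>x p. x \<in> H \<Longrightarrow> le (ipow a p) x \<Longrightarrow> p \<le> f x"
    by metis
  have f_less: "iv x * ipow a (f x + 1) \<in> P" if "x \<in> H" for x
    using nle[of "ipow a (f x + 1)" x] f(2)[OF that, of "f x + 1"] that by (auto simp: mem aH)
  have f_mono: "f x \<le> f y" if "x \<in> H" "y \<in> H" "le x y" for x y
    using trans[OF f(1)] f(2) that by blast
  have f_ge: "f x + f y \<le> f (x * y)" if "x \<in> H" "y \<in> H" for x y
  proof -
    have "le (ipow a (f x) * ipow a (f y)) (ipow a (f x) * y)"
      using f(1) that left by blast
    moreover have "le (ipow a (f x) * y) (x * y)"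
      using f(1) that right by blast
    ultimately have "le (ipow a (f x + f y)) (x * y)"
      unfolding ipow_add using trans by blast
    then show ?thesis
      using f(2) that mem by blast
  qed
  have f_le: "f (x * y) \<le> f x + f y + 1" if "x \<in> H" "y \<in> H" for x y
  proof (rule ccontr)
    assume "\<not> ?thesis"
    then have "le (ipow a ((f x + 1) + (f y + 1))) (ipow a (f (x * y)))"
      by (simp add: ipow_le)
    then have l: "le (ipow a ((f x + 1) + (f y + 1))) (x * y)"
      using trans f(1) that mem by blast
    have "iv y * (iv x * ipow a (f x + 1)) * y * (iv y * ipow a (f y + 1)) \<in> P"
      using f_less that biP' cone_mult[OF c] by blast
    then have p: "iv (x * y) * ipow a ((f x + 1) + (f y + 1)) \<in> P"
      unfolding ipow_add by (simp add: mult.assoc)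
    have h: "ipow a ((f x + 1) + (f y + 1)) \<in> H" "x * y \<in> H"
      using that by (auto intro: mem aH)
    show False
      using l p nle[OF h] by blast
  qed
  have f_N: "f x = 0" if "x \<in> N" for x
  proof (rule antisym)
    have xH: "x \<in> H"
      using that NH by blast
    have "le 1 x" "le x 1"
      using that subgrp_iv[OF sN] by (auto simp: le_def)
    then show "0 \<le> f x" "f x \<le> 0"
      using f(2)[OF xH, of 0] trans[OF f(1)[OF xH], of "ipow a 0"] ipow_le[of "f x" 0] by simp_all
  qed
  have f_pow: "int k * f x \<le> f (x ^ k) \<and> f (x ^ k) \<le> int k * f x + int k" if x: "x \<in> H" for x k
  proof (induction k)
    case 0
    then show ?case
      using f_N[of 1] subgrp_one[OF sN] by simp
  next
    case (Suc k)
    then show ?case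
      using f_ge[OF x, of "x ^ k"] f_le[OF x, of "x ^ k"] x by (auto simp: mem algebra_simps)
  qed
  \<comment> \<open>Both sides are compared with \<open>f (x ^ (k * m))\<close>, read once as a
    power of \<open>x ^ k\<close> and once as a power of \<open>x ^ m\<close>.\<close>
  have f_cross: "int m * f (x ^ k) \<le> int k * f (x ^ m) + int k" if x: "x \<in> H" for x k m
    using f_pow[of "x ^ k" m] f_pow[of "x ^ m" k] x mem(3)[OF x]
    by (simp add: power_mult[symmetric] mult.commute)
  \<comment> \<open>The supremum is the limit of the quotients: \<open>f_cross\<close> keeps every
    quotient within \<open>1 / k\<close> of it.\<close>
  define \<phi> where "\<phi> x = (SUP k\<in>{1..}. real_of_int (f (x ^ k)) / real k)" for x
  have quot: "real_of_int (f (x ^ k)) / real k \<le> (real_of_int (f (x ^ m)) + 1) / real m"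
    if "x \<in> H" "1 \<le> k" "1 \<le> m" for x k m
  proof -
    have "real_of_int (int m * f (x ^ k)) \<le> real_of_int (int k * f (x ^ m) + int k)"
      using f_cross[OF that(1)] of_int_le_iff by blast
    then show ?thesis
      using that by (simp add: field_simps)
  qed
  have \<phi>_bounds: "real_of_int (f (x ^ k)) \<le> real k * \<phi> x" "real k * \<phi> x \<le> real_of_int (f (x ^ k)) + 1"
    if "x \<in> H" "1 \<le> k" for x k
  proof -
    have "bdd_above ((\<lambda>k. real_of_int (f (x ^ k)) / real k) ` {1..})"
      using quot[OF that(1), of _ 1] by (intro bdd_aboveI[where M = "(real_of_int (f (x ^ 1)) + 1) / real 1"]) auto
    then have "real_of_int (f (x ^ k)) / real k \<le> \<phi> x"
      unfolding \<phi>_def using that by (intro cSUP_upper) auto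
    then show "real_of_int (f (x ^ k)) \<le> real k * \<phi> x"
      using that by (simp add: field_simps)
    have "\<phi> x \<le> (real_of_int (f (x ^ k)) + 1) / real k"
      unfolding \<phi>_def using quot that by (intro cSUP_least) auto
    then show "real k * \<phi> x \<le> real_of_int (f (x ^ k)) + 1"
      using that by (simp add: field_simps)
  qed
  \<comment> \<open>A bounded error disappears in the homogenization. The bound 3 is large enough
    for the rounding errors below, which add up to at most 2 in absolute value.\<close>
  have small: "z = 0" if "\<And>k::nat. 1 \<le> k \<Longrightarrow> \<bar>real k * z\<bar> \<le> 3" for z :: real
  proof (rule ccontr)
    assume z: "z \<noteq> 0"
    obtain k :: nat where "3 / \<bar>z\<bar> < real k"
      using reals_Archimedean2 by blast
    then have "3 < real k * \<bar>z\<bar>"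
      using z by (simp add: field_simps)
    moreover have "1 \<le> k"
      using calculation by (cases k) auto
    ultimately show False
      using that[of k] by (simp add: abs_mult)
  qed
  have add: "\<phi> (x * y) = \<phi> x + \<phi> y" if x: "x \<in> H" and y: "y \<in> H" for x y
  proof -
    have xy: "x * y \<in> H" "y * x \<in> H"
      using x y mem by auto
    \<comment> \<open>The power \<open>(x * y) ^ k\<close> lies between \<open>x ^ k * y ^ k\<close>
      and \<open>y ^ k * x ^ k\<close>, and \<open>f\<close> takes nearly the same value on these
      two.\<close>
    have "f (x ^ k) + f (y ^ k) \<le> f ((x * y) ^ k) \<and> f ((x * y) ^ k) \<le> f (x ^ k) + f (y ^ k) + 1" for k
    proof -
      have pk: "x ^ k \<in> H" "y ^ k \<in> H" "(x * y) ^ k \<in> H" "x ^ k * y ^ k \<in> H" "y ^ k * x ^ k \<in> H"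
        using x y mem by auto
      note ff = f_ge[OF pk(1,2)] f_ge[OF pk(2,1)] f_le[OF pk(1,2)] f_le[OF pk(2,1)]
      consider "le (x * y) (y * x)" | "le (y * x) (x * y)"
        using nle[OF xy] by (auto simp: le_def)
      then show ?thesis
      proof cases
        case 1
        have "le (x ^ k * y ^ k) ((x * y) ^ k) \<and> le ((x * y) ^ k) (y ^ k * x ^ k)"
          by (intro conjI pow_commute_le[where H = H and le = le])
            (use sH x y 1 in \<open>auto intro: refl left right dest: trans\<close>)
        then show ?thesis
          using ff f_mono pk by fastforce
      next
        case 2
        have "le ((x * y) ^ k) (x ^ k * y ^ k) \<and> le (y ^ k * x ^ k) ((x * y) ^ k)"
          by (intro conjI pow_commute_le[where H = H and le = "\<lambda>u v. le v u"])
            (use sH x y 2 in \<open>auto intro: refl left right dest: trans\<close>)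
        then show ?thesis
          using ff f_mono pk by fastforce
      qed
    qed
    note fk = this
    have "\<bar>real k * (\<phi> (x * y) - \<phi> x - \<phi> y)\<bar> \<le> 3" if k: "1 \<le> k" for k
    proof -
      have "real_of_int (f (x ^ k)) + real_of_int (f (y ^ k)) \<le> real_of_int (f ((x * y) ^ k))"
        "real_of_int (f ((x * y) ^ k)) \<le> real_of_int (f (x ^ k)) + real_of_int (f (y ^ k)) + 1"
        using fk[of k] by linarith+
      then show ?thesis
        using \<phi>_bounds[OF x k] \<phi>_bounds[OF y k] \<phi>_bounds[OF xy(1) k]
        by (simp add: algebra_simps abs_le_iff)
    qed
    then show ?thesis
      using small[of "\<phi> (x * y) - \<phi> x - \<phi> y"] by simp
  qed
  then have hm: "hm H \<phi>"
    by (simp add: hm_def)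
  have pos: "0 < \<phi> x" if x: "x \<in> P" for x
  proof -
    obtain k where k: "iv a * x ^ k \<in> P"
      using arch[OF x aH] by blast
    have k0: "1 \<le> k"
      using k cone_iv[OF c a] by (cases k) auto
    have "le (ipow a 1) (x ^ k)"
      using k by (simp add: le_def)
    then have "1 \<le> f (x ^ k)"
      using f(2) x PH mem by blast
    then show ?thesis
      using \<phi>_bounds(1)[OF PH[OF x] k0] k0 by (smt (verit) of_int_1_le_iff mult_nonneg_nonpos of_nat_0_le_iff)
  qed
  have zero: "\<phi> x = 0" if x: "x \<in> N" for x
    using \<phi>_bounds[OF NH[OF x]] f_N[OF subgrp_pow[OF sN x]] by (intro small) force
  have "P = {x\<in>H. 0 < \<phi> x}"
  proof (intro subset_antisym subsetI)
    fix x assume "x \<in> {x\<in>H. 0 < \<phi> x}"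
    then have x: "x \<in> H" "0 < \<phi> x"
      by auto
    then show "x \<in> P"
      using cone_total[OF c x(1)] zero[of x] pos[of "iv x"] hm_iv[OF hm sH x(1)] by auto
  qed (use pos PH in auto)
  moreover have "N = {x\<in>H. \<phi> x = 0}"
  proof (intro subset_antisym subsetI)
    fix x assume "x \<in> {x\<in>H. \<phi> x = 0}"
    then have x: "x \<in> H" "\<phi> x = 0"
      by auto
    then show "x \<in> N"
      using cone_total[OF c x(1)] pos[of x] pos[of "iv x"] hm_iv[OF hm sH x(1)] by auto
  qed (use zero NH in auto)
  ultimately show ?thesis
    using sH hm by (auto simp: ohom_def)
qed

text \<open>For a rational \<open>p/q\<close> strictly between the two ratios,
  \<open>x ^ q * ipow a (- p)\<close> would have different signs under \<phi> and \<psi>, although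
  both describe \<open>P\<close>.\<close>

lemma ohom_ratio_le:
  assumes o: "ohom H N P \<phi>" "ohom H N P \<psi>" and a: "a \<in> P" and x: "x \<in> H"
  shows "\<psi> x / \<psi> a \<le> \<phi> x / \<phi> a"
proof (rule ccontr)
  assume "\<not> ?thesis"
  then have "\<phi> x / \<phi> a < \<psi> x / \<psi> a"
    by simp
  then obtain r where r: "r \<in> \<rat>" "\<phi> x / \<phi> a < r" "r < \<psi> x / \<psi> a"
    using Rats_dense_in_real by blast
  obtain p :: int and q :: nat where pq: "q \<noteq> 0" "r = real_of_int p / real q"
    using r(1) unfolding Rats_eq_int_div_nat by force
  have aH: "a \<in> H" "0 < \<phi> a" "0 < \<psi> a"
    using ohomD(3)[OF o(1), of a] ohomD(3)[OF o(2), of a] a by auto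
  have v: "\<theta> (x ^ q * ipow a (- p)) = real q * \<theta> x - real_of_int p * \<theta> a" if "hm H \<theta>" for \<theta>
    using that ohomD(1)[OF o(1)] aH x by (simp add: hm_mult[of H] hm_pow[of H] hm_zp[of H] subgrp_pow subgrp_zp)
  have h: "hm H \<phi>" "hm H \<psi>"
    using o ohomD by blast+
  have "x ^ q * ipow a (- p) \<in> H"
    using ohomD(1)[OF o(1)] aH x by (simp add: subgrp_mult subgrp_pow subgrp_zp)
  then have "0 < real q * \<phi> x - real_of_int p * \<phi> a \<longleftrightarrow> 0 < real q * \<psi> x - real_of_int p * \<psi> a"
    using ohomD(3)[OF o(1)] ohomD(3)[OF o(2)] v[OF h(1)] v[OF h(2)] by metis
  moreover have "real q * \<phi> x < real_of_int p * \<phi> a"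
    using r(2) pq aH by (simp add: field_simps)
  moreover have "real_of_int p * \<psi> a < real q * \<psi> x"
    using r(3) pq aH by (simp add: field_simps)
  ultimately show False
    by simp
qed

lemma ohom_unique:
  assumes "ohom H N P \<phi>" "ohom H N P \<psi>" "a \<in> P" "x \<in> H"
  shows "\<psi> x = \<psi> a / \<phi> a * \<phi> x"
proof -
  have "\<psi> x / \<psi> a = \<phi> x / \<phi> a"
    using ohom_ratio_le[OF assms] ohom_ratio_le[OF assms(2,1,3,4)] by simp
  then show ?thesis
    using ohomD(3)[OF assms(1), of a] ohomD(3)[OF assms(2), of a] assms(3) by (simp add: field_simps)
qed

lemma ohom_cases:
  assumes "ohom H N P \<phi>" "x \<in> H"
  shows "x \<in> P \<or> x \<in> N \<or> iv x \<in> P"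
  using cone_total[OF ohom_cone[OF assms(1)] assms(2)] .

text \<open>Composing \<phi> with the conjugation gives a second homomorphism for the same order on
  \<open>A\<close>, so uniqueness up to scale supplies the factor.\<close>

lemma conj_scale_ex:
  assumes o: "ohom A N P \<phi>" and g: "\<And>a. a \<in> A \<Longrightarrow> g * a * iv g \<in> A"
    "\<And>a. a \<in> N \<Longrightarrow> g * a * iv g \<in> N" "\<And>a. a \<in> P \<Longrightarrow> g * a * iv g \<in> P"
  shows "\<exists>l>0. \<forall>a\<in>A. \<phi> (g * a * iv g) = l * \<phi> a"
proof -
  define \<psi> where "\<psi> a = \<phi> (g * a * iv g)" for a
  note sA = ohomD(1)[OF o] and hA = ohomD(2)[OF o]
  have h: "hm A \<psi>"
    unfolding hm_def
  proof (intro ballI)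
    fix x y assume xy: "x \<in> A" "y \<in> A"
    have "g * (x * y) * iv g = (g * x * iv g) * (g * y * iv g)"
      by (simp add: mult.assoc)
    then show "\<psi> (x * y) = \<psi> x + \<psi> y"
      using hm_mult[OF hA g(1)[OF xy(1)] g(1)[OF xy(2)]] by (simp add: \<psi>_def)
  qed
  have iv: "\<psi> (iv a) = - \<psi> a" if "a \<in> A" for a
    using hm_iv[OF h sA that] .
  have pos: "0 < \<psi> a" if "a \<in> P" for a
    using g(3)[OF that] ohomD(3)[OF o] by (simp add: \<psi>_def)
  have zero: "\<psi> a = 0" if "a \<in> N" for a
    using g(2)[OF that] ohomD(4)[OF o] by (simp add: \<psi>_def)
  have "a \<in> P \<longleftrightarrow> 0 < \<psi> a" "a \<in> N \<longleftrightarrow> \<psi> a = 0" if "a \<in> A" for a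
    using ohom_cases[OF o that] pos[of a] zero[of a] pos[of "iv a"] iv[OF that] by force+
  moreover have "P \<subseteq> A" "N \<subseteq> A"
    using ohomD(3,4)[OF o] by auto
  ultimately have "P = {x\<in>A. 0 < \<psi> x}" "N = {x\<in>A. \<psi> x = 0}"
    by blast+
  then have o2: "ohom A N P \<psi>"
    unfolding ohom_def using sA h by blast
  show ?thesis
  proof (cases "P = {}")
    case True
    have "\<phi> (g * a * iv g) = 1 * \<phi> a" if "a \<in> A" for a
      using ohom_cases[OF o that] ohom_cases[OF o g(1)[OF that]] ohomD(4)[OF o, of a]
        ohomD(4)[OF o, of "g * a * iv g"] True by (metis empty_iff mult_zero_right)
    then show ?thesis
      by (intro exI[of _ 1]) simp
  next
    case False
    then obtain a where "a \<in> P"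
      by blast
    then have "0 < \<psi> a / \<phi> a"
      using ohomD(3)[OF o, of a] ohomD(3)[OF o2, of a] by simp
    moreover have "\<phi> (g * x * iv g) = \<psi> a / \<phi> a * \<phi> x" if "x \<in> A" for x
      using ohom_unique[OF o o2 \<open>a \<in> P\<close> that] unfolding \<psi>_def .
    ultimately show ?thesis
      by blast
  qed
qed

text \<open>A single element with nonzero value determines the factor, which makes it
  multiplicative. On \<open>A\<close> it is 1 because \<phi> does not see conjugation inside its own
  domain.\<close>

lemma conj_scale:
  assumes o: "ohom A N P \<phi>" and H: "subgrp H" "A \<subseteq> H" "normal_in H A" "normal_in H N"
    and pos: "\<And>h a. h \<in> H \<Longrightarrow> a \<in> P \<Longrightarrow> h * a * iv h \<in> P" and ne: "P \<noteq> {}"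
  obtains l where "\<And>h. h \<in> H \<Longrightarrow> 0 < l h" "\<And>h a. h \<in> H \<Longrightarrow> a \<in> A \<Longrightarrow> \<phi> (h * a * iv h) = l h * \<phi> a"
    "\<And>g h. g \<in> H \<Longrightarrow> h \<in> H \<Longrightarrow> l (g * h) = l g * l h" "\<And>a. a \<in> A \<Longrightarrow> l a = 1"
proof -
  have "\<forall>h\<in>H. \<exists>l>0. \<forall>a\<in>A. \<phi> (h * a * iv h) = l * \<phi> a"
    using conj_scale_ex[OF o] normal_inD[OF H(3)] normal_inD[OF H(4)] pos by blast
  then obtain l where l: "\<And>h. h \<in> H \<Longrightarrow> 0 < l h" "\<And>h a. h \<in> H \<Longrightarrow> a \<in> A \<Longrightarrow> \<phi> (h * a * iv h) = l h * \<phi> a"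
    by metis
  obtain p where "p \<in> P"
    using ne by blast
  then have p: "p \<in> A" "\<phi> p \<noteq> 0"
    using ohomD(3)[OF o] by auto
  have "l (g * h) = l g * l h" if gh: "g \<in> H" "h \<in> H" for g h
  proof -
    have "(g * h) * p * iv (g * h) = g * (h * p * iv h) * iv g"
      by (simp add: mult.assoc)
    then have "l (g * h) * \<phi> p = l g * (l h * \<phi> p)"
      using l(2) gh p normal_inD[OF H(3)] subgrp_mult[OF H(1)] by metis
    then show ?thesis
      using p by simp
  qed
  moreover have "l a = 1" if "a \<in> A" for a
    using l(2)[of a p] that p H(2) hm_conj[OF ohomD(2)[OF o] ohomD(1)[OF o], of p a] by auto
  ultimately show ?thesis
    using that l by blast
qed

lemma mult_hom_simps:
  fixes l :: "'g::grp \<Rightarrow> real"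
  assumes H: "subgrp H" and l: "\<And>h. h \<in> H \<Longrightarrow> 0 < l h" "\<And>g h. g \<in> H \<Longrightarrow> h \<in> H \<Longrightarrow> l (g * h) = l g * l h"
  shows "l 1 = 1" "\<And>h. h \<in> H \<Longrightarrow> l (iv h) = inverse (l h)" "\<And>h n. h \<in> H \<Longrightarrow> l (h ^ n) = l h ^ n"
proof -
  show 1: "l 1 = 1"
    using l(2)[of 1 1] l(1)[of 1] subgrp_one[OF H] by simp
  show "l (iv h) = inverse (l h)" if "h \<in> H" for h
    using l(2)[of h "iv h"] that subgrp_iv[OF H that] 1 l(1)[OF that] by (simp add: field_simps)
  show "l (h ^ n) = l h ^ n" if "h \<in> H" for h n
    by (induction n) (auto simp: 1 l(2) that subgrp_pow[OF H])
qed

text \<open>The reals are a vector space over the rationals in which \<open>x\<close> and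
  \<open>y\<close> are independent. The functional is necessarily discontinuous, and this is what
  makes the perturbed order below differ from the given one.\<close>

lemma additive_separating:
  fixes x y :: real
  assumes "y \<noteq> 0" "x / y \<notin> \<rat>"
  obtains l :: "real \<Rightarrow> real" where "\<And>u v. l (u + v) = l u + l v" "l x = 1" "l y = 0"
proof -
  interpret V: vector_space "\<lambda>(q::rat) (x::real). of_rat q * x"
    by standard (auto simp: algebra_simps of_rat_add of_rat_mult)
  interpret VV: vector_space_pair "\<lambda>(q::rat) (x::real). of_rat q * x" "\<lambda>(q::rat) (x::real). of_rat q * x"
    by standard
  have ne: "x \<noteq> y"
    using assms by auto
  have "V.independent {x, y}"
  proof (rule V.independent_if_scalars_zero)
    fix f z assume s: "(\<Sum>z\<in>{x, y}. of_rat (f z) * z) = 0" and z: "z \<in> {x, y}"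
    have e: "of_rat (f x) * x + of_rat (f y) * y = 0"
      using s ne by simp
    have fx: "f x = 0"
    proof (rule ccontr)
      assume n: "f x \<noteq> 0"
      then have "x / y = - of_rat (f y) / of_rat (f x)"
        using e assms(1) by (simp add: field_simps)
      then show False
        using assms(2) by simp
    qed
    then have "f y = 0"
      using e assms(1) by simp
    then show "f z = 0"
      using fx z by auto
  qed simp
  then obtain g where g: "Vector_Spaces.linear (\<lambda>(q::rat) (x::real). of_rat q * x)
      (\<lambda>(q::rat) (x::real). of_rat q * x) g"
    "\<And>z. z \<in> {x, y} \<Longrightarrow> g z = (if z = x then 1 else 0)"
    using VV.linear_independent_extend[of "{x, y}" "\<lambda>z. if z = x then 1 else 0"] by blast
  have "g (u + v) = g u + g v" for u v
    using g(1) by (simp add: Vector_Spaces.linear_iff)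
  then show ?thesis
    using that[of g] g(2)[of x] g(2)[of y] ne by simp
qed

text \<open>If \<open>\<phi>(H)\<close> contains two rationally independent values, the order is perturbed by adding a
  small multiple of an additive function of the value, ties being broken by the original order.\<close>

lemma ohom_iso_rational:
  assumes o: "ohom H N P \<phi>" and i: "isolated H N P" and u: "u \<in> H" and v: "v \<in> P"
  shows "\<phi> u / \<phi> v \<in> \<rat>"
proof (rule ccontr)
  assume irr: "\<phi> u / \<phi> v \<notin> \<rat>"
  note sH = ohomD(1)[OF o] and hH = ohomD(2)[OF o]
  have vH: "v \<in> H" "0 < \<phi> v"
    using v ohomD(3)[OF o] by auto
  have "\<phi> v \<noteq> 0"
    using vH by simp
  from additive_separating[OF this irr]
  obtain l :: "real \<Rightarrow> real" where l: "\<And>a b. l (a + b) = l a + l b" "l (\<phi> u) = 1" "l (\<phi> v) = 0"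
    by blast
  define \<psi> where "\<psi> e h = \<phi> h + e * l (\<phi> h)" for e h
  define Q where "Q e = {h\<in>H. 0 < \<psi> e h \<or> \<psi> e h = 0 \<and> 0 < \<phi> h}" for e
  have h\<psi>: "hm H (\<psi> e)" for e
    using hH by (simp add: hm_def \<psi>_def l(1) algebra_simps)
  have l0: "l 0 = 0"
    using l(1)[of 0 0] by simp
  have Q: "cone H N (Q e)" for e
  proof (rule coneI)
    show "subgrp H" "subgrp N" "N \<subseteq> H"
      using ohom_cone[OF o] cone_sg cone_sub by blast+
    show "Q e \<subseteq> H"
      by (auto simp: Q_def)
    show "x \<notin> N" if "x \<in> Q e" for x
      using that ohomD(4)[OF o] l0 by (auto simp: Q_def \<psi>_def)
    show "x * y \<in> Q e" if "x \<in> Q e" "y \<in> Q e" for x y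
      using that hm_mult[OF hH, of x y] hm_mult[OF h\<psi>, of x y e] subgrp_mult[OF sH, of x y]
      by (auto simp: Q_def)
    show "x \<in> Q e \<or> x \<in> N \<or> iv x \<in> Q e" if x: "x \<in> H" for x
      using hm_iv[OF h\<psi> sH x, of e] hm_iv[OF hH sH x] subgrp_iv[OF sH x] x ohomD(4)[OF o, of x]
      by (auto simp: Q_def)
  qed
  obtain F where F: "finite F" "F \<subseteq> P" "\<And>Q. cone H N Q \<Longrightarrow> F \<subseteq> Q \<Longrightarrow> Q = P"
    using i by (auto simp: isolated_def)
  have "\<forall>\<^sub>F e in at_right 0. \<forall>f\<in>F. 0 < \<psi> e f"
  proof (intro eventually_ball_finite[OF F(1)] ballI)
    fix f assume "f \<in> F"
    then have "0 < \<phi> f"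
      using F(2) ohomD(3)[OF o] by auto
    moreover have "((\<lambda>e. \<psi> e f) \<longlongrightarrow> \<phi> f + 0 * l (\<phi> f)) (at_right 0)"
      unfolding \<psi>_def by (intro tendsto_intros)
    ultimately show "\<forall>\<^sub>F e in at_right 0. 0 < \<psi> e f"
      using order_tendstoD(1) by fastforce
  qed
  then have "\<forall>\<^sub>F e in at_right 0. 0 < e \<and> (\<forall>f\<in>F. 0 < \<psi> e f)"
    by (auto intro: eventually_conj eventually_at_right_less)
  then obtain e where e: "0 < e" "\<And>f. f \<in> F \<Longrightarrow> 0 < \<psi> e f"
    using eventually_happens'[of "at_right (0::real)"] trivial_limit_at_right_real by blast
  have "F \<subseteq> Q e"
    using F(2) ohomD(3)[OF o] e(2) by (auto simp: Q_def)
  then have QP: "Q e = P"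
    using F(3) Q by blast
  \<comment> \<open>The exponent \<open>q\<close> is the first for which \<open>v ^ q\<close>
    exceeds \<open>u ^ p\<close>, so that \<open>\<phi> z\<close> is at most
    \<open>\<phi> v\<close>, while the perturbation contributes \<open>- e * p\<close>. The choice
    of \<open>p\<close> makes the latter dominate.\<close>
  obtain p :: nat where p: "\<phi> v / e < real p"
    using reals_Archimedean2 by blast
  define q where "q = \<lfloor>real p * \<phi> u / \<phi> v\<rfloor> + 1"
  define z where "z = ipow v q * iv (u ^ p)"
  have z: "\<theta> z = real_of_int q * \<theta> v - real p * \<theta> u" if "hm H \<theta>" for \<theta>
    unfolding z_def using that sH u vH
    by (simp add: hm_mult[of H] hm_iv[of H] hm_pow[of H] hm_zp[of H] subgrp_pow subgrp_zp subgrp_iv)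
  have zH: "z \<in> H"
    unfolding z_def using sH u vH by (simp add: subgrp_mult subgrp_pow subgrp_zp subgrp_iv)
  have q: "real p * \<phi> u / \<phi> v < real_of_int q" "real_of_int q \<le> real p * \<phi> u / \<phi> v + 1"
    unfolding q_def by linarith+
  have b: "real p * \<phi> u < real_of_int q * \<phi> v" "real_of_int q * \<phi> v \<le> real p * \<phi> u + \<phi> v"
    using q vH by (simp_all add: field_simps)
  have "z \<in> P"
    using ohomD(3)[OF o] zH z[OF hH] b by auto
  moreover have "\<psi> e z < 0"
  proof -
    have "\<psi> e z = (real_of_int q * \<phi> v - real p * \<phi> u) - e * real p"
      unfolding z[OF h\<psi>] by (simp add: \<psi>_def l algebra_simps)
    moreover have "\<phi> v < e * real p"
      using p e(1) by (simp add: field_simps)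
    ultimately show ?thesis
      using b by simp
  qed
  then have "z \<notin> Q e"
    by (auto simp: Q_def)
  ultimately show False
    using QP by blast
qed

lemma ohom_scale: "ohom H N P \<phi> \<Longrightarrow> 0 < c \<Longrightarrow> ohom H N P (\<lambda>x. \<phi> x / c)"
  by (auto simp: ohom_def hm_def add_divide_distrib zero_less_divide_iff)

lemma isolated_rank_one:
  assumes "ohom H N P \<phi>" "isolated H N P"
  shows "\<exists>\<psi>. ohom H N P \<psi> \<and> \<psi> ` H \<subseteq> \<rat>"
proof (cases "P = {}")
  case True
  then have "\<phi> x = 0" if "x \<in> H" for x
    using ohom_cases[OF assms(1) that] ohomD(4)[OF assms(1)] by auto
  then show ?thesis
    using assms(1) by (intro exI[of _ \<phi>]) auto
next
  case False
  then obtain v where v: "v \<in> P"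
    by blast
  then have "0 < \<phi> v"
    using ohomD(3)[OF assms(1)] by auto
  then show ?thesis
    using ohom_scale[OF assms(1)] ohom_iso_rational[OF assms _ v] by blast
qed

lemma rats_opposite:
  fixes x y :: real
  assumes "x \<in> \<rat>" "y \<in> \<rat>" "0 < x" "y < 0"
  obtains m n :: nat where "0 < m" "0 < n" "real m * x + real n * y = 0"
proof -
  obtain p q where x: "q \<noteq> 0" "\<bar>x\<bar> = real p / real q"
    using Rats_abs_nat_div_natE[OF assms(1)] by metis
  obtain r s where y: "s \<noteq> 0" "\<bar>y\<bar> = real r / real s"
    using Rats_abs_nat_div_natE[OF assms(2)] by metis
  have "p \<noteq> 0"
    using assms(3) x(2) by (intro notI) simp
  have "r \<noteq> 0"
    using assms(4) y(2) by (intro notI) simp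
  have "real (q * r) * x + real (s * p) * y = 0"
  proof -
    have "x = real p / real q" "y = - (real r / real s)"
      using x(2) y(2) assms(3,4) by auto
    then show ?thesis
      using x(1) y(1) by simp
  qed
  then show ?thesis
    using that[of "q * r" "s * p"] x y \<open>p \<noteq> 0\<close> \<open>r \<noteq> 0\<close> by auto
qed

text \<open>Two rational values of opposite sign cancel in some positive combination, giving a
  product of positive elements inside \<open>N\<close>.\<close>

lemma qhom_opposite_signs:
  assumes q: "qhom H N \<phi>" and c: "cone H N P" and x: "x \<in> P" and y: "y \<in> P" and s: "0 < \<phi> x" "\<phi> y < 0"
  shows False
proof -
  have H: "x \<in> H" "y \<in> H"
    using x y cone_mem[OF c] by auto
  obtain m n :: nat where mn: "0 < m" "0 < n" "real m * \<phi> x + real n * \<phi> y = 0"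
    using rats_opposite[OF qhomD(4)[OF q H(1)] qhomD(4)[OF q H(2)] s] .
  have "x ^ m * y ^ n \<in> P"
    using cone_pow[OF c x mn(1)] cone_pow[OF c y mn(2)] cone_mult[OF c] by blast
  moreover have "x ^ m * y ^ n \<in> N"
    using mn H qhomD(1,2)[OF q] by (simp add: qhomD(3)[OF q] hm_simps(1,3)[of H] subgrp_mult subgrp_pow)
  ultimately show False
    using cone_disj[OF c] by blast
qed

lemma qhom_uminus: "qhom H N \<phi> \<Longrightarrow> qhom H N (\<lambda>x. - \<phi> x)"
  by (auto simp: qhom_def hm_def image_subset_iff)

lemma qhom_orient_pos:
  assumes q: "qhom H N \<phi>" and c: "cone H N P" and x: "x \<in> P" "0 < \<phi> x"
  shows "ohom H N P \<phi>"
proof -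
  have pos: "0 < \<phi> y" if "y \<in> P" for y
    using qhom_opposite_signs[OF q c x(1) that x(2)] that qhomD(3)[OF q, of y] cone_mem[OF c] cone_disj[OF c that]
    by (meson linorder_neqE_linordered_idom)
  have "y \<in> P" if y: "y \<in> H" "0 < \<phi> y" for y
    using cone_total[OF c y(1)] pos[of "iv y"] hm_iv[OF qhomD(2,1)[OF q] y(1)] y qhomD(3)[OF q, of y] by auto
  then have "P = {x\<in>H. 0 < \<phi> x}"
    using pos cone_mem(1)[OF c] by blast
  then show ?thesis
    using q unfolding ohom_def qhom_def by blast
qed

lemma qhom_orient:
  assumes q: "qhom H N \<phi>" and c: "cone H N P"
  shows "ohom H N P \<phi> \<or> ohom H N P (\<lambda>x. - \<phi> x)"
proof (cases "P = {}")
  case True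
  then have "\<phi> y = 0" if "y \<in> H" for y
    using cone_total[OF c that] qhomD(3)[OF q] by auto
  then show ?thesis
    using q True by (auto simp: ohom_def qhom_def)
next
  case False
  then obtain x where x: "x \<in> P"
    by blast
  then have "\<phi> x \<noteq> 0"
    using qhomD(3)[OF q, of x] cone_mem[OF c] cone_disj[OF c x] by blast
  then consider "0 < \<phi> x" | "0 < - \<phi> x"
    by linarith
  then show ?thesis
    using qhom_orient_pos[OF q c x] qhom_orient_pos[OF qhom_uminus[OF q] c x] by cases auto
qed

lemma qhom_oriented:
  assumes "qhom H N \<phi>" "cone H N P"
  obtains \<psi> where "ohom H N P \<psi>" "qhom H N \<psi>"
  using qhom_orient[OF assms] assms(1) qhom_uminus by blast

lemma qhom_finite_cones:
  assumes "qhom H N \<phi>"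
  shows "finite {P. cone H N P}"
proof -
  have "{P. cone H N P} \<subseteq> {{x\<in>H. 0 < \<phi> x}, {x\<in>H. 0 < - \<phi> x}}"
    using qhom_orient[OF assms] by (auto simp: ohom_def)
  then show ?thesis
    by (rule finite_subset) simp
qed

lemma cone_conj:
  assumes c: "cone H N P" and n: "normal_in H N" and g: "g \<in> H"
  shows "cone H N {x\<in>H. iv g * x * g \<in> P}"
proof (rule coneI)
  note sH = cone_sg(1)[OF c]
  show "subgrp H" "subgrp N" "N \<subseteq> H"
    using cone_sg[OF c] cone_sub[OF c] by blast+
  show "{x\<in>H. iv g * x * g \<in> P} \<subseteq> H"
    by blast
  show "x \<notin> N" if "x \<in> {x\<in>H. iv g * x * g \<in> P}" for x
    using that normal_inD2[OF n sH g, of x] cone_disj[OF c] by blast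
  show "x * y \<in> {x\<in>H. iv g * x * g \<in> P}"
    if "x \<in> {x\<in>H. iv g * x * g \<in> P}" "y \<in> {x\<in>H. iv g * x * g \<in> P}" for x y
    using that cone_mult[OF c, of "iv g * x * g" "iv g * y * g"] subgrp_mult[OF sH] by (simp add: mult.assoc)
  show "x \<in> {x\<in>H. iv g * x * g \<in> P} \<or> x \<in> N \<or> iv x \<in> {x\<in>H. iv g * x * g \<in> P}" if x: "x \<in> H" for x
  proof -
    have "iv g * x * g \<in> H" "iv x \<in> H"
      using x g sH by (auto intro: subgrp_mult subgrp_iv)
    moreover have "x \<in> N" if "iv g * x * g \<in> N"
      using normal_inD[OF n g that] by (simp add: mult.assoc)
    ultimately show ?thesis
      using cone_total[OF c, of "iv g * x * g"] x by (auto simp: mult.assoc)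
  qed
qed

text \<open>Conjugation by \<open>x\<close> preserves the order, so right multiplication by powers
  of \<open>x\<close> is monotone: \<open>y < x ^ a\<close> and \<open>z < x ^ b\<close> give
  \<open>y * z < y * x ^ b < x ^ (a + b)\<close>. This replaces normality of the subgroup generated
  by \<open>x\<close>.\<close>

lemma pow_hull_cvx:
  assumes c: "cone H N P" and x: "x \<in> P"
    and r: "\<And>u. u \<in> P \<Longrightarrow> iv x * u * x \<in> P" and l: "\<And>u. u \<in> P \<Longrightarrow> x * u * iv x \<in> P"
  shows "cvx H N P {y\<in>H. (\<exists>n. iv y * x ^ n \<in> P) \<and> (\<exists>n. x ^ n * y \<in> P)}" (is "cvx H N P ?E")
proof -
  note sH = cone_sg(1)[OF c]
  have xH: "x \<in> H"
    using x cone_mem[OF c] by blast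
  have rn: "iv (x ^ n) * u * x ^ n \<in> P" if "u \<in> P" for u n
  proof (induction n)
    case (Suc n)
    have "iv x * (iv (x ^ n) * u * x ^ n) * x \<in> P"
      using r Suc by blast
    then show ?case
      unfolding power_Suc2 by (simp add: mult.assoc)
  qed (use that in simp)
  have ln: "x ^ n * u * iv (x ^ n) \<in> P" if "u \<in> P" for u n
  proof (induction n)
    case (Suc n)
    have "x * (x ^ n * u * iv (x ^ n)) * iv x \<in> P"
      using l Suc by blast
    then show ?case
      by (simp add: mult.assoc)
  qed (use that in simp)
  have mul: "y * z \<in> ?E" if yz: "y \<in> ?E" "z \<in> ?E" for y z
  proof -
    obtain a b c' d where e: "iv y * x ^ a \<in> P" "x ^ b * y \<in> P" "iv z * x ^ c' \<in> P" "x ^ d * z \<in> P"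
      using yz by blast
    have "(iv z * x ^ c') * (iv (x ^ c') * (iv y * x ^ a) * x ^ c') \<in> P"
      using e rn cone_mult[OF c] by blast
    then have "iv (y * z) * x ^ (a + c') \<in> P"
      by (simp add: mult.assoc power_add)
    moreover have "(x ^ d * (x ^ b * y) * iv (x ^ d)) * (x ^ d * z) \<in> P"
      using e ln cone_mult[OF c] by blast
    then have "x ^ (d + b) * (y * z) \<in> P"
      by (simp add: mult.assoc power_add)
    moreover have "y * z \<in> H"
      using yz subgrp_mult[OF sH] by blast
    ultimately show ?thesis
      by blast
  qed
  have inv: "iv y \<in> ?E" if y: "y \<in> ?E" for y
  proof -
    obtain a b where e: "iv y * x ^ a \<in> P" "x ^ b * y \<in> P"
      using y by blast
    have "x ^ a * iv y \<in> P" "iv (iv y) * x ^ b \<in> P"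
      using ln[OF e(1), of a] rn[OF e(2), of b] by (simp_all add: mult.assoc)
    moreover have "iv y \<in> H"
      using y subgrp_iv[OF sH] by blast
    ultimately show ?thesis
      by blast
  qed
  have N: "n \<in> ?E" if n: "n \<in> N" for n
  proof -
    have "iv n * x ^ 1 \<in> P" "x ^ 1 * n \<in> P"
      using cone_NP[OF c subgrp_iv[OF cone_sg(2)[OF c] n] x] cone_PN[OF c n x] by simp_all
    then show ?thesis
      using cone_mem(2)[OF c n] by blast
  qed
  have "subgrp ?E"
    unfolding subgrp_def using mul inv N subgrp_one[OF cone_sg(2)[OF c]] by blast
  moreover have "u \<in> ?E" if uv: "u \<in> P" "v \<in> P" "u * v \<in> ?E" for u v
  proof -
    obtain n where "iv (u * v) * x ^ n \<in> P"
      using uv by blast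
    then have "v * (iv (u * v) * x ^ n) \<in> P"
      using cone_mult[OF c] uv by blast
    then have "iv u * x ^ n \<in> P"
      by (simp add: mult.assoc)
    moreover have "x ^ 1 * u \<in> P"
      using cone_mult[OF c x uv(1)] by simp
    ultimately show ?thesis
      using cone_mem(1)[OF c uv(1)] by blast
  qed
  ultimately show ?thesis
    unfolding cvx_def using N by blast
qed

lemma finite_lower_bound:
  assumes c: "cone H N P" and F: "finite F" "F \<subseteq> P" and z: "z \<in> P"
    and dense: "\<And>g. g \<in> P \<Longrightarrow> \<exists>p\<in>P. iv p * g \<in> P"
  shows "\<exists>g\<in>P. iv g * z \<in> P \<and> (\<forall>f\<in>F. iv g * f \<in> P)"
  using F
proof (induction F)
  case empty
  then show ?case
    using dense[OF z] by blast
next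
  case (insert f F)
  then obtain g where g: "g \<in> P" "iv g * z \<in> P" "\<And>f. f \<in> F \<Longrightarrow> iv g * f \<in> P"
    by auto
  have f: "f \<in> P"
    using insert by simp
  show ?case
  proof (cases "iv g * f \<in> P")
    case True
    then show ?thesis
      using g by blast
  next
    case False
    obtain p where p: "p \<in> P" "iv p * f \<in> P"
      using dense[OF f] by blast
    have "iv g * f \<in> H"
      using cone_mem(1)[OF c] f g(1) subgrp_mult[OF cone_sg(1)[OF c]] subgrp_iv[OF cone_sg(1)[OF c]] by blast
    then have fg: "iv f * g \<in> P \<or> iv f * g \<in> N"
      using False cone_total[OF c] subgrp_iv[OF cone_sg(2)[OF c], of "iv g * f"] by fastforce
    have step: "iv p * y \<in> P" if "iv g * y \<in> P" for y
    proof -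
      have "iv p * f * (iv f * g) \<in> P"
        using fg cone_mult[OF c p(2)] cone_PN[OF c _ p(2)] by blast
      then have "iv p * f * (iv f * g) * (iv g * y) \<in> P"
        using cone_mult[OF c] that by blast
      then show ?thesis
        by (simp add: mult.assoc)
    qed
    show ?thesis
      using p g step by (intro bexI[of _ p]) auto
  qed
qed

text \<open>An isolated order without convex subgroups is right-invariant under all small positive
  elements, because conjugation by such an element moves it only slightly.\<close>

lemma isolated_simple_rank_one:
  assumes i: "isolated H N P" and n: "normal_in H N" and nc: "\<And>C. cvx H N P C \<Longrightarrow> C = N \<or> C = H"
  shows "\<exists>\<phi>. ohom H N P \<phi> \<and> \<phi> ` H \<subseteq> \<rat>"
proof -
  note c = isolated_cone[OF i]
  note sH = cone_sg(1)[OF c] and sN = cone_sg(2)[OF c]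
  have PH: "x \<in> P \<Longrightarrow> x \<in> H" for x
    using cone_mem(1)[OF c] .
  have small: "\<exists>x\<in>P. (\<forall>u\<in>P. iv x * u * x \<in> P) \<and> iv z * x \<notin> P" if z: "z \<in> P" for z
  proof (cases "\<forall>g\<in>P. \<exists>p\<in>P. iv p * g \<in> P")
    case True
    obtain F where F: "finite F" "F \<subseteq> P" "\<And>Q. cone H N Q \<Longrightarrow> F \<subseteq> Q \<Longrightarrow> Q = P"
      using i by (auto simp: isolated_def)
    obtain g where g: "g \<in> P" "iv g * z \<in> P" "\<And>f. f \<in> F \<Longrightarrow> iv g * f \<in> P"
      using finite_lower_bound[OF c F(1,2) z] True by blast
    \<comment> \<open>For \<open>f\<close> above \<open>g\<close>, the conjugate
      \<open>iv g * f * g\<close> is the product of the positive elements \<open>iv g * f\<close>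
      and \<open>g\<close>. So the conjugated cone contains \<open>F\<close>, and isolation
      identifies it with \<open>P\<close>.\<close>
    have "F \<subseteq> {x\<in>H. iv g * x * g \<in> P}"
      using g F(2) PH cone_mult[OF c] by blast
    then have "{x\<in>H. iv g * x * g \<in> P} = P"
      using F(3) cone_conj[OF c n PH[OF g(1)]] by blast
    moreover have "iv z * g \<notin> P"
      using cone_iv[OF c g(2)] by simp
    ultimately show ?thesis
      using g(1) by blast
  next
    case False
    then obtain g where g: "g \<in> P" "\<And>p. p \<in> P \<Longrightarrow> iv p * g \<notin> P"
      by blast
    \<comment> \<open>Here \<open>g\<close> is a least positive element, hence at most
      \<open>u\<close>, and the same product decomposition works for every \<open>u\<close>.\<close>
    have "iv g * u * g \<in> P" if u: "u \<in> P" for u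
    proof -
      have "iv g * u \<in> H"
        by (intro subgrp_mult[OF sH] subgrp_iv[OF sH] PH u g(1))
      then have "iv g * u \<in> P \<or> iv g * u \<in> N"
        using cone_total[OF c, of "iv g * u"] g(2)[OF u] by auto
      then show ?thesis
        using cone_mult[OF c _ g(1)] cone_NP[OF c _ g(1)] by blast
    qed
    then show ?thesis
      using g z by blast
  qed
  have "\<exists>n. iv h * z ^ n \<in> P" if z: "z \<in> P" and h: "h \<in> H" for z h
  proof -
    obtain x where x: "x \<in> P" "\<And>u. u \<in> P \<Longrightarrow> iv x * u * x \<in> P" "iv z * x \<notin> P"
      using small[OF z] by blast
    have l: "x * u * iv x \<in> P" if u: "u \<in> P" for u
    proof (rule ccontr)
      assume a: "x * u * iv x \<notin> P"
      have "x * u * iv x \<in> H"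
        by (intro subgrp_mult[OF sH] subgrp_iv[OF sH] PH u x(1))
      moreover have "x * u * iv x \<notin> N"
        using normal_in_conj_iff[OF n sH PH[OF x(1)], of u] cone_disj[OF c u] by blast
      ultimately have "iv (x * u * iv x) \<in> P"
        using a cone_total[OF c] by blast
      then have "iv x * iv (x * u * iv x) * x \<in> P"
        using x(2) by blast
      then have "iv u \<in> P"
        by (simp add: mult.assoc)
      then show False
        using cone_iv[OF c u] by blast
    qed
    let ?E = "{y\<in>H. (\<exists>n. iv y * x ^ n \<in> P) \<and> (\<exists>n. x ^ n * y \<in> P)}"
    have E: "cvx H N P ?E"
      using pow_hull_cvx[OF c x(1) x(2) l] .
    have "x ^ 1 * x \<in> P" "iv x * x ^ 2 \<in> P"
      using cone_mult[OF c x(1) x(1)] x(1) by (simp_all add: power2_eq_square)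
    then have "x \<in> ?E"
      using PH[OF x(1)] by blast
    then have "?E = H"
      using nc[OF E] cone_disj[OF c x(1)] by blast
    then obtain n where n1: "iv h * x ^ n \<in> P"
      using h by blast
    have zx: "iv x * z \<in> P \<or> iv x * z \<in> N"
    proof -
      have "iv x * z \<in> H"
        by (intro subgrp_mult[OF sH] subgrp_iv[OF sH] PH z x(1))
      then show ?thesis
        using cone_total[OF c, of "iv x * z"] x(3) by auto
    qed
    have rn: "iv (x ^ k) * u * x ^ k \<in> P" if "u \<in> P" for u k
    proof (induction k)
      case (Suc k)
      have "iv x * (iv (x ^ k) * u * x ^ k) * x \<in> P"
        using x(2) Suc by blast
      then show ?case
        unfolding power_Suc2 by (simp add: mult.assoc)
    qed (use that in simp)
    have xk: "x ^ k \<in> H" for k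
      using subgrp_pow[OF sH PH[OF x(1)]] .
    \<comment> \<open>Invariance under conjugation by \<open>x\<close> raises
      \<open>x \<le> z\<close> to powers, so cofinality of the powers of \<open>x\<close> passes to
      those of \<open>z\<close>.\<close>
    have "iv (x ^ k) * z ^ k \<in> P \<or> iv (x ^ k) * z ^ k \<in> N" for k
    proof (induction k)
      case 0
      then show ?case
        by (simp add: subgrp_one[OF sN])
    next
      case (Suc k)
      have a: "iv (x ^ k) * (iv x * z) * x ^ k \<in> P \<or> iv (x ^ k) * (iv x * z) * x ^ k \<in> N"
        using zx rn normal_inD2[OF n sH xk] by blast
      have e: "iv (x ^ Suc k) * z ^ Suc k = (iv (x ^ k) * (iv x * z) * x ^ k) * (iv (x ^ k) * z ^ k)"
        by (simp add: mult.assoc)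
      show ?case
        unfolding e using a Suc cone_mult[OF c] cone_NP[OF c] cone_PN[OF c] subgrp_mult[OF sN] by blast
    qed
    then have "(iv h * x ^ n) * (iv (x ^ n) * z ^ n) \<in> P"
      using cone_mult[OF c n1] cone_PN[OF c _ n1] by blast
    then have "iv h * z ^ n \<in> P"
      by (simp add: mult.assoc)
    then show ?thesis
      by blast
  qed
  then obtain \<phi> where "ohom H N P \<phi>"
    using hoelder[OF c n] by blast
  then show ?thesis
    using isolated_rank_one[OF _ i] by blast
qed

section \<open>Extensions of rank one by Archimedean\<close>

lemma qhom_ratio:
  assumes q: "qhom H A \<kappa>" and b: "b \<in> H" "\<kappa> b \<noteq> 0" and h: "h \<in> H"
  obtains k :: nat and m :: int where "0 < k" "real k * \<kappa> h = real_of_int m * \<kappa> b" "h ^ k * ipow b (- m) \<in> A"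
proof -
  have "\<kappa> h / \<kappa> b \<in> \<rat>"
    using qhomD(4)[OF q] b h by simp
  then obtain m :: int and k :: nat where k: "0 < k" "\<kappa> h / \<kappa> b = real_of_int m / real k"
    unfolding Rats_eq_int_div_nat by force
  then have e: "real k * \<kappa> h = real_of_int m * \<kappa> b"
    using b by (simp add: field_simps)
  have "\<kappa> (h ^ k * ipow b (- m)) = real k * \<kappa> h - real_of_int m * \<kappa> b"
    using qhomD(1,2)[OF q] b h by (simp add: hm_mult[of H] hm_pow[of H] hm_zp[of H] subgrp_pow subgrp_zp)
  then have "h ^ k * ipow b (- m) \<in> A"
    using e qhomD(1)[OF q] b h by (simp add: qhomD(3)[OF q] subgrp_mult subgrp_pow subgrp_zp)
  then show ?thesis
    using that k e by blast
qed

text \<open>Modulo \<open>A\<close> some positive power of \<open>h\<close> is a power of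
  \<open>b\<close>, and \<theta> factors through \<open>H/A\<close>. This proportionality is the
  main use of rank one.\<close>

lemma hm_vanishing:
  assumes q: "qhom H A \<kappa>" and b: "b \<in> H" "\<kappa> b \<noteq> 0" and t: "hm H \<theta>" "\<And>a. a \<in> A \<Longrightarrow> \<theta> a = 0" and h: "h \<in> H"
  shows "\<theta> h = \<kappa> h / \<kappa> b * \<theta> b"
proof -
  note sH = qhomD(1)[OF q]
  obtain k :: nat and m :: int where k: "0 < k" "real k * \<kappa> h = real_of_int m * \<kappa> b" "h ^ k * ipow b (- m) \<in> A"
    using qhom_ratio[OF q b h] .
  have "\<theta> (h ^ k * ipow b (- m)) = real k * \<theta> h - real_of_int m * \<theta> b"
    using t sH b h by (simp add: hm_mult[of H] hm_pow[of H] hm_zp[of H] subgrp_pow subgrp_zp)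
  then have "real k * \<theta> h = real_of_int m * \<theta> b"
    using t(2)[OF k(3)] by simp
  then have "\<kappa> b * (real k * \<theta> h) = (real k * \<kappa> h) * \<theta> b"
    unfolding k(2) by simp
  then have "real k * (\<kappa> b * \<theta> h) = real k * (\<kappa> h * \<theta> b)"
    by (simp only: mult.assoc mult.left_commute)
  then show ?thesis
    using k(1) b by (simp add: field_simps)
qed

text \<open>The commutator pairing on \<open>H/A\<close> is alternating, hence trivial since \<open>H/A\<close> has rank one.\<close>

lemma central_commutator:
  assumes q: "qhom H A \<kappa>" and hA: "hm A \<phi>"
    and cen: "\<And>h a. h \<in> H \<Longrightarrow> a \<in> A \<Longrightarrow> \<phi> (h * a * iv h) = \<phi> a" and xy: "x \<in> H" "y \<in> H"
  shows "\<phi> (x * y * iv x * iv y) = 0"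
proof -
  note sH = qhomD(1)[OF q]
  have sA: "subgrp A"
    using kernel_sg[OF sH qhomD(2)[OF q]] q by (simp add: qhom_def)
  have nA: "normal_in H A"
    using qhom_normal[OF q] .
  have cA: "g * h * iv g * iv h \<in> A" if "g \<in> H" "h \<in> H" for g h
    using that sH qhomD(2)[OF q] by (simp add: qhomD(3)[OF q] hm_mult[of H] hm_iv[of H] subgrp_mult subgrp_iv)
  define X where "X y x = \<phi> (x * y * iv x * iv y)" for x y
  have hX: "hm H (X y)" if y: "y \<in> H" for y
    unfolding hm_def
  proof (intro ballI)
    fix g h assume gh: "g \<in> H" "h \<in> H"
    \<comment> \<open>The commutator identity \<open>[gh, y] = g [h, y] g^-1 [g, y]\<close>; by
      \<open>cen\<close> the outer conjugation does not change the value.\<close>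
    have e: "(g * h) * y * iv (g * h) * iv y = (g * (h * y * iv h * iv y) * iv g) * (g * y * iv g * iv y)"
      by (simp add: mult.assoc)
    show "X y (g * h) = X y g + X y h"
      unfolding X_def e
      using hm_mult[OF hA normal_inD[OF nA gh(1) cA[OF gh(2) y]] cA[OF gh(1) y]] cen[OF gh(1) cA[OF gh(2) y]] by simp
  qed
  have X0: "X y a = 0" if y: "y \<in> H" and a: "a \<in> A" for y a
  proof -
    have e: "a * y * iv a * iv y = a * (y * iv a * iv y)"
      by (simp add: mult.assoc)
    have "iv a \<in> A"
      using a subgrp_iv[OF sA] by blast
    then show ?thesis
      unfolding X_def e using hm_mult[OF hA a normal_inD[OF nA y]] cen[OF y] hm_iv[OF hA sA a] by simp
  qed
  have anti: "X x y = - X y x" if "x \<in> H" "y \<in> H" for x y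
  proof -
    have e: "y * x * iv y * iv x = iv (x * y * iv x * iv y)"
      by (simp add: mult.assoc)
    show ?thesis
      unfolding X_def e using hm_iv[OF hA sA cA[OF that]] by simp
  qed
  show ?thesis
  proof (cases "\<exists>b\<in>H. \<kappa> b \<noteq> 0")
    case True
    then obtain b where b: "b \<in> H" "\<kappa> b \<noteq> 0"
      by blast
    have l: "X y x = \<kappa> x / \<kappa> b * X y b" if "x \<in> H" "y \<in> H" for x y
      using hm_vanishing[OF q b hX[OF that(2)] X0[OF that(2)] that(1)] .
    have "X b b = 0"
      by (simp add: X_def mult.assoc hm_one[OF hA sA])
    then have "X b y = 0"
      using l[OF xy(2) b(1)] by simp
    then have "X y b = 0"
      using anti[OF b(1) xy(2)] by simp
    then show ?thesis
      using l[OF xy] by (simp add: X_def)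
  next
    case False
    then have "x \<in> A"
      using xy qhomD(3)[OF q] by blast
    then show ?thesis
      using X0[OF xy(2)] by (simp add: X_def)
  qed
qed

text \<open>By \<open>central_commutator\<close>, \<open>H\<close> is abelian modulo the kernel of
  \<phi>. Prescribing the value 0 at \<open>b\<close> forces
  \<open>\<tau> h = \<phi> (h ^ k * ipow b (- m)) / k\<close> whenever \<open>h ^ k\<close> agrees
  with \<open>ipow b m\<close> modulo \<open>A\<close>.\<close>

lemma hom_extend:
  assumes q: "qhom H A \<kappa>" and hA: "hm A \<phi>"
    and cen: "\<And>h a. h \<in> H \<Longrightarrow> a \<in> A \<Longrightarrow> \<phi> (h * a * iv h) = \<phi> a"
  shows "\<exists>\<tau>. hm H \<tau> \<and> (\<forall>a\<in>A. \<tau> a = \<phi> a)"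
proof (cases "\<exists>b\<in>H. \<kappa> b \<noteq> 0")
  case False
  then have "H = A"
    using qhomD(3)[OF q] by blast
  then show ?thesis
    using hA by blast
next
  case True
  then obtain b where b: "b \<in> H" "\<kappa> b \<noteq> 0"
    by blast
  note sH = qhomD(1)[OF q] and nA = qhom_normal[OF q] and hH = qhomD(2)[OF q]
  have sA: "subgrp A"
    using kernel_sg[OF sH hH] q by (simp add: qhom_def)
  have AH: "a \<in> H" if "a \<in> A" for a
    using that qhomD(3)[OF q] by blast
  define eq where "eq x y \<longleftrightarrow> x \<in> H \<and> y \<in> H \<and> iv x * y \<in> A \<and> \<phi> (iv x * y) = 0" for x y
  have refl: "eq x x" if "x \<in> H" for x
    using that by (simp add: eq_def subgrp_one[OF sA] hm_one[OF hA sA])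
  have trans: "eq x z" if "eq x y" "eq y z" for x y z
  proof -
    have e: "iv x * z = (iv x * y) * (iv y * z)"
      by (simp add: mult.assoc)
    show ?thesis
      using that subgrp_mult[OF sA, of "iv x * y" "iv y * z"] hm_mult[OF hA, of "iv x * y" "iv y * z"]
      unfolding eq_def e by simp
  qed
  have left: "eq (z * x) (z * y)" if "eq x y" "z \<in> H" for x y z
    using that subgrp_mult[OF sH] by (auto simp: eq_def mult.assoc)
  have right: "eq (x * z) (y * z)" if "eq x y" "z \<in> H" for x y z
    using that normal_inD[OF nA subgrp_iv[OF sH that(2)], of "iv x * y"] cen[OF subgrp_iv[OF sH that(2)], of "iv x * y"] subgrp_mult[OF sH]
    by (auto simp: eq_def mult.assoc)
  have comm: "eq (x * y) (y * x)" if xy: "x \<in> H" "y \<in> H" for x y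
  proof -
    have e: "iv (x * y) * (y * x) = iv y * iv x * iv (iv y) * iv (iv x)"
      by (simp add: mult.assoc)
    have i: "iv y \<in> H" "iv x \<in> H"
      using xy subgrp_iv[OF sH] by auto
    have "iv y * iv x * iv (iv y) * iv (iv x) \<in> A"
      using i sH hH by (simp add: qhomD(3)[OF q] hm_mult[of H] hm_iv[of H] subgrp_mult subgrp_iv xy)
    then show ?thesis
      unfolding eq_def e using xy subgrp_mult[OF sH] central_commutator[OF q hA cen i] by simp
  qed
  have val: "\<phi> x = \<phi> y" if "eq x y" "x \<in> A" for x y
  proof -
    have "y = x * (iv x * y)"
      by simp
    then show ?thesis
      using that hm_mult[OF hA that(2), of "iv x * y"] by (simp add: eq_def)
  qed
  have sym: "eq y x" if "eq x y" for x y
    using that subgrp_iv[OF sA, of "iv x * y"] hm_iv[OF hA sA, of "iv x * y"] by (simp add: eq_def)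
  have exch: "eq ((x * y) * (z * w)) ((x * z) * (y * w))" if "x \<in> H" "y \<in> H" "z \<in> H" "w \<in> H" for x y z w
    using left[OF right[OF comm[OF that(2,3)] that(4)] that(1)] by (simp add: mult.assoc)
  have pw: "eq ((x * y) ^ n) (x ^ n * y ^ n)" if "x \<in> H" "y \<in> H" for x y n
  proof (induction n)
    case (Suc n)
    have "eq ((x * y) * (x * y) ^ n) ((x * y) * (x ^ n * y ^ n))"
      using left[OF Suc subgrp_mult[OF sH that]] .
    moreover have "eq ((x * y) * (x ^ n * y ^ n)) ((x * x ^ n) * (y * y ^ n))"
      using that subgrp_pow[OF sH] by (intro exch) auto
    ultimately show ?case
      unfolding power_Suc by (rule trans)
  qed (simp add: refl subgrp_one[OF sH])
  define val' where "val' h k m \<longleftrightarrow> 0 < k \<and> real k * \<kappa> h = real_of_int m * \<kappa> b" for h and k :: nat and m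
  define T where "T h k m = \<phi> (h ^ k * ipow b (- m))" for h and k :: nat and m
  have inA: "h ^ k * ipow b (- m) \<in> A" if "h \<in> H" "val' h k m" for h k m
    using that b sH hH by (simp add: val'_def qhomD(3)[OF q] hm_mult[of H] hm_pow[of H] hm_zp[of H] subgrp_mult subgrp_pow subgrp_zp)
  \<comment> \<open>Two representations of the same ratio have a common multiple, so homogeneity
    makes the quotient independent of the chosen \<open>k\<close> and \<open>m\<close>.\<close>
  have scale: "T h (k * j) (m * int j) = real j * T h k m" if h: "h \<in> H" "val' h k m" for h k m and j :: nat
  proof -
    have zb: "ipow b (- m * int j) = ipow b (- m) ^ j"
    proof (induction j)
      case (Suc j)
      have "ipow b (- m * int (Suc j)) = ipow b (- m + - m * int j)"
        by (simp add: ring_distribs)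
      then show ?case
        unfolding ipow_add using Suc by simp
    qed simp
    have "eq ((h ^ k * ipow b (- m)) ^ j) ((h ^ k) ^ j * ipow b (- m) ^ j)"
      using h b by (intro pw subgrp_pow[OF sH] subgrp_zp[OF sH]) auto
    then have "eq ((h ^ k * ipow b (- m)) ^ j) (h ^ (k * j) * ipow b (- (m * int j)))"
      using zb by (simp add: power_mult)
    then have "\<phi> ((h ^ k * ipow b (- m)) ^ j) = T h (k * j) (m * int j)"
      unfolding T_def using val subgrp_pow[OF sA inA[OF h]] by blast
    then show ?thesis
      using hm_pow[OF hA sA inA[OF h]] by (simp add: T_def)
  qed
  have add: "T (g * h) k (m + n) = T g k m + T h k n"
    if gh: "g \<in> H" "h \<in> H" "val' g k m" "val' h k n" for g h k m n
  proof -
    have H: "g ^ k \<in> H" "h ^ k \<in> H" "ipow b (- m) \<in> H" "ipow b (- n) \<in> H"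
      using gh b by (auto intro: subgrp_pow[OF sH] subgrp_zp[OF sH])
    have e: "ipow b (- (m + n)) = ipow b (- m) * ipow b (- n)"
      by (simp flip: ipow_add)
    have "eq ((g ^ k * ipow b (- m)) * (h ^ k * ipow b (- n))) ((g ^ k * h ^ k) * (ipow b (- m) * ipow b (- n)))"
      using exch H by blast
    moreover have "eq ((g ^ k * h ^ k) * (ipow b (- m) * ipow b (- n))) ((g * h) ^ k * (ipow b (- m) * ipow b (- n)))"
      using right[OF sym[OF pw[OF gh(1,2)]] subgrp_mult[OF sH H(3,4)]] .
    ultimately have "eq ((g ^ k * ipow b (- m)) * (h ^ k * ipow b (- n))) ((g * h) ^ k * ipow b (- (m + n)))"
      unfolding e by (rule trans)
    then show ?thesis
      unfolding T_def using val subgrp_mult[OF sA inA[OF gh(1,3)] inA[OF gh(2,4)]]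
        hm_mult[OF hA inA[OF gh(1,3)] inA[OF gh(2,4)]] by metis
  qed
  have "\<exists>k m. val' h k m" if "h \<in> H" for h
    using qhom_ratio[OF q b that] unfolding val'_def by blast
  then obtain kk mm where km: "\<And>h. h \<in> H \<Longrightarrow> val' h (kk h) (mm h)"
    by metis
  define \<tau> where "\<tau> h = T h (kk h) (mm h) / real (kk h)" for h
  have indep: "\<tau> h = T h k m / real k" if h: "h \<in> H" "val' h k m" for h k m
  proof -
    have v: "0 < k" "0 < kk h" "real k * \<kappa> h = real_of_int m * \<kappa> b" "real (kk h) * \<kappa> h = real_of_int (mm h) * \<kappa> b"
      using h(2) km[OF h(1)] by (auto simp: val'_def)
    have "real_of_int (m * int (kk h)) * \<kappa> b = real_of_int (mm h * int k) * \<kappa> b"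
    proof -
      have "real_of_int (m * int (kk h)) * \<kappa> b = real (kk h) * (real k * \<kappa> h)"
        unfolding v(3) by simp
      also have "\<dots> = real k * (real (kk h) * \<kappa> h)"
        by simp
      also have "\<dots> = real_of_int (mm h * int k) * \<kappa> b"
        unfolding v(4) by simp
      finally show ?thesis .
    qed
    then have "m * int (kk h) = mm h * int k"
      using b(2) by (simp only: mult_cancel_right of_int_eq_iff) simp
    then have "real (kk h) * T h k m = real k * T h (kk h) (mm h)"
      using scale[OF h, of "kk h"] scale[OF h(1) km[OF h(1)], of k] by (simp add: mult.commute)
    then show ?thesis
      using v by (simp add: \<tau>_def field_simps)
  qed
  have "\<tau> (g * h) = \<tau> g + \<tau> h" if gh: "g \<in> H" "h \<in> H" for g h
  proof -
    define K where "K = kk g * kk h"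
    have g: "val' g K (mm g * int (kk h))"
      using km[OF gh(1)] km[OF gh(2)] by (simp add: val'_def K_def)
    have h: "val' h K (mm h * int (kk g))"
      using km[OF gh(1)] km[OF gh(2)] by (simp add: val'_def K_def)
    have "val' (g * h) K (mm g * int (kk h) + mm h * int (kk g))"
      using g h hm_mult[OF hH gh] by (simp add: val'_def algebra_simps)
    then show ?thesis
      using indep[OF subgrp_mult[OF sH gh]] indep[OF gh(1) g] indep[OF gh(2) h] add[OF gh g h]
      by (simp add: add_divide_distrib)
  qed
  moreover have "\<tau> a = \<phi> a" if "a \<in> A" for a
    using indep[OF AH[OF that], of 1 0] that qhomD(3)[OF q] by (simp add: val'_def T_def)
  ultimately show ?thesis
    unfolding hm_def by blast
qed

text \<open>The cocycles \<open>\<tau> + x \<kappa>\<close> with \<open>x\<close> large define orders close to the given one in which \<open>A\<close> is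
  no longer convex.\<close>

lemma cocycle_perturbation:
  assumes i: "isolated H N P" and A: "cvx H N P A" and o: "ohom A N (P \<inter> A) \<phi>"
    and l: "\<And>h. h \<in> H \<Longrightarrow> 0 < l h"
    and t: "\<And>g h. g \<in> H \<Longrightarrow> h \<in> H \<Longrightarrow> \<tau> (g * h) = \<tau> g + l g * \<tau> h" "\<And>a. a \<in> A \<Longrightarrow> \<tau> a = \<phi> a"
    and k: "\<And>g h. g \<in> H \<Longrightarrow> h \<in> H \<Longrightarrow> \<kappa> (g * h) = \<kappa> g + l g * \<kappa> h" "\<And>a. a \<in> A \<Longrightarrow> \<kappa> a = 0"
      "\<And>h. h \<in> P - A \<Longrightarrow> 0 < \<kappa> h"
    and b: "b \<in> P - A" and a: "a \<in> P \<inter> A"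
  shows False
proof -
  note c = isolated_cone[OF i]
  note sH = cone_sg(1)[OF c]
  have PH: "x \<in> P \<Longrightarrow> x \<in> H" for x
    using cone_mem(1)[OF c] .
  have AH: "x \<in> A \<Longrightarrow> x \<in> H" for x
    using cvx_sub(2)[OF A] by blast
  define \<psi> where "\<psi> r h = \<tau> h + r * \<kappa> h" for r h
  have mul: "\<psi> r (g * h) = \<psi> r g + l g * \<psi> r h" if "g \<in> H" "h \<in> H" for r g h
    unfolding \<psi>_def t(1)[OF that] k(1)[OF that] by (simp add: algebra_simps)
  have one: "\<psi> r 1 = 0" for r
    using mul[of 1 1 r] subgrp_one[OF sH] l[of 1] by simp
  have iv: "\<psi> r (iv h) = - \<psi> r h / l h" if "h \<in> H" for r h
    using mul[OF that subgrp_iv[OF sH that], of r] one l[OF that] by (simp add: field_simps)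
  \<comment> \<open>This is the order of the orbit of 0 under the affine maps
    \<open>x \<mapsto> \<psi> r g + l g * x\<close>, refined on the stabilizer of 0 by
    \<open>P\<close>.\<close>
  define Q where "Q r = {h\<in>H. 0 < \<psi> r h \<or> \<psi> r h = 0 \<and> h \<in> P}" for r
  have Q: "cone H N (Q r)" for r
  proof (rule coneI)
    show "subgrp H" "subgrp N" "N \<subseteq> H" "Q r \<subseteq> H"
      using cone_sg[OF c] cone_sub[OF c] by (auto simp: Q_def)
    show "x \<notin> N" if "x \<in> Q r" for x
    proof
      assume "x \<in> N"
      then have "x \<in> A" "\<phi> x = 0" "x \<notin> P"
        using ohomD(4)[OF o, of x] cone_disj[OF c] by auto
      then show False
        using that t(2)[of x] k(2)[of x] by (simp add: Q_def \<psi>_def)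
    qed
    show "x * y \<in> Q r" if xy: "x \<in> Q r" "y \<in> Q r" for x y
    proof -
      have H: "x \<in> H" "y \<in> H" and nn: "0 \<le> \<psi> r x" "0 \<le> \<psi> r y"
        using xy by (auto simp: Q_def)
      have "0 \<le> l x * \<psi> r y"
        using l[OF H(1)] nn by simp
      moreover have "0 < l x * \<psi> r y" if "0 < \<psi> r y"
        using l[OF H(1)] that by simp
      ultimately have "0 < \<psi> r (x * y) \<or> \<psi> r x = 0 \<and> \<psi> r y = 0"
        using nn unfolding mul[OF H] by linarith
      then show ?thesis
        using xy mul[OF H, of r] subgrp_mult[OF sH H] cone_mult[OF c, of x y] unfolding Q_def by auto
    qed
    show "x \<in> Q r \<or> x \<in> N \<or> iv x \<in> Q r" if x: "x \<in> H" for x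
    proof -
      consider "0 < \<psi> r x" | "\<psi> r x < 0" | "\<psi> r x = 0"
        by linarith
      then show ?thesis
      proof cases
        case 2
        then have "0 < \<psi> r (iv x)"
          using iv[OF x, of r] l[OF x] by (simp add: divide_neg_pos)
        then show ?thesis
          using subgrp_iv[OF sH x] by (simp add: Q_def)
      next
        case 3
        then have "\<psi> r (iv x) = 0"
          using iv[OF x, of r] by simp
        then show ?thesis
          using 3 x subgrp_iv[OF sH x] cone_total[OF c x] by (auto simp: Q_def)
      qed (use x in \<open>simp add: Q_def\<close>)
    qed
  qed
  obtain F where F: "finite F" "F \<subseteq> P" "\<And>Q. cone H N Q \<Longrightarrow> F \<subseteq> Q \<Longrightarrow> Q = P"
    using i by (auto simp: isolated_def)
  have "\<forall>\<^sub>F r in at_top. \<forall>f\<in>F. 0 < \<psi> r f"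
  proof (intro eventually_ball_finite[OF F(1)] ballI)
    fix f assume "f \<in> F"
    then have f: "f \<in> P"
      using F(2) by blast
    show "\<forall>\<^sub>F r in at_top. 0 < \<psi> r f"
    proof (cases "f \<in> A")
      case True
      then have "0 < \<psi> r f" for r
        using ohomD(3)[OF o, of f] f t(2)[of f] k(2)[of f] by (simp add: \<psi>_def)
      then show ?thesis
        by simp
    next
      case False
      then have "0 < \<kappa> f"
        using k(3) f by blast
      then have "0 < \<psi> r f" if "- \<tau> f / \<kappa> f < r" for r
        using that by (simp add: \<psi>_def field_simps)
      then show ?thesis
        by (rule eventually_mono[OF eventually_gt_at_top])
    qed
  qed
  then obtain r where r: "\<And>f. f \<in> F \<Longrightarrow> 0 < \<psi> r f"
    using eventually_happens'[of "at_top :: real filter"] trivial_limit_at_top_linorder by blast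
  have "F \<subseteq> Q r"
    using F(2) r PH by (auto simp: Q_def)
  then have QP: "Q r = P"
    using F(3) Q by blast
  have aA: "a \<in> A" "0 < \<phi> a"
    using a ohomD(3)[OF o, of a] by auto
  have bH: "b \<in> H"
    using b PH by blast
  \<comment> \<open>In \<open>P\<close> the element \<open>b\<close> dominates all of
    \<open>A\<close>, but in the affine order a large enough power of \<open>a\<close> outweighs it;
    the factor \<open>l b\<close> enters because \<open>a\<close> is multiplied on the right of
    \<open>b\<close>.\<close>
  obtain n :: nat where n: "\<psi> r b / (l b * \<phi> a) < real n"
    using reals_Archimedean2 by blast
  let ?a = "iv (a ^ n)"
  have an: "?a \<in> A" "?a \<in> H"
    using subgrp_iv[OF cvx_sg[OF A] subgrp_pow[OF cvx_sg[OF A] aA(1)]] AH by auto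
  have "\<phi> ?a = - real n * \<phi> a"
    using hm_iv[OF ohomD(2,1)[OF o] subgrp_pow[OF ohomD(1)[OF o] aA(1)], of n] hm_pow[OF ohomD(2,1)[OF o] aA(1), of n]
    by simp
  then have "\<psi> r ?a = - real n * \<phi> a"
    using t(2)[OF an(1)] k(2)[OF an(1)] by (simp add: \<psi>_def)
  then have "\<psi> r (b * ?a) = \<psi> r b - l b * (real n * \<phi> a)"
    using mul[OF bH an(2), of r] by simp
  also have "\<dots> < 0"
    using n l[OF bH] aA by (simp add: field_simps)
  finally have "b * ?a \<notin> Q r"
    by (simp add: Q_def)
  moreover have "b * ?a \<in> P - A"
    using cone_PN[OF cvx_cone_above[OF c A] an(1) b] .
  ultimately show False
    using QP by blast
qed

text \<open>If every conjugation acts on \<open>A/N\<close> by a positive factor, there are two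
  cocycles for the scale character \<open>l\<close>: one extending \<phi>, and one vanishing on
  \<open>A\<close> and positive on \<open>P - A\<close>. When \<open>l = 1\<close> these are
  homomorphisms; otherwise the second is \<open>l - 1\<close> up to sign and the first comes from
  commutators.\<close>

lemma lex_not_isolated:
  assumes i: "isolated H N P" and A: "cvx H N P A" and nN: "normal_in H N"
    and o: "ohom A N (P \<inter> A) \<phi>" and k: "ohom H A (P - A) \<kappa>" and q: "qhom H A \<kappa>"
    and pos: "\<And>h a. h \<in> H \<Longrightarrow> a \<in> P \<inter> A \<Longrightarrow> h * a * iv h \<in> P"
    and b: "b \<in> P - A" and a: "a \<in> P \<inter> A"
  shows False
proof -
  note c = isolated_cone[OF i]
  note sH = cone_sg(1)[OF c] and nA = ohom_normal[OF k] and sA = cvx_sg[OF A]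
  have AH: "x \<in> A \<Longrightarrow> x \<in> H" for x
    using cvx_sub(2)[OF A] by blast
  have pos': "h * a * iv h \<in> P \<inter> A" if "h \<in> H" "a \<in> P \<inter> A" for h a
    using that pos normal_inD[OF nA] by blast
  obtain l where l: "\<And>h. h \<in> H \<Longrightarrow> 0 < l h" "\<And>h a. h \<in> H \<Longrightarrow> a \<in> A \<Longrightarrow> \<phi> (h * a * iv h) = l h * \<phi> a"
    "\<And>g h. g \<in> H \<Longrightarrow> h \<in> H \<Longrightarrow> l (g * h) = l g * l h" "\<And>a. a \<in> A \<Longrightarrow> l a = 1"
    using conj_scale[OF o sH cvx_sub(2)[OF A] nA nN pos'] a by blast
  show False
  proof (cases "\<forall>h\<in>H. l h = 1")
    case True
    then have cen: "\<phi> (h * a * iv h) = \<phi> a" if "h \<in> H" "a \<in> A" for h a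
      using l(2)[OF that] that by simp
    obtain \<tau> where t: "hm H \<tau>" "\<And>a. a \<in> A \<Longrightarrow> \<tau> a = \<phi> a"
      using hom_extend[OF q ohomD(2)[OF o] cen] by blast
    show False
    proof (rule cocycle_perturbation[where l = "\<lambda>_. 1" and \<tau> = \<tau> and \<kappa> = \<kappa>, OF i A o])
      show "\<kappa> h > 0" if "h \<in> P - A" for h
        using that ohomD(3)[OF k] by blast
      show "\<kappa> a = 0" if "a \<in> A" for a
        using that ohomD(4)[OF k] by blast
    qed (use hm_mult[OF t(1)] hm_mult[OF ohomD(2)[OF k]] t(2) a b in simp_all)
  next
    case False
    then obtain d where d: "d \<in> H" "l d \<noteq> 1"
      by blast
    define w where "w = ln (l d) / \<kappa> d"
    have kd: "\<kappa> d \<noteq> 0"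
      using d l(4) ohomD(4)[OF k, of d] by blast
    have "hm H (\<lambda>h. ln (l h))"
      unfolding hm_def
    proof (intro ballI)
      fix x y assume xy: "x \<in> H" "y \<in> H"
      show "ln (l (x * y)) = ln (l x) + ln (l y)"
        unfolding l(3)[OF xy] using ln_mult_pos[OF l(1)[OF xy(1)] l(1)[OF xy(2)]] .
    qed
    \<comment> \<open>The logarithm of the scale vanishes on \<open>A\<close>, hence is a multiple
      of \<kappa>.\<close>
    then have "ln (l x) = w * \<kappa> x" if "x \<in> H" for x
      using hm_vanishing[OF q d(1) kd _ _ that, of "\<lambda>h. ln (l h)"] l(4) by (simp add: w_def)
    then have l_exp: "l x = exp (w * \<kappa> x)" if "x \<in> H" for x
      using l(1) that by (metis exp_ln)
    have w: "w \<noteq> 0"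
      using l(1)[OF d(1)] d(2) kd by (simp add: w_def)
    have sgn_pos: "0 < sgn w * (l x - 1)" if "x \<in> P - A" for x
    proof -
      have "x \<in> H" "0 < \<kappa> x"
        using that ohomD(3)[OF k] by blast+
      then show ?thesis
        using w by (cases "0 < w") (auto simp: l_exp mult_less_0_iff mult_neg_neg sgn_if)
    qed
    \<comment> \<open>The formula is forced by \<open>\<tau> d = 0\<close>, that is, by putting the
      fixed point of \<open>d\<close> at the origin: a cocycle extending \<phi> then satisfies
      \<open>\<phi> [h, d] = (1 - l d) * \<tau> h\<close>.\<close>
    define \<tau> where "\<tau> h = \<phi> (h * d * iv h * iv d) / (1 - l d)" for h
    have com: "h * d * iv h * iv d \<in> A" if "h \<in> H" for h
      using ohom_commutator[OF k that d(1)] .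
    \<comment> \<open>The function \<open>l - 1\<close> is a cocycle for \<open>l\<close> and, by
      the exponential form of \<open>l\<close>, has the sign of \<open>w * \<kappa>\<close>; the
      factor \<open>sgn w\<close> corrects that sign.\<close>
    show False
    proof (rule cocycle_perturbation[where l = l and \<tau> = \<tau> and \<kappa> = "\<lambda>h. sgn w * (l h - 1)", OF i A o])
      show "\<tau> (g * h) = \<tau> g + l g * \<tau> h" if gh: "g \<in> H" "h \<in> H" for g h
      proof -
        have e: "g * h * d * iv (g * h) * iv d = (g * (h * d * iv h * iv d) * iv g) * (g * d * iv g * iv d)"
          by (simp add: mult.assoc)
        have "\<phi> (g * h * d * iv (g * h) * iv d) = l g * \<phi> (h * d * iv h * iv d) + \<phi> (g * d * iv g * iv d)"
          unfolding e using hm_mult[OF ohomD(2)[OF o] normal_inD[OF nA gh(1) com[OF gh(2)]] com[OF gh(1)]]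
            l(2)[OF gh(1) com[OF gh(2)]] by simp
        then show ?thesis
          by (simp add: \<tau>_def add_divide_distrib)
      qed
      show "\<tau> a = \<phi> a" if a: "a \<in> A" for a
      proof -
        have e: "a * d * iv a * iv d = a * (d * iv a * iv d)"
          by (simp add: mult.assoc)
        have ia: "iv a \<in> A"
          using subgrp_iv[OF sA a] .
        have "\<phi> (a * d * iv a * iv d) = \<phi> a + l d * - \<phi> a"
          unfolding e using hm_mult[OF ohomD(2)[OF o] a normal_inD[OF nA d(1) ia]] l(2)[OF d(1) ia]
            hm_iv[OF ohomD(2,1)[OF o] a] by simp
        then show ?thesis
          using d(2) by (simp add: \<tau>_def field_simps)
      qed
      show "sgn w * (l (g * h) - 1) = sgn w * (l g - 1) + l g * (sgn w * (l h - 1))" if "g \<in> H" "h \<in> H" for g h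
        using l(3)[OF that] by (simp add: algebra_simps)
      show "sgn w * (l a - 1) = 0" if "a \<in> A" for a
        using l(4)[OF that] by simp
      show "0 < sgn w * (l h - 1)" if "h \<in> P - A" for h
        using sgn_pos[OF that] .
    qed (use a b l(1) in simp_all)
  qed
qed

section \<open>Conradian orders\<close>

definition Ccone :: "'g::grp set \<Rightarrow> 'g set \<Rightarrow> bool" where
  "Ccone H P \<longleftrightarrow> cone H {1} P \<and> (\<forall>f\<in>P. \<forall>g\<in>P. \<exists>n\<ge>1. iv g * f * g ^ n \<in> P)"

lemma Ccone_cone: "Ccone H P \<Longrightarrow> cone H {1} P"
  by (simp add: Ccone_def)

text \<open>The exponent in the Conrad property can always be taken to be 2. If it failed for 2,
  then \<open>y = f * g\<close> would satisfy \<open>y * g \<le> g\<close>, hence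
  \<open>y ^ k < g\<close> for all \<open>k\<close>. This gives
  \<open>f * y ^ k < f * g = y\<close>, violating the property for \<open>f\<close> and
  \<open>y\<close>.\<close>

lemma Ccone_square:
  assumes C: "Ccone H P" and f: "f \<in> P" and g: "g \<in> P"
  shows "iv g * f * g ^ 2 \<in> P"
proof (rule ccontr)
  note c = Ccone_cone[OF C]
  note sH = cone_sg(1)[OF c]
  assume n: "iv g * f * g ^ 2 \<notin> P"
  define y where "y = f * g"
  define w where "w = iv g * y * g"
  have fgH: "f \<in> H" "g \<in> H"
    using f g cone_mem(1)[OF c] by auto
  have w: "w = iv g * f * g ^ 2"
    by (simp add: w_def y_def power2_eq_square mult.assoc)
  have "w \<in> H"
    unfolding w by (intro subgrp_mult[OF sH] subgrp_iv[OF sH] subgrp_pow[OF sH] fgH)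
  then have iw: "iv w = 1 \<or> iv w \<in> P"
    using cone_total[OF c] n w iv_one by fastforce
  have yP: "y \<in> P"
    unfolding y_def using cone_mult[OF c f g] .
  have "iv y * f * y ^ k \<notin> P" if k: "1 \<le> k" for k
  proof
    assume p: "iv y * f * y ^ k \<in> P"
    have "iv w ^ k = 1 \<or> iv w ^ k \<in> P"
      using iw cone_pow[OF c] k by auto
    then have "g * iv w ^ k \<in> P"
      using cone_mult[OF c g] g by auto
    moreover have "iv w ^ k = iv g * iv (y ^ k) * g"
      using conj_power[of "iv g" "iv y" k] by (simp add: w_def mult.assoc iv_power)
    ultimately have "iv (y ^ k) * g \<in> P"
      by (simp add: mult.assoc)
    moreover have "iv (y ^ k) * g = iv (iv y * f * y ^ k)"
      by (simp add: mult.assoc y_def)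
    ultimately show False
      using cone_iv[OF c p] by simp
  qed
  then show False
    using C f yP unfolding Ccone_def by blast
qed

text \<open>\<open>E\<close> consists of the elements that are bounded, together with their
  inverses, by powers of \<open>f\<close>. If \<open>x < f ^ a\<close> and \<open>y < f ^ m\<close>,
  then \<open>Ccone_square\<close> gives \<open>x * y < x * f ^ m < f ^ (a + 2 * m)\<close>, which
  replaces right invariance.\<close>

lemma Ccone_pow_hull:
  assumes C: "Ccone H P" and f: "f \<in> P"
  defines "E \<equiv> {x\<in>H. (\<exists>n. iv x * f ^ n \<in> P) \<and> (\<exists>n. x * f ^ n \<in> P)}"
  shows "cvx H {1} P E" "f \<in> E"
proof -
  note c = Ccone_cone[OF C]
  note sH = cone_sg(1)[OF c]
  have suc: "\<exists>n\<ge>1. x * f ^ n \<in> P" if "x * f ^ k \<in> P" for x k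
  proof -
    have "x * f ^ k * f \<in> P"
      using cone_mult[OF c that f] .
    then show ?thesis
      by (intro exI[of _ "Suc k"]) (simp add: power_Suc2 mult.assoc del: power_Suc)
  qed
  have up: "\<exists>n. iv (x * y) * f ^ n \<in> P" if x: "iv x * f ^ a \<in> P" and y: "iv y * f ^ b \<in> P" for x y a b
  proof -
    obtain m where m: "1 \<le> m" "iv y * f ^ m \<in> P"
      using suc[OF y] by blast
    have fm: "f ^ m \<in> P"
      using cone_pow[OF c f] m by simp
    have "iv y * f ^ m * (iv (f ^ m) * (iv x * f ^ a) * (f ^ m) ^ 2) \<in> P"
      using cone_mult[OF c m(2) Ccone_square[OF C x fm]] .
    then have "iv (x * y) * f ^ (a + m * 2) \<in> P"
      by (simp add: mult.assoc power_add power_mult)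
    then show ?thesis
      by blast
  qed
  have m: "x * y \<in> E" if xy: "x \<in> E" "y \<in> E" for x y
  proof -
    obtain a b where ab: "iv x * f ^ a \<in> P" "iv y * f ^ b \<in> P"
      using xy by (auto simp: E_def)
    obtain a' b' where ab': "x * f ^ a' \<in> P" "y * f ^ b' \<in> P"
      using xy by (auto simp: E_def)
    have "\<exists>n. iv (iv y * iv x) * f ^ n \<in> P"
      by (rule up[of "iv y" b' "iv x" a']) (simp_all add: ab')
    then show ?thesis
      using up[OF ab] xy subgrp_mult[OF sH] unfolding E_def by simp
  qed
  show f: "f \<in> E"
  proof -
    have "iv f * f ^ 2 \<in> P" "f * f ^ 1 \<in> P"
      using f cone_mult[OF c f f] by (simp_all add: power2_eq_square)
    then show ?thesis
      unfolding E_def using cone_mem(1)[OF c f] by blast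
  qed
  have "1 * f ^ 1 \<in> P"
    using \<open>f \<in> P\<close> by simp
  then have "1 \<in> E"
    unfolding E_def using subgrp_one[OF sH] by (auto intro!: exI[of _ 1])
  moreover have "iv x \<in> E" if "x \<in> E" for x
    using that subgrp_iv[OF sH] by (auto simp: E_def)
  ultimately have "subgrp E"
    unfolding subgrp_def using m by blast
  moreover have "u \<in> E" if uv: "u \<in> P" "v \<in> P" "u * v \<in> E" for u v
  proof -
    obtain n where "iv (u * v) * f ^ n \<in> P"
      using uv by (auto simp: E_def)
    then have "v * (iv (u * v) * f ^ n) \<in> P"
      using cone_mult[OF c] uv by blast
    then have "iv u * f ^ n \<in> P"
      by (simp add: mult.assoc)
    moreover have "u * f ^ 0 \<in> P"
      using uv by simp
    ultimately show ?thesis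
      unfolding E_def using cone_mem(1)[OF c uv(1)] by blast
  qed
  ultimately show "cvx H {1} P E"
    unfolding cvx_def using \<open>1 \<in> E\<close> by (auto simp: E_def)
qed

text \<open>By maximality of \<open>S\<close>, powers of any positive element outside
  \<open>S\<close> are cofinal. A conjugate of \<open>s\<close> in \<open>S\<close> cannot be such
  an element, since its powers are conjugates of powers of \<open>s\<close>, which stay in
  \<open>S\<close>. So \<open>S\<close> is normal and \<open>hoelder\<close> applies.\<close>

theorem conrad_jump:
  assumes C: "Ccone H P" and S: "cvx H {1} P S" and max: "\<And>D. cvx H {1} P D \<Longrightarrow> D \<subseteq> S \<or> D = H"
  shows "\<exists>\<phi>. ohom H S (P - S) \<phi>"
proof -
  note c = Ccone_cone[OF C]
  note sH = cone_sg(1)[OF c] and sS = cvx_sg[OF S]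
  note cS = cvx_cone_above[OF c S]
  have cof: "\<exists>n. iv h * f ^ n \<in> P" if f: "f \<in> P - S" and h: "h \<in> H" for f h
  proof -
    have fP: "f \<in> P"
      using f by blast
    show ?thesis
      using max[OF Ccone_pow_hull(1)[OF C fP]] Ccone_pow_hull(2)[OF C fP] f h by blast
  qed
  have N1: "iv h * s * h \<notin> P - S" if h: "h \<in> P - S" and s: "s \<in> S" for h s
  proof
    assume u: "iv h * s * h \<in> P - S"
    have hP: "h \<in> P" "h \<in> H"
      using h cone_mem(1)[OF c] by blast+
    \<comment> \<open>The bound \<open>h ^ 2\<close> matches the exponent of
      \<open>Ccone_square\<close>, which is applied to \<open>iv (s ^ n) * h\<close> and
      \<open>h\<close> to reach the opposite inequality.\<close>
    obtain n where n: "iv (h ^ 2) * (iv h * s * h) ^ n \<in> P"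
      using cof[OF u subgrp_pow[OF sH hP(2)]] by blast
    have "(iv h * s * h) ^ n = iv h * s ^ n * h"
      using conj_power[of "iv h" s n] by simp
    then have p: "iv (h ^ 2) * (iv h * s ^ n * h) \<in> P"
      using n by simp
    have "iv (s ^ n) * h \<in> P"
      using cone_NP[OF cS subgrp_iv[OF sS subgrp_pow[OF sS s]] h] by blast
    then have "iv h * (iv (s ^ n) * h) * h ^ 2 \<in> P"
      using Ccone_square[OF C _ hP(1)] by blast
    then have "iv (iv (h ^ 2) * (iv h * s ^ n * h)) \<in> P"
      by (simp add: mult.assoc)
    then show False
      using cone_iv[OF c p] by blast
  qed
  have N2: "h * s * iv h \<notin> P - S" if h: "h \<in> P - S" and s: "s \<in> S" for h s
  proof
    assume u: "h * s * iv h \<in> P - S"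
    have hP: "h \<in> P" "h \<in> H"
      using h cone_mem(1)[OF c] by blast+
    obtain n where "iv h * (h * s * iv h) ^ n \<in> P"
      using cof[OF u hP(2)] by blast
    then have p: "s ^ n * iv h \<in> P"
      unfolding conj_power by (simp add: mult.assoc)
    have "h * iv (s ^ n) \<in> P"
      using cone_PN[OF cS subgrp_iv[OF sS subgrp_pow[OF sS s]] h] by blast
    then show False
      using cone_iv[OF c p] by simp
  qed
  have SH: "s \<in> S \<Longrightarrow> s \<in> H" for s
    using cvx_sub(2)[OF S] by blast
  have nS: "normal_in H S"
    unfolding normal_in_def
  proof (intro ballI)
    fix h s assume h: "h \<in> H" and s: "s \<in> S"
    have is': "iv s \<in> S"
      using subgrp_iv[OF sS s] .
    have cH: "h * s * iv h \<in> H"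
      by (intro subgrp_mult[OF sH] subgrp_iv[OF sH] h SH s)
    have np: "h * s * iv h \<notin> P - S \<and> iv (h * s * iv h) \<notin> P - S" if hS: "h \<notin> S"
    proof -
      have e: "iv (h * s * iv h) = h * iv s * iv h"
        by (simp add: mult.assoc)
      consider "h \<in> P - S" | "iv h \<in> P - S"
        using cone_total[OF cS h] hS by blast
      then show ?thesis
      proof cases
        case 1
        then show ?thesis
          unfolding e using N2[OF 1 s] N2[OF 1 is'] by blast
      next
        case 2
        then show ?thesis
          unfolding e using N1[OF 2 s] N1[OF 2 is'] by simp
      qed
    qed
    show "h * s * iv h \<in> S"
    proof (cases "h \<in> S")
      case True
      then show ?thesis
        by (intro subgrp_mult[OF sS] subgrp_iv[OF sS] s)
    next
      case False
      then show ?thesis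
        using cone_total[OF cS cH] np by blast
    qed
  qed
  have "\<exists>n. iv h * f ^ n \<in> P - S" if f: "f \<in> P - S" and h: "h \<in> H" for f h
  proof -
    obtain n where n: "iv h * f ^ n \<in> P"
      using cof[OF f h] by blast
    \<comment> \<open>One more factor \<open>f\<close> moves the element out of \<open>S\<close>, as
      the quotient cone demands.\<close>
    have "iv h * f ^ n * f \<in> P - S"
    proof (cases "iv h * f ^ n \<in> S")
      case True
      then show ?thesis
        using cone_NP[OF cS True f] by blast
    next
      case False
      then show ?thesis
        using cone_mult[OF cS _ f] n by blast
    qed
    then show ?thesis
      by (intro exI[of _ "Suc n"]) (simp add: power_Suc2 mult.assoc del: power_Suc)
  qed
  then show ?thesis
    using hoelder[OF cS nS] by blast
qed

text \<open>Outside \<open>S\<close> the order is unchanged, and an extra factor \<open>g\<close>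
  from \<open>P - S\<close> absorbs whatever lies in \<open>S\<close>. Inside \<open>S\<close> the
  claim is the mirror image of \<open>Ccone_square\<close>.\<close>

lemma Ccone_flip:
  assumes C: "Ccone H P" and S: "cvx H {1} P S"
  shows "Ccone H ((P - S) \<union> iv ` (P \<inter> S))"
proof -
  note c = Ccone_cone[OF C]
  note sH = cone_sg(1)[OF c] and sS = cvx_sg[OF S]
  note cS = cvx_cone_above[OF c S] and cB = cvx_cone_below[OF c S]
  have mem: "x \<in> iv ` (P \<inter> S) \<longleftrightarrow> iv x \<in> P \<inter> S" for x
    by (metis (no_types, lifting) image_iff iv_iv)
  have "cone S {1} (iv ` (P \<inter> S))"
  proof (rule coneI)
    show "subgrp S" "subgrp {1::'a}" "{1} \<subseteq> S"
      using sS subgrp_one[OF sS] subgrp_triv by auto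
    show "iv ` (P \<inter> S) \<subseteq> S"
      using subgrp_iv[OF sS] by blast
    show "x \<notin> {1}" if "x \<in> iv ` (P \<inter> S)" for x
      using that cone_disj[OF cB, of "iv x"] unfolding mem by auto
    show "x * y \<in> iv ` (P \<inter> S)" if "x \<in> iv ` (P \<inter> S)" "y \<in> iv ` (P \<inter> S)" for x y
      using that cone_mult[OF cB, of "iv y" "iv x"] unfolding mem iv_mult by blast
    show "x \<in> iv ` (P \<inter> S) \<or> x \<in> {1} \<or> iv x \<in> iv ` (P \<inter> S)" if "x \<in> S" for x
      using cone_total[OF cB that] unfolding mem iv_iv by blast
  qed
  note lex = cone_lex(1)[OF cS this]
  have PX: "x * g \<in> P - S" if "x \<in> P" "g \<in> P - S" for x g
    using that cone_NP[OF cS _ that(2), of x] cone_mult[OF cS _ that(2), of x] by blast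
  have "\<exists>n\<ge>1. iv g * f * g ^ n \<in> (P - S) \<union> iv ` (P \<inter> S)"
    if fg: "f \<in> (P - S) \<union> iv ` (P \<inter> S)" "g \<in> (P - S) \<union> iv ` (P \<inter> S)" for f g
  proof -
    consider (a) "f \<in> P - S" "g \<in> P - S" | (b) "iv f \<in> P \<inter> S" "g \<in> P - S"
      | (c) "f \<in> P - S" "iv g \<in> P \<inter> S" | (d) "iv f \<in> P \<inter> S" "iv g \<in> P \<inter> S"
      using fg mem by blast
    then show ?thesis
    proof cases
      case a
      then have "iv g * f * g ^ 2 * g \<in> P - S"
        using PX Ccone_square[OF C] by blast
      then show ?thesis
        by (intro exI[of _ 3]) (simp add: mult.assoc power2_eq_square power3_eq_cube)
    next
      case b
      have fS: "f \<in> S"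
        using b subgrp_iv_iff[OF sS] by blast
      have "f * g \<in> P"
        using cone_NP[OF cS fS b(2)] by blast
      then have "iv g * (f * g) * g ^ 2 * g \<in> P - S"
        using PX Ccone_square[OF C] b(2) by blast
      then show ?thesis
        by (intro exI[of _ 4]) (simp add: mult.assoc power2_eq_square eval_nat_numeral)
    next
      case c
      have "iv g * f \<in> P - S" "g \<in> S"
        using cone_NP[OF cS _ c(1)] c(2) subgrp_iv_iff[OF sS] by blast+
      then have "iv g * f * g ^ 1 \<in> P - S"
        using cone_PN[OF cS] by simp
      then show ?thesis
        by blast
    next
      case d
      define u v where "u = iv g" and "v = iv f"
      have u: "u \<in> P" "u \<in> S" and v: "v \<in> P" "v \<in> S"
        using d by (auto simp: u_def v_def)
      \<comment> \<open>Otherwise the inverse is at least 1. Conjugating it as in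
        \<open>Ccone_square\<close> yields \<open>iv v\<close>, which would then be
        positive.\<close>
      have "u ^ 2 * v * iv u \<in> P"
      proof (rule ccontr)
        assume n: "u ^ 2 * v * iv u \<notin> P"
        have "u ^ 2 * v * iv u \<in> H"
          using u v cone_mem(1)[OF \<open>cone H {1} P\<close>] subgrp_mult[OF sH] subgrp_iv[OF sH] subgrp_pow[OF sH] by simp
        then have "iv (u ^ 2 * v * iv u) = 1 \<or> iv (u ^ 2 * v * iv u) \<in> P"
          using n cone_total[OF \<open>cone H {1} P\<close>] iv_one by fastforce
        then have "iv u * iv (u ^ 2 * v * iv u) * u ^ 2 \<in> P"
        proof
          assume "iv (u ^ 2 * v * iv u) = 1"
          then show ?thesis
            using u by (simp add: power2_eq_square)
        qed (use Ccone_square[OF C _ u(1)] in blast)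
        then have "iv v \<in> P"
          by (simp add: mult.assoc)
        then show False
          using cone_iv[OF \<open>cone H {1} P\<close> v(1)] by blast
      qed
      moreover have "u ^ 2 * v * iv u \<in> S"
        by (intro subgrp_mult[OF sS] subgrp_iv[OF sS] subgrp_pow[OF sS] u v)
      moreover have "u ^ 2 * v * iv u = iv (iv g * f * g ^ 2)"
        by (simp add: u_def v_def mult.assoc iv_power)
      ultimately have "iv g * f * g ^ 2 \<in> iv ` (P \<inter> S)"
        unfolding mem by simp
      then show ?thesis
        by (intro exI[of _ 2]) simp
    qed
  qed
  then show ?thesis
    unfolding Ccone_def using lex by blast
qed

text \<open>Reversing the order on different convex subgroups gives different Conradian orders: for
  \<open>S\<close> inside \<open>T\<close>, a positive element of \<open>T - S\<close> keeps its
  sign in one reversal and loses it in the other.\<close>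

lemma finite_convex:
  assumes C: "Ccone H P" and fin: "finite {Q. Ccone H Q}"
  shows "finite {S. cvx H {1} P S}"
proof (rule inj_on_finite)
  note c = Ccone_cone[OF C]
  let ?f = "\<lambda>S. (P - S) \<union> iv ` (P \<inter> S)"
  show "?f ` {S. cvx H {1} P S} \<subseteq> {Q. Ccone H Q}"
    using Ccone_flip[OF C] by blast
  have key: "?f S \<noteq> ?f T" if S: "cvx H {1} P S" and T: "cvx H {1} P T" and st: "S \<subset> T" for S T
  proof
    assume e: "?f S = ?f T"
    obtain x where x: "x \<in> T" "x \<notin> S"
      using st by blast
    have "x \<noteq> 1"
      using x subgrp_one[OF cvx_sg[OF S]] by auto
    then have "x \<in> P \<or> iv x \<in> P"
      using cone_total[OF c, of x] cvx_sub(2)[OF T] x by blast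
    then obtain y where y: "y \<in> T" "y \<notin> S" "y \<in> P"
      using x subgrp_iv[OF cvx_sg[OF T]] subgrp_iv_iff[OF cvx_sg[OF S]] by blast
    have "y \<in> ?f S" "iv y \<in> ?f T"
      using y by auto
    then show False
      using cone_iv[OF Ccone_cone[OF Ccone_flip[OF C S]]] e by blast
  qed
  show "inj_on ?f {S. cvx H {1} P S}"
  proof (rule inj_onI)
    fix S T assume "S \<in> {S. cvx H {1} P S}" "T \<in> {S. cvx H {1} P S}" "?f S = ?f T"
    then show "S = T"
      using cvx_chain[OF c, of S T] key[of S T] key[of T S] by blast
  qed
qed (rule fin)

lemma max_convex:
  assumes c: "cone H N P" and fin: "finite {S. cvx H N P S}" and ne: "H \<noteq> N"
  obtains S where "cvx H N P S" "S \<noteq> H" "\<And>D. cvx H N P D \<Longrightarrow> D \<subseteq> S \<or> D = H"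
proof -
  define M where "M = {S. cvx H N P S \<and> S \<noteq> H}"
  have "finite M" "N \<in> M"
    using fin cvx_triv[OF c] ne by (auto simp: M_def intro: finite_subset)
  then obtain S where "S \<in> M" "\<forall>D\<in>M. S \<subseteq> D \<longrightarrow> S = D"
    using finite_has_maximal2[of M N] by blast
  then have S: "cvx H N P S" "S \<noteq> H" "\<And>D. cvx H N P D \<Longrightarrow> D \<noteq> H \<Longrightarrow> S \<subseteq> D \<Longrightarrow> S = D"
    by (auto simp: M_def)
  show ?thesis
  proof (rule that[of S])
    show "D \<subseteq> S \<or> D = H" if D: "cvx H N P D" for D
      using cvx_chain[OF c D S(1)] S(3)[OF D] by blast
  qed (use S in auto)
qed

lemma Ccone_below:
  assumes C: "Ccone H P" and S: "subgrp S" "S \<subseteq> H"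
  shows "Ccone S (P \<inter> S)"
proof -
  have "cone S ({1} \<inter> S) (P \<inter> S)"
    using cone_restrict[OF Ccone_cone[OF C] S] .
  moreover have "\<exists>n\<ge>1. iv g * f * g ^ n \<in> P \<inter> S" if fg: "f \<in> P \<inter> S" "g \<in> P \<inter> S" for f g
  proof -
    obtain n where "1 \<le> n" "iv g * f * g ^ n \<in> P"
      using C fg unfolding Ccone_def by blast
    moreover have "f \<in> S" "g \<in> S"
      using fg by auto
    then have "iv g * f * g ^ n \<in> S"
      by (intro subgrp_mult[OF S(1)] subgrp_iv[OF S(1)] subgrp_pow[OF S(1)])
    ultimately show ?thesis
      by blast
  qed
  moreover have "{1} \<inter> S = {1}"
    using subgrp_one[OF S(1)] by blast
  ultimately show ?thesis
    unfolding Ccone_def by simp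
qed

text \<open>Modulo \<open>N\<close> all elements commute, so \<open>iv g * f * g ^ 2\<close> lies in
  the coset of \<open>f * g\<close>; thus abelian quotients transmit the Conrad property from
  \<open>N\<close> with any order on top.\<close>

lemma Ccone_lex:
  assumes X: "cone H N X" and n: "normal_in H N" and com: "\<And>x y. x \<in> H \<Longrightarrow> y \<in> H \<Longrightarrow> x * y * iv x * iv y \<in> N"
    and Y: "Ccone N Y"
  shows "Ccone H (X \<union> Y)"
proof -
  note sH = cone_sg(1)[OF X] and sN = cone_sg(2)[OF X]
  note cY = Ccone_cone[OF Y]
  have "\<exists>k\<ge>1. iv g * f * g ^ k \<in> X \<union> Y" if fg: "f \<in> X \<union> Y" "g \<in> X \<union> Y" for f g
  proof -
    have NX: "x * y \<in> X" if "x \<in> N" "y \<in> X" for x y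
      using cone_NP[OF X that] .
    consider (a) "f \<in> X" "g \<in> X" | (b) "f \<in> Y" "g \<in> X" | (c) "f \<in> X" "g \<in> Y" | (d) "f \<in> Y" "g \<in> Y"
      using fg by blast
    then show ?thesis
    proof cases
      case a
      have H: "iv f \<in> H" "iv g \<in> H"
        using a cone_mem(1)[OF X] subgrp_iv[OF sH] by blast+
      have "f * (iv f * iv g * iv (iv f) * iv (iv g)) \<in> X"
        using cone_PN[OF X com[OF H] a(1)] .
      then have "iv g * f * g \<in> X"
        by (simp add: mult.assoc)
      then have "iv g * f * g * g \<in> X"
        using cone_mult[OF X _ a(2)] by blast
      then show ?thesis
        by (intro exI[of _ 2]) (simp add: power2_eq_square mult.assoc)
    next
      case b
      have "iv g * f * g \<in> N"
        using normal_inD2[OF n sH] cone_mem(1)[OF X b(2)] cone_mem(1)[OF cY b(1)] by blast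
      then have "iv g * f * g * g \<in> X"
        using NX b by blast
      then show ?thesis
        by (intro exI[of _ 2]) (simp add: power2_eq_square mult.assoc)
    next
      case c
      have "iv g * f * g \<in> X"
        using cone_mem(1)[OF cY c(2)] subgrp_iv[OF sN] c(1) NX cone_PN[OF X] by blast
      then show ?thesis
        by (intro exI[of _ 1]) simp
    next
      case d
      then show ?thesis
        using Y unfolding Ccone_def by blast
    qed
  qed
  then show ?thesis
    unfolding Ccone_def using cone_lex(1)[OF X cY] by blast
qed

lemma finite_cones_above:
  assumes n: "normal_in H N" and com: "\<And>x y. x \<in> H \<Longrightarrow> y \<in> H \<Longrightarrow> x * y * iv x * iv y \<in> N"
    and Y: "Ccone N Y" and fin: "finite {Q. Ccone H Q}"
  shows "finite {X. cone H N X}"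
proof (rule inj_on_finite[OF _ _ fin])
  show "(\<lambda>X. X \<union> Y) ` {X. cone H N X} \<subseteq> {Q. Ccone H Q}"
    using Ccone_lex[OF _ n com Y] by blast
  show "inj_on (\<lambda>X. X \<union> Y) {X. cone H N X}"
    by (rule inj_onI) (use cone_lex(3)[OF _ Ccone_cone[OF Y]] in \<open>metis mem_Collect_eq\<close>)
qed

lemma finite_Ccones_below:
  assumes X: "cone H N X" and n: "normal_in H N" and com: "\<And>x y. x \<in> H \<Longrightarrow> y \<in> H \<Longrightarrow> x * y * iv x * iv y \<in> N"
    and fin: "finite {Q. Ccone H Q}"
  shows "finite {Y. Ccone N Y}"
proof (rule inj_on_finite[OF _ _ fin])
  show "(\<lambda>Y. X \<union> Y) ` {Y. Ccone N Y} \<subseteq> {Q. Ccone H Q}"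
    using Ccone_lex[OF X n com] by blast
  show "inj_on (\<lambda>Y. X \<union> Y) {Y. Ccone N Y}"
    by (rule inj_onI) (use cone_lex(4)[OF X Ccone_cone] in \<open>metis mem_Collect_eq\<close>)
qed

text \<open>If conjugation by some \<open>g\<close> in \<open>G\<close> moved \<open>S\<close>, then
  \<kappa> composed with it would be a homomorphism \<psi> that does not vanish on \<open>S\<close>.
  The lexicographic order by \<kappa> and then \<psi> is invariant under conjugation in
  \<open>H\<close>, so it is not isolated. Yet it is one of finitely many, as each completes to a
  Conradian order of \<open>H\<close>.\<close>

lemma conrad_max_normal:
  assumes G: "subgrp G" "H \<subseteq> G" "normal_in G H" and C: "Ccone H P" and fin: "finite {Q. Ccone H Q}"
    and S: "cvx H {1} P S" "S \<noteq> H" and max: "\<And>D. cvx H {1} P D \<Longrightarrow> D \<subseteq> S \<or> D = H"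
  shows "normal_in G S" "\<exists>\<kappa>. qhom H S \<kappa>" "finite {Q. Ccone S Q}"
proof -
  note c = Ccone_cone[OF C]
  note sH = cone_sg(1)[OF c] and sS = cvx_sg[OF S(1)] and SH = cvx_sub(2)[OF S(1)]
  note cS = cvx_cone_above[OF c S(1)]
  obtain \<phi> where p: "ohom H S (P - S) \<phi>"
    using conrad_jump[OF C S(1) max] by blast
  note nS = ohom_normal[OF p] and com = ohom_commutator[OF p]
  have "finite {X. cone H S X}"
    using finite_cones_above[OF nS com Ccone_below[OF C sS SH] fin] .
  then obtain \<kappa> where k: "ohom H S (P - S) \<kappa>" "\<kappa> ` H \<subseteq> \<rat>"
    using isolated_rank_one[OF p isolated_if_finite[OF cS]] by blast
  then have q: "qhom H S \<kappa>"
    by (simp add: ohom_def qhom_def)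
  then show "\<exists>\<kappa>. qhom H S \<kappa>"
    by blast
  show "finite {Q. Ccone S Q}"
    using finite_Ccones_below[OF cS nS com fin] .
  note hk = ohomD(2)[OF k(1)]
  obtain b where b: "b \<in> P - S"
  proof -
    obtain x where x: "x \<in> H" "x \<notin> S"
      using S(2) SH by blast
    then have "x \<in> P - S \<or> iv x \<in> P - S"
      using cone_total[OF cS] by blast
    then show ?thesis
      using that by blast
  qed
  have key: "\<kappa> (iv g * a * g) = 0" if g: "g \<in> G" and a: "a \<in> S" for g a
  proof (rule ccontr)
    assume ne: "\<kappa> (iv g * a * g) \<noteq> 0"
    define \<psi> where "\<psi> x = \<kappa> (iv g * x * g)" for x
    have cH: "iv g * x * g \<in> H" if "x \<in> H" for x
      using normal_inD2[OF G(3,1) g that] .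
    have h\<psi>: "hm H \<psi>"
      unfolding hm_def
    proof (intro ballI)
      fix x y assume xy: "x \<in> H" "y \<in> H"
      have e: "iv g * (x * y) * g = (iv g * x * g) * (iv g * y * g)"
        by (simp add: mult.assoc)
      show "\<psi> (x * y) = \<psi> x + \<psi> y"
        unfolding \<psi>_def e using hm_mult[OF hk cH[OF xy(1)] cH[OF xy(2)]] .
    qed
    define S2 where "S2 = {x\<in>H. \<psi> x = 0}"
    have sS2: "subgrp S2"
      unfolding S2_def by (rule kernel_sg[OF sH h\<psi>])
    have nS2: "normal_in H S2"
      using hm_conj'[OF h\<psi> sH] by (simp add: normal_in_def S2_def)
    have comS2: "x * y * iv x * iv y \<in> S2" if "x \<in> H" "y \<in> H" for x y
      using that sH h\<psi> by (simp add: S2_def hm_mult[of H] hm_iv[of H] subgrp_mult subgrp_iv)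
    \<comment> \<open>The common kernel of \<kappa> and \<psi>; \<open>H/N\<close> is abelian and of
      rank at least two.\<close>
    define N where "N = S \<inter> S2"
    define Y where "Y = {x\<in>S. 0 < \<psi> x}"
    have o: "ohom S N Y \<psi>"
      unfolding ohom_def using sS hm_mono[OF h\<psi> SH] SH by (auto simp: Y_def N_def S2_def)
    have nN: "normal_in H N"
      unfolding N_def by (rule normal_in_Int[OF nS nS2])
    have comN: "x * y * iv x * iv y \<in> N" if "x \<in> H" "y \<in> H" for x y
      using com[OF that] comS2[OF that] by (simp add: N_def)
    have sN: "subgrp N"
      unfolding N_def by (rule subgrp_Int[OF sS sS2])
    have NH: "N \<subseteq> H"
      using SH by (auto simp: N_def)
    let ?Q = "(P - S) \<union> Y"
    note lex = cone_lex[OF cS ohom_cone[OF o]]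
    have i: "isolated H N ?Q"
      using isolated_if_finite[OF lex(1)] finite_cones_above[OF nN comN Ccone_below[OF C sN NH] fin] by blast
    have ia: "iv a \<in> S"
      using subgrp_iv[OF sS a] .
    have "\<psi> (iv a) = - \<psi> a"
      using hm_iv[OF ohomD(2)[OF o] sS a] .
    then have "a \<in> Y \<or> iv a \<in> Y"
      using ne a ia by (auto simp: Y_def \<psi>_def)
    then obtain a0 where a0: "a0 \<in> ?Q \<inter> S"
      using lex(4) by blast
    show False
    proof (rule lex_not_isolated[OF i lex(2) nN, of \<psi> \<kappa> b a0])
      show "ohom S N (?Q \<inter> S) \<psi>" "ohom H S (?Q - S) \<kappa>" "qhom H S \<kappa>"
        using o k(1) q unfolding lex(3,4) by auto
      show "b \<in> ?Q - S" "a0 \<in> ?Q \<inter> S"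
        using b a0 by auto
      show "h * x * iv h \<in> ?Q" if h: "h \<in> H" and x: "x \<in> ?Q \<inter> S" for h x
      proof -
        have "x \<in> Y"
          using x lex(4) by blast
        then have "x \<in> S" "0 < \<psi> x"
          by (auto simp: Y_def)
        then have "h * x * iv h \<in> S" "0 < \<psi> (h * x * iv h)"
          using normal_inD[OF nS h] hm_conj[OF h\<psi> sH _ h, of x] SH by auto
        then show ?thesis
          by (simp add: Y_def)
      qed
    qed
  qed
  show "normal_in G S"
    unfolding normal_in_def
  proof (intro ballI)
    fix g s assume g: "g \<in> G" and s: "s \<in> S"
    have "g * s * iv g \<in> H"
      using normal_inD[OF G(3) g] s SH by blast
    moreover have "\<kappa> (g * s * iv g) = 0"
      using key[OF subgrp_iv[OF G(1) g] s] by simp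
    ultimately show "g * s * iv g \<in> S"
      using ohomD(4)[OF k(1)] by blast
  qed
qed

section \<open>Normal series with rank one factors\<close>

definition rseries :: "'g::grp set \<Rightarrow> (nat \<Rightarrow> 'g set) \<Rightarrow> nat \<Rightarrow> bool" where
  "rseries G T n \<longleftrightarrow> T 0 = {1} \<and> T n = G \<and> (\<forall>i<n. \<exists>\<phi>. qhom (T (Suc i)) (T i) \<phi>)"

text \<open>\<open>H\<close> descends through the convex subgroups while \<open>G\<close> stays
  fixed, so that all terms are normal in \<open>G\<close> and not just in the next term. This is
  needed for intersecting them with arbitrary subgroups of \<open>G\<close>.\<close>

theorem conrad_series:
  assumes G: "subgrp G"
  shows "Ccone H P \<Longrightarrow> finite {Q. Ccone H Q} \<Longrightarrow> H \<subseteq> G \<Longrightarrow> normal_in G H \<Longrightarrow>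
    \<exists>n T. rseries H T n \<and> (\<forall>i\<le>n. normal_in G (T i))"
proof (induction "card {S. cvx H {1} P S}" arbitrary: H P rule: less_induct)
  case less
  note c = Ccone_cone[OF less(2)]
  note fc = finite_convex[OF less(2,3)]
  show ?case
  proof (cases "H = {1}")
    case True
    then show ?thesis
      by (intro exI[of _ 0] exI[of _ "\<lambda>_. {1}"]) (simp add: rseries_def normal_in_triv)
  next
    case False
    obtain S where S: "cvx H {1} P S" "S \<noteq> H" "\<And>D. cvx H {1} P D \<Longrightarrow> D \<subseteq> S \<or> D = H"
      using max_convex[OF c fc False] by blast
    note n = conrad_max_normal[OF G less(4,5,2,3) S]
    have SH: "S \<subseteq> H"
      using cvx_sub(2)[OF S(1)] .
    have "{D. cvx S {1} (P \<inter> S) D} \<subset> {D. cvx H {1} P D}"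
    proof
      show "{D. cvx S {1} (P \<inter> S) D} \<subseteq> {D. cvx H {1} P D}"
        using cvx_trans[OF c S(1)] by blast
      have "H \<notin> {D. cvx S {1} (P \<inter> S) D}"
        using S(2) SH cvx_sub(2)[of S "{1}" "P \<inter> S" H] by blast
      then show "{D. cvx S {1} (P \<inter> S) D} \<noteq> {D. cvx H {1} P D}"
        using cvx_self[OF c] by blast
    qed
    then have "card {D. cvx S {1} (P \<inter> S) D} < card {D. cvx H {1} P D}"
      using psubset_card_mono[OF fc] by blast
    moreover have "Ccone S (P \<inter> S)"
      using Ccone_below[OF less(2) cvx_sg[OF S(1)] SH] .
    moreover have "S \<subseteq> G"
      using SH less(4) by blast
    ultimately obtain m T where T: "rseries S T m" "\<And>i. i \<le> m \<Longrightarrow> normal_in G (T i)"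
      using less(1) n by blast
    define T' where "T' = T(Suc m := H)"
    have "rseries H T' (Suc m)"
      using T(1) n(2) by (auto simp: rseries_def T'_def less_Suc_eq)
    moreover have "normal_in G (T' i)" if "i \<le> Suc m" for i
      using T(2)[of i] that less(5) by (auto simp: T'_def le_Suc_eq)
    ultimately show ?thesis
      by blast
  qed
qed

lemma rseries_sg: "rseries G T n \<Longrightarrow> i \<le> n \<Longrightarrow> subgrp (T i)"
proof (cases i)
  case 0
  then show "rseries G T n \<Longrightarrow> subgrp (T i)"
    by (simp add: rseries_def subgrp_triv)
next
  case (Suc j)
  then show "rseries G T n \<Longrightarrow> i \<le> n \<Longrightarrow> subgrp (T i)"
    unfolding rseries_def using qhomD(1) by (metis Suc_le_lessD)
qed

lemma rseries_step: "rseries G T n \<Longrightarrow> i < n \<Longrightarrow> T i \<subseteq> T (Suc i)"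
  unfolding rseries_def using qhomD(3) by blast

lemma rseries_qhom: "rseries G T n \<Longrightarrow> i < n \<Longrightarrow> \<exists>\<phi>. qhom (T (Suc i)) (T i) \<phi>"
  by (simp add: rseries_def)

lemma countable_step:
  assumes q: "qhom H N \<phi>" and N: "countable N"
  shows "countable H"
proof -
  have "countable (\<phi> ` H)"
    using countable_rat countable_subset q unfolding qhom_def by blast
  moreover have "countable {x\<in>H. \<phi> x = r}" for r
  proof (cases "{x\<in>H. \<phi> x = r} = {}")
    case True
    then show ?thesis
      by (metis countable_empty)
  next
    case False
    then obtain y where y: "y \<in> H" "\<phi> y = r"
      by blast
    have "{x\<in>H. \<phi> x = r} \<subseteq> (\<lambda>z. y * z) ` N"
    proof
      fix x assume "x \<in> {x\<in>H. \<phi> x = r}"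
      then have x: "x \<in> H" "\<phi> x = r"
        by auto
      have "iv y * x \<in> N"
        using x y qhomD(1,2)[OF q] by (simp add: qhomD(3)[OF q] hm_mult[of H] hm_iv[of H] subgrp_mult subgrp_iv)
      then show "x \<in> (\<lambda>z. y * z) ` N"
        by (intro image_eqI[of _ _ "iv y * x"]) simp_all
    qed
    then show ?thesis
      by (rule countable_subset[OF _ countable_image[OF N]])
  qed
  ultimately have "countable (\<Union>r\<in>\<phi> ` H. {x\<in>H. \<phi> x = r})"
    by blast
  moreover have "H \<subseteq> (\<Union>r\<in>\<phi> ` H. {x\<in>H. \<phi> x = r})"
    by blast
  ultimately show ?thesis
    using countable_subset by blast
qed

lemma rseries_countable:
  assumes "rseries G T n"
  shows "countable G"
proof -
  have "countable (T i)" if "i \<le> n" for i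
    using that
  proof (induction i)
    case 0
    then show ?case
      using assms by (simp add: rseries_def)
  next
    case (Suc i)
    then show ?case
      using rseries_qhom[OF assms, of i] countable_step by auto
  qed
  then show ?thesis
    using assms by (auto simp: rseries_def)
qed

text \<open>The steps of the series at which the intersection with \<open>H\<close> grows. For
  convex subgroups of a fixed order this finite set is a complete invariant.\<close>

definition jumps :: "(nat \<Rightarrow> 'g::grp set) \<Rightarrow> nat \<Rightarrow> 'g set \<Rightarrow> nat set" where
  "jumps T n H = {j. j < n \<and> (\<exists>x\<in>H \<inter> T (Suc j). x \<notin> T j)}"

text \<open>At a common jump, an element of \<open>D\<close> is commensurable with one of
  \<open>C\<close> modulo the previous term. By induction a power of it lies in \<open>C\<close>,
  and \<open>C\<close> is closed under roots.\<close>

lemma convex_jumps: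
  assumes r: "rseries G T n" and HG: "H \<subseteq> G" and c: "cone H {1} P"
    and C: "cvx H {1} P C" and D: "cvx H {1} P D" and CD: "C \<subseteq> D" and j: "jumps T n D \<subseteq> jumps T n C"
  shows "C = D"
proof -
  note sD = cvx_sg[OF D] and sC = cvx_sg[OF C]
  have "D \<inter> T i \<subseteq> C" if "i \<le> n" for i
    using that
  proof (induction i)
    case 0
    then show ?case
      using r subgrp_one[OF sC] by (auto simp: rseries_def)
  next
    case (Suc i)
    obtain \<phi> where q: "qhom (T (Suc i)) (T i) \<phi>"
      using rseries_qhom[OF r, of i] Suc by auto
    show ?case
    proof
      fix d assume d: "d \<in> D \<inter> T (Suc i)"
      show "d \<in> C"
      proof (cases "d \<in> T i")
        case True
        then show ?thesis
          using Suc d by auto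
      next
        case False
        then have "i \<in> jumps T n D"
          using d Suc(2) by (auto simp: jumps_def)
        then obtain x where x: "x \<in> C" "x \<in> T (Suc i)" "x \<notin> T i"
          using j by (auto simp: jumps_def)
        then have "\<phi> x \<noteq> 0"
          using qhomD(3)[OF q] by blast
        then obtain k :: nat and m :: int where k: "0 < k" "d ^ k * ipow x (- m) \<in> T i"
          using qhom_ratio[OF q x(2), of d] d by blast
        have "d ^ k * ipow x (- m) \<in> D"
          using d x CD sD by (auto intro: subgrp_mult subgrp_pow subgrp_zp)
        then have "d ^ k * ipow x (- m) \<in> C"
          using k Suc by auto
        then have "d ^ k \<in> C"
          using subgrp_cancel_right[OF sC subgrp_zp[OF sC x(1)]] by blast
        then show ?thesis
          using cvx_pow[OF c C _ k(1)] d cvx_sub(2)[OF D] by blast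
      qed
    qed
  qed
  from this[of n] have "D \<subseteq> C"
    using r HG cvx_sub(2)[OF D] by (auto simp: rseries_def)
  then show ?thesis
    using CD by blast
qed

lemma rseries_finite_convex:
  assumes r: "rseries G T n" and HG: "H \<subseteq> G" and c: "cone H {1} P"
  shows "finite {S. cvx H {1} P S}"
proof (rule inj_on_finite[of "jumps T n" _ "Pow {..<n}"])
  show "inj_on (jumps T n) {S. cvx H {1} P S}"
  proof (rule inj_onI)
    fix C D assume CD: "C \<in> {S. cvx H {1} P S}" "D \<in> {S. cvx H {1} P S}" "jumps T n C = jumps T n D"
    then show "C = D"
      using cvx_chain[OF c, of C D] convex_jumps[OF r HG c, of C D] convex_jumps[OF r HG c, of D C] by auto
  qed
qed (auto simp: jumps_def)

section \<open>Tararin chains\<close>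

text \<open>The last condition says that \<open>t\<close> acts on \<open>T (Suc j) / T j\<close> by negative factors \<open>- q/p\<close>.\<close>

definition tararin :: "(nat \<Rightarrow> 'g::grp set) \<Rightarrow> nat \<Rightarrow> bool" where
  "tararin T m \<longleftrightarrow> T 0 = {1} \<and> (\<forall>j<m. (\<exists>\<phi>. qhom (T (Suc j)) (T j) \<phi>) \<and> T (Suc j) \<noteq> T j) \<and>
     (\<forall>j. Suc j < m \<longrightarrow> normal_in (T (Suc (Suc j))) (T j) \<and>
       (\<exists>t\<in>T (Suc (Suc j)). \<forall>x\<in>T (Suc j) - T j. \<exists>p>0. \<exists>q>0. (t * x * iv t) ^ p * x ^ q \<in> T j))"

lemma tararin_Suc: "tararin T (Suc m) \<Longrightarrow> tararin T m"
  by (auto simp: tararin_def)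

lemma tararin_zero: "tararin T m \<Longrightarrow> T 0 = {1}"
  by (simp add: tararin_def)

lemma tararin_qhom: "tararin T (Suc m) \<Longrightarrow> \<exists>\<phi>. qhom (T (Suc m)) (T m) \<phi>"
  by (auto simp: tararin_def)

lemma tararin_strict: "tararin T (Suc m) \<Longrightarrow> T (Suc m) \<noteq> T m"
  by (auto simp: tararin_def)

lemma tararin_negative:
  assumes "tararin T m" "Suc j < m"
  obtains t where "normal_in (T (Suc (Suc j))) (T j)" "t \<in> T (Suc (Suc j))"
    "\<And>x. x \<in> T (Suc j) \<Longrightarrow> x \<notin> T j \<Longrightarrow> \<exists>p>0. \<exists>q>0. (t * x * iv t) ^ p * x ^ q \<in> T j"
proof -
  have 1: "normal_in (T (Suc (Suc j))) (T j)"
    and 2: "\<exists>t\<in>T (Suc (Suc j)). \<forall>x\<in>T (Suc j) - T j. \<exists>p>0. \<exists>q>0. (t * x * iv t) ^ p * x ^ q \<in> T j"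
    using assms by (auto simp: tararin_def)
  from 2 obtain t where t: "t \<in> T (Suc (Suc j))"
    "\<forall>x\<in>T (Suc j) - T j. \<exists>p>0. \<exists>q>0. (t * x * iv t) ^ p * x ^ q \<in> T j"
    by (rule bexE)
  show ?thesis
    by (rule that[OF 1 t(1)]) (use t(2) in simp)
qed

text \<open>Let \<open>A\<close> be the subgroup below the top and \<open>B\<close> the one below
  \<open>A\<close>. If \<open>A\<close> were not convex, its convex hull would be everything,
  because \<open>H/A\<close> has rank one and hulls are closed under roots. Then powers of positive
  elements of \<open>A - B\<close> are cofinal, so conjugation preserves their sign, contradicting
  the negative factor of \<open>t\<close>.\<close>

lemma tararin_convex: "tararin T (Suc m) \<Longrightarrow> cone (T (Suc m)) {1} Q \<Longrightarrow> cvx (T (Suc m)) {1} Q (T m)"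
proof (induction m arbitrary: Q)
  case 0
  then show ?case
    using cvx_triv[OF 0(2)] tararin_zero[OF 0(1)] by simp
next
  case (Suc m)
  let ?H = "T (Suc (Suc m))" and ?A = "T (Suc m)" and ?B = "T m"
  note c = Suc(3)
  obtain \<kappa> where k: "qhom ?H ?A \<kappa>"
    using tararin_qhom[OF Suc(2)] by blast
  obtain \<phi>0 where p0: "qhom ?A ?B \<phi>0"
    using tararin_qhom[OF tararin_Suc[OF Suc(2)]] by blast
  note sH = qhomD(1)[OF k] and sA = qhomD(1)[OF p0] and nA = qhom_normal[OF k]
  have AH: "?A \<subseteq> ?H" and BA: "?B \<subseteq> ?A"
    using qhomD(3)[OF k] qhomD(3)[OF p0] by blast+
  obtain t where nB: "normal_in ?H ?B" and t: "t \<in> ?H"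
    "\<And>x. x \<in> ?A \<Longrightarrow> x \<notin> ?B \<Longrightarrow> \<exists>p>0. \<exists>q>0. (t * x * iv t) ^ p * x ^ q \<in> ?B"
    using tararin_negative[OF Suc(2), of m] by (metis lessI)
  have "{1} \<inter> ?A = {1}"
    using subgrp_one[OF sA] by blast
  then have cA: "cone ?A {1} (Q \<inter> ?A)"
    using cone_restrict[OF c sA AH] by simp
  note vB = Suc(1)[OF tararin_Suc[OF Suc(2)] cA]
  note cAB = cvx_cone_above[OF cA vB]
  obtain \<phi> where p: "ohom ?A ?B (Q \<inter> ?A - ?B) \<phi>" "qhom ?A ?B \<phi>"
    using qhom_oriented[OF p0 cAB] .
  obtain x where x: "x \<in> Q \<inter> ?A - ?B"
    using tararin_strict[OF tararin_Suc[OF Suc(2)]] BA cone_total[OF cAB] by blast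
  then have xA: "x \<in> ?A" "x \<in> Q" "x \<notin> ?B"
    by auto
  show ?case
  proof (rule ccontr)
    assume n: "\<not> cvx ?H {1} Q ?A"
    have "{1} \<subseteq> ?A"
      using subgrp_one[OF sA] by blast
    then obtain u v where uv: "u \<in> Q" "v \<in> Q" "u * v \<in> ?A" "u \<notin> ?A"
      using n sA AH unfolding cvx_def by blast
    note K = chull_cvx[OF c sA AH nA xA(1,2)]
    note sK = cvx_sg[OF K(1)]
    have uK: "u \<in> chull ?H Q ?A"
      using K uv unfolding cvx_def by blast
    have uH: "u \<in> ?H" "\<kappa> u \<noteq> 0"
      using uv cone_mem(1)[OF c] qhomD(3)[OF k] by blast+
    \<comment> \<open>A single element \<open>u\<close> of the hull outside \<open>A\<close> is
      commensurable with every \<open>h\<close> modulo \<open>A\<close>.\<close>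
    have inK: "h \<in> chull ?H Q ?A" if h: "h \<in> ?H" for h
    proof -
      obtain j :: nat and i :: int where j: "0 < j" "h ^ j * ipow u (- i) \<in> ?A"
        using qhom_ratio[OF k uH h] by blast
      then have "h ^ j \<in> chull ?H Q ?A"
        using subgrp_cancel_right[OF sK subgrp_zp[OF sK uK]] K(2) by blast
      then show ?thesis
        using cvx_pow[OF c K(1) h j(1)] by blast
    qed
    have "t * x * iv t \<in> Q"
    proof (rule conj_pos[OF c, of "?A - ?B"])
      show "?A - ?B \<subseteq> ?H"
        using AH by blast
      show "y \<in> Q \<or> iv y \<in> Q" if "y \<in> ?A - ?B" for y
        using cone_total[OF cAB, of y] that by blast
      show "iv y \<in> ?A - ?B" if "y \<in> ?A - ?B" for y
        using that subgrp_iv_iff[OF sA] subgrp_iv_iff[OF cone_sg(2)[OF cAB]] by blast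
      show "h * y * iv h \<in> ?A - ?B" if "h \<in> ?H" "y \<in> ?A - ?B" for h y
        using that normal_in_conj_iff[OF nA sH] normal_in_conj_iff[OF nB sH] by blast
      show "\<exists>n. iv h * a ^ n \<in> Q" if a: "a \<in> ?A - ?B" "a \<in> Q" and h: "h \<in> ?H" for a h
      proof -
        obtain b where b: "b \<in> ?A" "iv h * b \<in> Q"
          using inK[OF h] unfolding chull_def by blast
        have aA: "a \<in> ?A" "0 < \<phi> a"
          using a ohomD(3)[OF p(1), of a] by auto
        obtain n :: nat where n: "\<phi> b / \<phi> a < real n"
          using reals_Archimedean2 by blast
        have "\<phi> (iv b * a ^ n) = real n * \<phi> a - \<phi> b"
          using sA b aA ohomD(2)[OF p(1)] by (simp add: hm_mult[of ?A] hm_iv[of ?A] hm_pow[of ?A] subgrp_pow subgrp_iv)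
        then have "0 < \<phi> (iv b * a ^ n)"
          using n aA by (simp add: field_simps)
        moreover have "iv b * a ^ n \<in> ?A"
          using sA b aA by (simp add: subgrp_mult subgrp_iv subgrp_pow)
        ultimately have "iv b * a ^ n \<in> Q"
          using ohomD(3)[OF p(1)] by blast
        then have "iv h * b * (iv b * a ^ n) \<in> Q"
          using cone_mult[OF c b(2)] by blast
        then have "iv h * a ^ n \<in> Q"
          by (simp add: mult.assoc)
        then show ?thesis
          by blast
      qed
    qed (use x t in auto)
    then have tx: "t * x * iv t \<in> Q \<inter> ?A - ?B"
      using xA normal_in_conj_iff[OF nA sH t(1)] normal_in_conj_iff[OF nB sH t(1)] by blast
    obtain p q :: nat where pq: "0 < p" "0 < q" "(t * x * iv t) ^ p * x ^ q \<in> ?B"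
      using t(2)[OF xA(1,3)] by blast
    have "(t * x * iv t) ^ p * x ^ q \<in> Q \<inter> ?A - ?B"
      using cone_mult[OF cAB cone_pow[OF cAB tx pq(1)] cone_pow[OF cAB x pq(2)]] .
    then show False
      using pq(3) by blast
  qed
qed

text \<open>Every order splits lexicographically at each term of the chain, and a rank one jump
  admits at most two orders.\<close>

lemma tararin_finite: "tararin T m \<Longrightarrow> finite {Q. cone (T m) {1} Q}"
proof (induction m)
  case 0
  have "{Q. cone (T 0) {1} Q} \<subseteq> Pow (T 0)"
    using cone_sub(2) by blast
  then show ?case
    using tararin_zero[OF 0] finite_subset by (metis finite.emptyI finite_Pow_iff finite_insert)
next
  case (Suc m)
  obtain \<phi> where q: "qhom (T (Suc m)) (T m) \<phi>"
    using tararin_qhom[OF Suc(2)] by blast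
  have "{Q. cone (T (Suc m)) {1} Q} \<subseteq>
    (\<lambda>(X, Y). X \<union> Y) ` ({X. cone (T (Suc m)) (T m) X} \<times> {Y. cone (T m) {1} Y})"
  proof
    fix Q assume "Q \<in> {Q. cone (T (Suc m)) {1} Q}"
    then have c: "cone (T (Suc m)) {1} Q"
      by blast
    note v = tararin_convex[OF Suc(2) c]
    show "Q \<in> (\<lambda>(X, Y). X \<union> Y) ` ({X. cone (T (Suc m)) (T m) X} \<times> {Y. cone (T m) {1} Y})"
      using cvx_cone_above[OF c v] cvx_cone_below[OF c v]
      by (intro image_eqI[of _ _ "(Q - T m, Q \<inter> T m)"]) auto
  qed
  then show ?case
    using qhom_finite_cones[OF q] Suc(1)[OF tararin_Suc[OF Suc(2)]] finite_subset
    by (metis (no_types, lifting) finite_SigmaI finite_imageI)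
qed

lemma tararin_sg: "tararin T m \<Longrightarrow> j \<le> m \<Longrightarrow> subgrp (T j)"
proof (cases j)
  case 0
  then show "tararin T m \<Longrightarrow> subgrp (T j)"
    by (simp add: tararin_def subgrp_triv)
next
  case (Suc i)
  then show "tararin T m \<Longrightarrow> j \<le> m \<Longrightarrow> subgrp (T j)"
    unfolding tararin_def using qhomD(1) by (metis Suc_le_lessD)
qed

lemma tararin_mono: "tararin T m \<Longrightarrow> i \<le> j \<Longrightarrow> j \<le> m \<Longrightarrow> T i \<subseteq> T j"
proof (induction j)
  case (Suc j)
  have "T j \<subseteq> T (Suc j)"
    using Suc(2,4) unfolding tararin_def qhom_def by (metis (no_types, lifting) Suc_le_lessD mem_Collect_eq subsetI)
  then show ?case
    using Suc by (cases "i = Suc j") auto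
qed simp

text \<open>If \<open>t\<close> acts on \<open>x\<close> by \<open>- q/p\<close>, then \<open>l x ^ p = l x ^ (- q)\<close>.\<close>

lemma tararin_character:
  fixes l :: "'g::grp \<Rightarrow> real"
  assumes T: "tararin T m" and l: "\<And>h. h \<in> T m \<Longrightarrow> 0 < l h"
    "\<And>g h. g \<in> T m \<Longrightarrow> h \<in> T m \<Longrightarrow> l (g * h) = l g * l h"
    and j: "j < m" and x: "x \<in> T j"
  shows "l x = 1"
  using j x
proof (induction j arbitrary: x)
  case 0
  then have "x = 1"
    using tararin_zero[OF T] by blast
  then show ?case
    using mult_hom_simps(1)[of "T m" l] tararin_sg[OF T order.refl] l by blast
next
  case (Suc j)
  note sT = tararin_sg[OF T order.refl]
  have ls: "l (iv h) = inverse (l h)" "l (h ^ n) = l h ^ n" if "h \<in> T m" for h n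
    using mult_hom_simps(2,3)[of "T m" l, OF sT] l that by blast+
  show ?case
  proof (cases "x \<in> T j")
    case True
    then show ?thesis
      using Suc by simp
  next
    case False
    obtain t where t: "t \<in> T (Suc (Suc j))"
      "\<And>x. x \<in> T (Suc j) \<Longrightarrow> x \<notin> T j \<Longrightarrow> \<exists>p>0. \<exists>q>0. (t * x * iv t) ^ p * x ^ q \<in> T j"
      using tararin_negative[OF T Suc(2)] by metis
    obtain p q :: nat where pq: "0 < p" "0 < q" "(t * x * iv t) ^ p * x ^ q \<in> T j"
      using t(2)[OF Suc(3) False] by blast
    have m: "t \<in> T m" "x \<in> T m"
      using t(1) Suc(3) tararin_mono[OF T, of "Suc (Suc j)" m] tararin_mono[OF T, of "Suc j" m] Suc(2) by auto
    have mm: "iv t \<in> T m" "t * x \<in> T m" "t * x * iv t \<in> T m" "(t * x * iv t) ^ p \<in> T m" "x ^ q \<in> T m"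
      using m sT by (auto intro: subgrp_mult subgrp_iv subgrp_pow)
    have "l (t * x * iv t) = l x"
      using l(2)[OF mm(2,1)] l(2)[OF m] ls(1)[OF m(1)] l(1)[OF m(1)] by (simp add: field_simps)
    then have "l ((t * x * iv t) ^ p * x ^ q) = l x ^ p * l x ^ q"
      using l(2)[OF mm(4,5)] ls(2)[OF mm(3)] ls(2)[OF m(2)] by simp
    moreover have "l ((t * x * iv t) ^ p * x ^ q) = 1"
      using Suc(1)[OF _ pq(3)] Suc(2) by simp
    ultimately have "l x ^ (p + q) = 1"
      by (simp add: power_add)
    then show ?thesis
      using power_eq_iff_eq_base[of "p + q" "l x" 1] l(1)[OF m(2)] pq by simp
  qed
qed

section \<open>The largest proper convex subgroup of an isolated order\<close>

text \<open>Conjugation by \<open>b\<close> permutes the cones of \<open>K\<close>. An orbit has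
  length at most their number, and that length divides the factorial.\<close>

lemma finite_conj_period:
  assumes fin: "finite {Q. cone K {1} Q}" and c: "cone K {1} Y"
    and b: "\<And>x. x \<in> K \<Longrightarrow> iv b * x * b \<in> K" "\<And>x. x \<in> K \<Longrightarrow> b * x * iv b \<in> K" and x: "x \<in> Y"
  shows "iv (b ^ fact (card {Q. cone K {1} Q})) * x * b ^ fact (card {Q. cone K {1} Q}) \<in> Y"
proof -
  define Z where "Z k = {x\<in>K. iv (b ^ k) * x * b ^ k \<in> Y}" for k
  have bk: "iv (b ^ k) * x * b ^ k \<in> K" "b ^ k * x * iv (b ^ k) \<in> K" if x: "x \<in> K" for x k
  proof -
    show "iv (b ^ k) * x * b ^ k \<in> K"
    proof (induction k)
      case (Suc k)
      have "iv b * (iv (b ^ k) * x * b ^ k) * b \<in> K"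
        using b(1) Suc by blast
      then show ?case
        unfolding power_Suc2 by (simp add: mult.assoc)
    qed (use x in simp)
    show "b ^ k * x * iv (b ^ k) \<in> K"
    proof (induction k)
      case (Suc k)
      have "b * (b ^ k * x * iv (b ^ k)) * iv b \<in> K"
        using b(2) Suc by blast
      then show ?case
        by (simp add: mult.assoc)
    qed (use x in simp)
  qed
  have sK: "subgrp K"
    using cone_sg(1)[OF c] .
  have Z: "cone K {1} (Z k)" for k
  proof (rule coneI)
    show "subgrp K" "subgrp {1::'a}" "{1} \<subseteq> K" "Z k \<subseteq> K"
      using sK subgrp_one[OF sK] subgrp_triv by (auto simp: Z_def)
    show "x \<notin> {1}" if "x \<in> Z k" for x
      using that cone_disj[OF c, of 1] by (auto simp: Z_def)
    show "x * y \<in> Z k" if xy: "x \<in> Z k" "y \<in> Z k" for x y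
    proof -
      have "iv (b ^ k) * x * b ^ k * (iv (b ^ k) * y * b ^ k) \<in> Y"
        using xy cone_mult[OF c] by (simp add: Z_def)
      then show ?thesis
        using xy subgrp_mult[OF sK] by (simp add: Z_def mult.assoc)
    qed
    show "x \<in> Z k \<or> x \<in> {1} \<or> iv x \<in> Z k" if x: "x \<in> K" for x
    proof -
      have "x = 1" if "iv (b ^ k) * x * b ^ k = 1"
      proof -
        have "b ^ k * (iv (b ^ k) * x * b ^ k) * iv (b ^ k) = 1"
          using that by simp
        then show ?thesis
          by (simp add: mult.assoc)
      qed
      moreover have "iv (iv (b ^ k) * x * b ^ k) = iv (b ^ k) * iv x * b ^ k"
        by (simp add: mult.assoc)
      ultimately show ?thesis
        using cone_total[OF c bk(1)[OF x, of k]] x subgrp_iv[OF sK x] unfolding Z_def by auto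
    qed
  qed
  have ZZ: "x \<in> Z (i + j) \<longleftrightarrow> iv (b ^ i) * x * b ^ i \<in> Z j" if "x \<in> K" for x i j
    using that bk(1)[OF that, of i] bk(1)[OF that, of "i + j"]
    by (simp add: Z_def power_add mult.assoc)
  let ?C = "{Q. cone K {1} Q}"
  have "\<not> inj_on Z {..card ?C}"
  proof
    assume "inj_on Z {..card ?C}"
    then have "card {..card ?C} \<le> card ?C"
      using Z fin by (intro card_inj_on_le) auto
    then show False
      by simp
  qed
  then obtain i j where ij: "i < j" "j \<le> card ?C" "Z i = Z j"
    unfolding inj_on_def by (metis atMost_iff linorder_neqE_nat)
  define d where "d = j - i"
  have d: "1 \<le> d" "d \<le> card ?C" "j = i + d"
    using ij by (auto simp: d_def)
  have Zd: "Z d = Z 0"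
  proof (rule Set.set_eqI)
    fix y
    show "y \<in> Z d \<longleftrightarrow> y \<in> Z 0"
    proof (cases "y \<in> K")
      case True
      have e: "iv (b ^ i) * (b ^ i * y * iv (b ^ i)) * b ^ i = y"
        by (simp add: mult.assoc)
      have "b ^ i * y * iv (b ^ i) \<in> Z (i + d) \<longleftrightarrow> b ^ i * y * iv (b ^ i) \<in> Z (i + 0)"
        using ij(3) d(3) by simp
      then show ?thesis
        unfolding ZZ[OF bk(2)[OF True]] e .
    next
      case False
      then show ?thesis
        by (simp add: Z_def)
    qed
  qed
  have Zq: "Z (d * q) = Z 0" for q
  proof (induction q)
    case (Suc q)
    have "y \<in> Z (d + d * q) \<longleftrightarrow> y \<in> Z (d + 0)" if "y \<in> K" for y
      unfolding ZZ[OF that] Suc by simp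
    then show ?case
      using Zd by (auto simp: Z_def)
  qed simp
  have "d dvd fact (card ?C)"
    using d by (intro dvd_fact) auto
  then obtain q where "fact (card ?C) = d * q"
    by blast
  then have "Z (fact (card ?C)) = Z 0"
    using Zq by metis
  moreover have "x \<in> Z 0"
    using x cone_mem(1)[OF c x] by (simp add: Z_def)
  ultimately show ?thesis
    by (auto simp: Z_def)
qed

locale max_cvx =
  fixes H P S :: "'g::grp set"
  assumes isolated: "isolated H {1} P" and S: "cvx H {1} P S" and SH: "S \<noteq> H"
    and max: "\<And>D. cvx H {1} P D \<Longrightarrow> D \<subseteq> S \<or> D = H"
begin

lemmas c = isolated_cone[OF isolated]
lemmas sH = cone_sg(1)[OF c] and sS = cvx_sg[OF S]
lemmas cS = cvx_cone_above[OF c S] and cB = cvx_cone_below[OF c S]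

lemma SsubH: "x \<in> S \<Longrightarrow> x \<in> H"
  using cvx_sub(2)[OF S] by blast

lemma PH: "x \<in> P \<Longrightarrow> x \<in> H"
  using cone_mem(1)[OF c] .

end

text \<open>\<open>S\<close> itself is not assumed to be normal, only its trace on \<open>A\<close>;
  the order is Archimedean on \<open>A\<close> modulo this trace, with values given by
  \<phi>.\<close>

locale normal_quot = max_cvx H P S for H P S :: "'g::grp set" +
  fixes A :: "'g set" and \<phi> :: "'g \<Rightarrow> real"
  assumes A: "subgrp A" "A \<subseteq> H" "normal_in H A" and D: "normal_in H (A \<inter> S)"
    and o: "ohom A (A \<inter> S) (P \<inter> A - S) \<phi>" and AS: "\<not> A \<subseteq> S"
begin

lemma AH: "x \<in> A \<Longrightarrow> x \<in> H"
  using A(2) by blast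

lemmas hA = ohomD(2)[OF o]

lemma pos_iff: "x \<in> A \<Longrightarrow> 0 < \<phi> x \<longleftrightarrow> x \<in> P \<and> x \<notin> S"
  using ohomD(3)[OF o, of x] by auto

lemma zero_iff: "x \<in> A \<Longrightarrow> \<phi> x = 0 \<longleftrightarrow> x \<in> S"
  using ohomD(4)[OF o, of x] by auto

lemma nonneg: "x \<in> A \<Longrightarrow> x \<in> P \<Longrightarrow> 0 \<le> \<phi> x"
  using pos_iff[of x] zero_iff[of x] by force

lemma pos_ex: obtains p where "p \<in> A" "p \<in> P" "p \<notin> S" "0 < \<phi> p"
proof -
  obtain x where x: "x \<in> A" "x \<notin> S"
    using AS by blast
  then have "\<phi> x \<noteq> 0"
    using zero_iff by blast
  moreover have "\<phi> (iv x) = - \<phi> x"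
    using hm_iv[OF hA A(1) x(1)] .
  ultimately have "0 < \<phi> x \<or> 0 < \<phi> (iv x)"
    by linarith
  then show ?thesis
    using that[of x] that[of "iv x"] pos_iff[of x] pos_iff[of "iv x"] x(1) subgrp_iv[OF A(1) x(1)] by blast
qed

text \<open>The convex hull of \<open>A\<close> is not inside \<open>S\<close>, so by maximality of
  \<open>S\<close> it is all of \<open>H\<close>.\<close>

lemma bounded:
  assumes h: "h \<in> H"
  shows "\<exists>a\<in>A. iv h * a \<in> P" "\<exists>a\<in>A. iv a * h \<in> P"
proof -
  obtain p where p: "p \<in> A" "p \<in> P" "p \<notin> S" "0 < \<phi> p"
    by (rule pos_ex)
  note K = chull_cvx[OF c A p(1,2)]
  have "chull H P A = H"
    using max[OF K(1)] K(2) p by blast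
  then show "\<exists>a\<in>A. iv h * a \<in> P" "\<exists>a\<in>A. iv a * h \<in> P"
    using h unfolding chull_def by blast+
qed

lemma cofinal:
  assumes a: "a \<in> A" "0 < \<phi> a" and h: "h \<in> H"
  shows "\<exists>n. iv h * a ^ n \<in> P"
proof -
  obtain b where b: "b \<in> A" "iv h * b \<in> P"
    using bounded(1)[OF h] by blast
  obtain n :: nat where n: "\<phi> b / \<phi> a < real n"
    using reals_Archimedean2 by blast
  have m: "iv b * a ^ n \<in> A"
    using A(1) b(1) a(1) by (simp add: subgrp_mult subgrp_iv subgrp_pow)
  have "\<phi> (iv b * a ^ n) = real n * \<phi> a - \<phi> b"
    using A(1) b a hA by (simp add: hm_mult[of A] hm_iv[of A] hm_pow[of A] subgrp_pow subgrp_iv)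
  then have "0 < \<phi> (iv b * a ^ n)"
    using n a by (simp add: field_simps)
  then have "iv h * b * (iv b * a ^ n) \<in> P"
    using cone_mult[OF c b(2)] pos_iff[OF m] by blast
  then have "iv h * a ^ n \<in> P"
    by (simp add: mult.assoc)
  then show ?thesis
    by blast
qed

lemma conj_positive:
  assumes h: "h \<in> H" and a: "a \<in> P \<inter> A - S"
  shows "h * a * iv h \<in> P \<inter> A - S"
proof -
  have cA: "cone A (A \<inter> S) (P \<inter> A - S)"
    using ohom_cone[OF o] .
  have "h * a * iv h \<in> P"
  proof (rule conj_pos[OF c, of "A - S"])
    show "A - S \<subseteq> H"
      using A(2) by blast
    show "y \<in> P \<or> iv y \<in> P" if "y \<in> A - S" for y
      using cone_total[OF cA, of y] that by blast
    show "iv y \<in> A - S" if "y \<in> A - S" for y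
      using that subgrp_iv_iff[OF A(1)] subgrp_iv_iff[OF sS] by blast
    show "h * y * iv h \<in> A - S" if "h \<in> H" "y \<in> A - S" for h y
      using that normal_in_conj_iff[OF A(3) sH] normal_in_conj_iff[OF D sH] by blast
    show "\<exists>n. iv h * a ^ n \<in> P" if "a \<in> A - S" "a \<in> P" "h \<in> H" for a h
      using cofinal[of a h] pos_iff[of a] that by blast
  qed (use a h in auto)
  then show ?thesis
    using a normal_in_conj_iff[OF A(3) sH h, of a] normal_in_conj_iff[OF D sH h, of a] by blast
qed

lemma scale:
  obtains l where "\<And>h. h \<in> H \<Longrightarrow> 0 < l h" "\<And>h a. h \<in> H \<Longrightarrow> a \<in> A \<Longrightarrow> \<phi> (h * a * iv h) = l h * \<phi> a"
    "\<And>g h. g \<in> H \<Longrightarrow> h \<in> H \<Longrightarrow> l (g * h) = l g * l h" "\<And>a. a \<in> A \<Longrightarrow> l a = 1"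
proof -
  have "P \<inter> A - S \<noteq> {}"
    by (rule pos_ex) blast
  then show ?thesis
    using conj_scale[OF o sH A(2,3) D conj_positive] that by blast
qed

end

text \<open>If \<open>\<phi>(A)\<close> is dense, then \<open>\<tau> g = sup {\<phi> a | a < g}\<close> extends \<open>\<phi>\<close> to a cocycle with zero set \<open>S\<close>,
  so that \<open>H\<close> acts on the line by the affine maps \<open>x \<mapsto> \<tau> g + l g x\<close>.\<close>

locale dense_quot = normal_quot H P S A \<phi> for H P S A :: "'g::grp set" and \<phi> :: "'g \<Rightarrow> real" +
  fixes l :: "'g \<Rightarrow> real"
  assumes l_pos: "\<And>h. h \<in> H \<Longrightarrow> 0 < l h"
    and l_conj: "\<And>h a. h \<in> H \<Longrightarrow> a \<in> A \<Longrightarrow> \<phi> (h * a * iv h) = l h * \<phi> a"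
    and l_mult: "\<And>g h. g \<in> H \<Longrightarrow> h \<in> H \<Longrightarrow> l (g * h) = l g * l h" and l_A: "\<And>a. a \<in> A \<Longrightarrow> l a = 1"
    and small: "\<And>e. 0 < e \<Longrightarrow> \<exists>a\<in>A. 0 < \<phi> a \<and> \<phi> a < e"
begin

definition \<tau> :: "'g \<Rightarrow> real" where
  "\<tau> g = (SUP a\<in>{a\<in>A. iv a * g \<in> P}. \<phi> a)"

lemma l_one: "l 1 = 1" and l_iv: "h \<in> H \<Longrightarrow> l (iv h) = inverse (l h)" and l_pow: "h \<in> H \<Longrightarrow> l (h ^ n) = l h ^ n"
  using mult_hom_simps[of H l, OF sH] l_pos l_mult by blast+

lemma dense:
  assumes "x < y"
  obtains a where "a \<in> A" "x < \<phi> a" "\<phi> a < y"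
proof -
  obtain a where a: "a \<in> A" "0 < \<phi> a" "\<phi> a < y - x"
    using small[of "y - x"] assms by auto
  define q where "q = \<lfloor>x / \<phi> a\<rfloor> + 1"
  have q: "x / \<phi> a < real_of_int q" "real_of_int q \<le> x / \<phi> a + 1"
    unfolding q_def by linarith+
  have "x < real_of_int q * \<phi> a" "real_of_int q * \<phi> a \<le> x + \<phi> a"
    using q a by (simp_all add: field_simps)
  then show ?thesis
    using that[of "ipow a q"] hm_zp[OF hA A(1) a(1), of q] subgrp_zp[OF A(1) a(1), of q] a by auto
qed

lemma iv_mult_nonneg: "a \<in> A \<Longrightarrow> b \<in> A \<Longrightarrow> iv a * b \<in> P \<Longrightarrow> \<phi> a \<le> \<phi> b"
  using nonneg[of "iv a * b"] hm_mult[OF hA, of "iv a" b] hm_iv[OF hA A(1), of a] subgrp_mult[OF A(1)] subgrp_iv[OF A(1)]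
  by force

lemma iv_mult_pos: "a \<in> A \<Longrightarrow> b \<in> A \<Longrightarrow> \<phi> a < \<phi> b \<Longrightarrow> iv a * b \<in> P"
  using pos_iff[of "iv a * b"] hm_mult[OF hA, of "iv a" b] hm_iv[OF hA A(1), of a] subgrp_mult[OF A(1)] subgrp_iv[OF A(1)]
  by force

lemma below_less:
  assumes "iv a * g \<in> P" "iv g * b \<in> P"
  shows "iv a * b \<in> P"
proof -
  have "iv a * g * (iv g * b) \<in> P"
    using cone_mult[OF c assms] .
  then show ?thesis
    by (simp add: mult.assoc)
qed

lemma \<tau>_upper:
  assumes g: "g \<in> H" and a: "a \<in> A" "iv a * g \<in> P"
  shows "\<phi> a \<le> \<tau> g"
proof -
  obtain b where b: "b \<in> A" "iv g * b \<in> P"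
    using bounded(1)[OF g] by blast
  have "bdd_above (\<phi> ` {a\<in>A. iv a * g \<in> P})"
    using iv_mult_nonneg[OF _ b(1) below_less[OF _ b(2)]] by (intro bdd_aboveI[of _ "\<phi> b"]) auto
  then show ?thesis
    unfolding \<tau>_def using a by (intro cSUP_upper) auto
qed

lemma below_\<tau>:
  assumes g: "g \<in> H" and a: "a \<in> A" "\<phi> a < \<tau> g"
  shows "iv a * g \<in> P"
proof -
  have "{a\<in>A. iv a * g \<in> P} \<noteq> {}"
    using bounded(2)[OF g] by blast
  then obtain b where b: "b \<in> A" "iv b * g \<in> P" "\<phi> a < \<phi> b"
    using less_cSUP_iff[of "{a\<in>A. iv a * g \<in> P}" \<phi> "\<phi> a"] a(2) cSUP_least[of "{a\<in>A. iv a * g \<in> P}" \<phi> "\<phi> a"]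
    unfolding \<tau>_def by (metis (mono_tags, lifting) mem_Collect_eq not_le)
  show ?thesis
    using below_less[of a b g] iv_mult_pos[OF a(1) b(1,3)] b(2) cone_mult[OF c, of "iv a * b" "iv b * g"]
    by (simp add: mult.assoc)
qed

lemma above_\<tau>:
  assumes g: "g \<in> H" and a: "a \<in> A" "\<tau> g < \<phi> a"
  shows "iv g * a \<in> P"
proof -
  obtain b where b: "b \<in> A" "\<tau> g < \<phi> b" "\<phi> b < \<phi> a"
    using dense[OF a(2)] by blast
  have gb: "iv b * g \<notin> P"
    using \<tau>_upper[OF g b(1)] b(2) by linarith
  have "iv g * b \<in> H"
    using g AH[OF b(1)] by (intro subgrp_mult[OF sH] subgrp_iv[OF sH])
  then have "iv g * b \<in> P \<or> iv g * b = 1"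
    using cone_total[OF c, of "iv g * b"] gb by auto
  then have "iv g * b * (iv b * a) \<in> P"
    using cone_mult[OF c _ iv_mult_pos[OF b(1) a(1) b(3)]] iv_mult_pos[OF b(1) a(1) b(3)] by auto
  then show ?thesis
    by (simp add: mult.assoc)
qed

text \<open>If \<open>a < h\<close> and \<open>b < g\<close>, then
  \<open>g * a * iv g * b < g * h\<close>, and the left side has value
  \<open>l g * \<phi> a + \<phi> b\<close>; the same holds with the inequalities reversed. Density
  of the values leaves no gap between the two bounds.\<close>

lemma \<tau>_mult:
  assumes g: "g \<in> H" and h: "h \<in> H"
  shows "\<tau> (g * h) = \<tau> g + l g * \<tau> h"
proof -
  have gh: "g * h \<in> H"
    using subgrp_mult[OF sH g h] .
  have cc: "g * a * iv g * a' \<in> A" "\<phi> (g * a * iv g * a') = l g * \<phi> a + \<phi> a'" if "a \<in> A" "a' \<in> A" for a a'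
    using normal_inD[OF A(3) g that(1)] that hm_mult[OF hA] l_conj[OF g that(1)] subgrp_mult[OF A(1)] by auto
  have "\<not> \<tau> (g * h) < \<tau> g + l g * \<tau> h"
  proof
    assume "\<tau> (g * h) < \<tau> g + l g * \<tau> h"
    then have "(\<tau> (g * h) - \<tau> g) / l g < \<tau> h"
      using l_pos[OF g] by (simp add: field_simps)
    then obtain a where a: "a \<in> A" "(\<tau> (g * h) - \<tau> g) / l g < \<phi> a" "\<phi> a < \<tau> h"
      by (rule dense)
    then have "\<tau> (g * h) - l g * \<phi> a < \<tau> g"
      using l_pos[OF g] by (simp add: field_simps)
    then obtain b where b: "b \<in> A" "\<tau> (g * h) - l g * \<phi> a < \<phi> b" "\<phi> b < \<tau> g"
      by (rule dense)
    have "iv b * g * (iv a * h) \<in> P"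
      using cone_mult[OF c below_\<tau>[OF g b(1,3)] below_\<tau>[OF h a(1,3)]] .
    then have "iv (g * a * iv g * b) * (g * h) \<in> P"
      by (simp add: mult.assoc)
    then have "l g * \<phi> a + \<phi> b \<le> \<tau> (g * h)"
      using \<tau>_upper[OF gh cc(1)[OF a(1) b(1)]] cc(2)[OF a(1) b(1)] by simp
    then show False
      using b(2) by linarith
  qed
  moreover have "\<not> \<tau> g + l g * \<tau> h < \<tau> (g * h)"
  proof
    assume "\<tau> g + l g * \<tau> h < \<tau> (g * h)"
    then have "\<tau> h < (\<tau> (g * h) - \<tau> g) / l g"
      using l_pos[OF g] by (simp add: field_simps)
    then obtain a where a: "a \<in> A" "\<tau> h < \<phi> a" "\<phi> a < (\<tau> (g * h) - \<tau> g) / l g"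
      by (rule dense)
    then have "\<tau> g < \<tau> (g * h) - l g * \<phi> a"
      using l_pos[OF g] by (simp add: field_simps)
    then obtain b where b: "b \<in> A" "\<tau> g < \<phi> b" "\<phi> b < \<tau> (g * h) - l g * \<phi> a"
      by (rule dense)
    have "iv h * a * (iv g * b) \<in> P"
      using cone_mult[OF c above_\<tau>[OF h a(1,2)] above_\<tau>[OF g b(1,2)]] .
    then have p: "iv (g * h) * (g * a * iv g * b) \<in> P"
      by (simp add: mult.assoc)
    have "\<phi> (g * a * iv g * b) < \<tau> (g * h)"
      using cc(2)[OF a(1) b(1)] b(3) by simp
    then have "iv (g * a * iv g * b) * (g * h) \<in> P"
      using below_\<tau>[OF gh cc(1)[OF a(1) b(1)]] by simp
    then show False
      using cone_iv[OF c p] by (simp add: mult.assoc)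
  qed
  ultimately show ?thesis
    by linarith
qed

lemma one_notin: "1 \<notin> P"
  using cone_disj[OF c, of 1] by blast

lemma \<tau>_A: "a \<in> A \<Longrightarrow> \<tau> a = \<phi> a"
  using below_\<tau>[of a a] above_\<tau>[of a a] AH[of a] one_notin by force

lemma \<tau>_one: "\<tau> 1 = 0"
  using \<tau>_A[OF subgrp_one[OF A(1)]] hm_one[OF hA A(1)] by simp

lemma \<tau>_iv: "h \<in> H \<Longrightarrow> \<tau> (iv h) = - \<tau> h / l h"
  using \<tau>_mult[of h "iv h"] subgrp_iv[OF sH, of h] \<tau>_one l_pos[of h] by (simp add: field_simps)

lemma \<tau>_nonneg:
  assumes "g \<in> P"
  shows "0 \<le> \<tau> g"
proof (rule ccontr)
  assume "\<not> 0 \<le> \<tau> g"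
  then have "iv g * 1 \<in> P"
    using hm_one[OF hA A(1)] by (intro above_\<tau>[OF PH[OF assms] subgrp_one[OF A(1)]]) simp
  then show False
    using cone_iv[OF c assms] by simp
qed

lemma \<tau>_pos: "g \<in> H \<Longrightarrow> 0 < \<tau> g \<Longrightarrow> g \<in> P"
  using below_\<tau>[of g 1] subgrp_one[OF A(1)] hm_one[OF hA A(1)] by simp

text \<open>A positive value at \<open>s\<close> in \<open>S\<close> would leave room for some
  \<open>a\<close> in \<open>A\<close> outside \<open>S\<close> between 1 and \<open>s\<close>.
  Conversely the zero set, the stabilizer of 0 in the affine action, is convex and proper, hence
  inside \<open>S\<close>.\<close>

lemma S_eq: "S = {h\<in>H. \<tau> h = 0}"
proof
  have notpos: "\<not> 0 < \<tau> s" if s: "s \<in> S" for s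
  proof
    assume "0 < \<tau> s"
    then obtain a where a: "a \<in> A" "0 < \<phi> a" "\<phi> a < \<tau> s"
      by (rule dense)
    have "a \<in> S"
      using cvx_between[OF S _ below_\<tau>[OF SsubH[OF s] a(1,3)] s] pos_iff[OF a(1)] a(2) by blast
    then show False
      using zero_iff[OF a(1)] a(2) by simp
  qed
  have "\<tau> s = 0" if s: "s \<in> S" for s
  proof -
    have "\<not> 0 < - \<tau> s / l s"
      using notpos[OF subgrp_iv[OF sS s]] \<tau>_iv[OF SsubH[OF s]] by simp
    then have "\<not> \<tau> s < 0"
      using l_pos[OF SsubH[OF s]] by (auto simp: divide_neg_pos)
    then show ?thesis
      using notpos[OF s] by linarith
  qed
  then show "S \<subseteq> {h\<in>H. \<tau> h = 0}"
    using SsubH by blast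
  have "subgrp {h\<in>H. \<tau> h = 0}"
    unfolding subgrp_def using subgrp_one[OF sH] subgrp_mult[OF sH] subgrp_iv[OF sH] \<tau>_one \<tau>_mult \<tau>_iv by auto
  moreover have "x \<in> {h\<in>H. \<tau> h = 0}" if xy: "x \<in> P" "y \<in> P" "x * y \<in> {h\<in>H. \<tau> h = 0}" for x y
  proof -
    have "0 \<le> l x * \<tau> y"
      using l_pos[OF PH[OF xy(1)]] \<tau>_nonneg[OF xy(2)] by simp
    then show ?thesis
      using \<tau>_mult[OF PH[OF xy(1)] PH[OF xy(2)]] \<tau>_nonneg[OF xy(1)] xy PH by auto
  qed
  ultimately have "cvx H {1} P {h\<in>H. \<tau> h = 0}"
    unfolding cvx_def using \<tau>_one subgrp_one[OF sH] by blast
  moreover obtain p where "p \<in> A" "0 < \<phi> p"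
    by (rule pos_ex)
  then have "{h\<in>H. \<tau> h = 0} \<noteq> H"
    using AH \<tau>_A by force
  ultimately show "{h\<in>H. \<tau> h = 0} \<subseteq> S"
    using max by blast
qed

text \<open>Conjugation by \<open>a\<close> moves the base point from 0 to \<open>\<phi> a\<close>:
  the value is the displacement of the point \<open>\<phi> a\<close> under \<open>f\<close>.\<close>

lemma \<tau>_conj: "a \<in> A \<Longrightarrow> f \<in> H \<Longrightarrow> \<tau> (iv a * f * a) = \<tau> f + (l f - 1) * \<phi> a"
  using \<tau>_mult[of "iv a * f" a] \<tau>_mult[of "iv a" f] \<tau>_iv[of a] \<tau>_A[of a] l_mult[of "iv a" f] l_iv[of a] l_A[of a]
    AH[of a] subgrp_mult[OF sH, of "iv a" f] subgrp_iv[OF sH, of a]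
  by (simp add: algebra_simps)

text \<open>An element of \<open>S\<close> fixes 0; with slope 1 it acts as the identity, so
  \<open>S\<close> is the kernel of the affine action.\<close>

lemma normal_if_trivial_scale:
  assumes "\<And>s. s \<in> S \<Longrightarrow> l s = 1"
  shows "normal_in H S"
  unfolding normal_in_def
proof (intro ballI)
  fix g s assume g: "g \<in> H" and s: "s \<in> S"
  have m: "s \<in> H" "iv g \<in> H" "g * s \<in> H" "g * s * iv g \<in> H"
    using SsubH[OF s] g sH by (auto intro: subgrp_mult subgrp_iv)
  have "\<tau> s = 0"
    using s S_eq by blast
  then have "\<tau> (g * s * iv g) = \<tau> g + l g * \<tau> (iv g)"
    using \<tau>_mult[OF m(3,2)] \<tau>_mult[OF g m(1)] l_mult[OF g m(1)] assms[OF s] by simp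
  also have "\<dots> = 0"
    using \<tau>_iv[OF g] l_pos[OF g] by simp
  finally show "g * s * iv g \<in> S"
    using S_eq m by blast
qed

text \<open>If \<open>l\<close> is nontrivial on \<open>S\<close>, the order is moved only slightly by conjugation with a small
  \<open>a \<in> A\<close>: the sign of \<open>\<phi> a\<close> is chosen so that the conjugate agrees on \<open>S\<close> outside the kernel of
  \<open>l\<close>, and \<open>a\<close> is a power whose exponent makes it act trivially on the finitely many orders of that kernel.\<close>

lemma trivial_scale:
  assumes T: "tararin T m" "T m = S" and s: "s \<in> S"
  shows "l s = 1"
proof (rule ccontr)
  assume ns: "l s \<noteq> 1"
  have "m \<noteq> 0"
    using tararin_zero[OF T(1)] T(2) s ns l_one by (metis singletonD)
  then obtain k where k: "m = Suc k"
    by (cases m) auto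
  note Tk = T(1)[unfolded k] and TS = T(2)[unfolded k]
  let ?K = "T k"
  have lS: "0 < l h" "g \<in> S \<Longrightarrow> l (g * h) = l g * l h" if "h \<in> S" for g h
    using that l_pos l_mult SsubH by blast+
  \<comment> \<open>Negative factors kill positive characters below the top term, so
    \<open>l\<close> restricted to \<open>S\<close> depends only on the top jump
    \<open>S/?K\<close>.\<close>
  have lK: "l x = 1" if "x \<in> ?K" for x
    using tararin_character[OF Tk, of l k x] lS that unfolding TS by blast
  obtain \<kappa>0 where q0: "qhom S ?K \<kappa>0"
    using tararin_qhom[OF Tk] unfolding TS by blast
  have vK: "cvx S {1} (P \<inter> S) ?K"
    using tararin_convex[OF Tk, unfolded TS, OF cB] .
  note cK = cvx_cone_above[OF cB vK] and cKb = cvx_cone_below[OF cB vK]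
  obtain \<kappa> where q: "ohom S ?K (P \<inter> S - ?K) \<kappa>" "qhom S ?K \<kappa>"
    using qhom_oriented[OF q0 cK] .
  have KS: "?K \<subseteq> S"
    using qhomD(3)[OF q(2)] by blast
  have sK: "s \<notin> ?K"
    using ns lK by blast
  have ln: "ln (l x) = \<kappa> x / \<kappa> s * ln (l s)" if "x \<in> S" for x
  proof (rule hm_vanishing[OF q(2) s, of "\<lambda>x. ln (l x)"])
    show "hm S (\<lambda>x. ln (l x))"
      unfolding hm_def
    proof (intro ballI)
      fix x y assume xy: "x \<in> S" "y \<in> S"
      show "ln (l (x * y)) = ln (l x) + ln (l y)"
        unfolding lS(2)[OF xy(2,1)] using ln_mult_pos[OF lS(1)[OF xy(1)] lS(1)[OF xy(2)]] .
    qed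
    show "\<kappa> s \<noteq> 0"
      using sK s qhomD(3)[OF q(2)] by blast
  qed (use lK that in auto)
  define w where "w = ln (l s) / \<kappa> s"
  have w0: "w \<noteq> 0"
    using ns lS(1)[OF s] sK s qhomD(3)[OF q(2), of s] by (simp add: w_def)
  have lnw: "ln (l x) = w * \<kappa> x" if "x \<in> S" for x
    using ln[OF that] by (simp add: w_def)
  have l_eq: "l x = exp (w * \<kappa> x)" if "x \<in> S" for x
    using lnw[OF that] lS(1)[OF that] by (metis exp_ln)
  have K_eq: "x \<in> ?K" if "x \<in> S" "l x = 1" for x
    using l_eq[OF that(1)] that w0 qhomD(3)[OF q(2)] by simp
  define r where "r = (fact (card {Q. cone ?K {1} Q}) :: nat)"
  have r0: "0 < real r"
    by (simp add: r_def)
  \<comment> \<open>\<open>?K\<close> consists of the elements that act on the line as the identity,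
    and therefore \<open>A\<close> normalizes it.\<close>
  have conjK: "iv b * x * b \<in> ?K" if b: "b \<in> A" and x: "x \<in> ?K" for b x
  proof -
    have xS: "x \<in> S" "x \<in> H" "l x = 1" "\<tau> x = 0"
      using x KS lK S_eq by auto
    have m: "iv b \<in> H" "iv b * x \<in> H" "iv b * x * b \<in> H"
      using AH[OF b] xS(2) sH by (auto intro: subgrp_mult subgrp_iv)
    have "iv b * x * b \<in> S"
      using \<tau>_conj[OF b xS(2)] xS m S_eq by simp
    moreover have "l (iv b * x * b) = 1"
      using l_mult[OF m(2) AH[OF b]] l_mult[OF m(1) xS(2)] l_A[OF b] l_A[OF subgrp_iv[OF A(1) b]] xS by simp
    ultimately show ?thesis
      using K_eq by blast
  qed
  have period: "iv (b ^ r) * x * b ^ r \<in> P" if b: "b \<in> A" and x: "x \<in> P \<inter> ?K" for b x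
  proof -
    have e: "P \<inter> S \<inter> ?K = P \<inter> ?K"
      using KS by blast
    have "iv (b ^ r) * x * b ^ r \<in> P \<inter> ?K"
      unfolding r_def
    proof (rule finite_conj_period[OF tararin_finite[OF tararin_Suc[OF Tk]] cKb[unfolded e]])
      show "b * y * iv b \<in> ?K" if "y \<in> ?K" for y
        using conjK[OF subgrp_iv[OF A(1) b] that] by simp
    qed (use conjK[OF b] x in auto)
    then show ?thesis
      by blast
  qed
  obtain F where F: "finite F" "F \<subseteq> P" "\<And>Q. cone H {1} Q \<Longrightarrow> F \<subseteq> Q \<Longrightarrow> Q = P"
    using isolated by (auto simp: isolated_def)
  have Fpos: "0 < \<tau> f" if "f \<in> F" "f \<notin> S" for f
    using \<tau>_nonneg[of f] F(2) that S_eq PH[of f] by force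
  have "\<forall>\<^sub>F e in at_right 0. \<forall>f\<in>F. f \<notin> S \<longrightarrow> \<bar>l f - 1\<bar> * e < \<tau> f"
  proof (intro eventually_ball_finite[OF F(1)] ballI)
    fix f assume f: "f \<in> F"
    show "\<forall>\<^sub>F e in at_right 0. f \<notin> S \<longrightarrow> \<bar>l f - 1\<bar> * e < \<tau> f"
    proof (cases "f \<in> S")
      case False
      have "((\<lambda>e. \<bar>l f - 1\<bar> * e) \<longlongrightarrow> \<bar>l f - 1\<bar> * 0) (at_right 0)"
        by (intro tendsto_intros)
      then have "\<forall>\<^sub>F e in at_right 0. \<bar>l f - 1\<bar> * e < \<tau> f"
        using Fpos[OF f False] by (intro order_tendstoD(2)) auto
      then show ?thesis
        by (rule eventually_mono) simp
    qed simp
  qed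
  then have "\<forall>\<^sub>F e in at_right 0. 0 < e \<and> (\<forall>f\<in>F. f \<notin> S \<longrightarrow> \<bar>l f - 1\<bar> * e < \<tau> f)"
    by (auto intro: eventually_conj eventually_at_right_less)
  then obtain e where e: "0 < e" "\<And>f. f \<in> F \<Longrightarrow> f \<notin> S \<Longrightarrow> \<bar>l f - 1\<bar> * e < \<tau> f"
    using eventually_happens'[of "at_right (0::real)"] trivial_limit_at_right_real by blast
  \<comment> \<open>The bound is divided by \<open>r\<close> because the conjugating element will be
    \<open>b ^ r\<close>, whose value is \<open>r * \<phi> b\<close>.\<close>
  obtain b0 where b0: "b0 \<in> A" "0 < \<phi> b0" "\<phi> b0 < e / real r"
    using small[of "e / real r"] e(1) r0 by auto
  define b where "b = (if 0 < w then b0 else iv b0)"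
  have b: "b \<in> A" "0 < w * \<phi> b" "\<bar>\<phi> b\<bar> < e / real r"
    using b0 subgrp_iv[OF A(1) b0(1)] hm_iv[OF hA A(1) b0(1)] w0 by (auto simp: b_def mult_less_0_iff)
  define a where "a = b ^ r"
  have pa: "\<phi> a = real r * \<phi> b"
    unfolding a_def by (rule hm_pow[OF hA A(1) b(1)])
  have aA: "a \<in> A" "a \<in> H"
    unfolding a_def using subgrp_pow[OF A(1) b(1)] AH by auto
  have wa: "0 < w * \<phi> a"
    using mult_pos_pos[OF r0 b(2)] pa by (simp add: mult.left_commute)
  have ae: "\<bar>\<phi> a\<bar> < e"
    using b(3) r0 pa by (simp add: abs_mult field_simps)
  let ?Q = "{x\<in>H. iv a * x * a \<in> P}"
  have cm: "iv a * f * a \<in> H" if "f \<in> H" for f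
    using that aA sH by (intro subgrp_mult subgrp_iv) auto
  have sgn: "0 < (l f - 1) * \<phi> a" if f: "f \<in> S" "0 < \<kappa> f" for f
  proof (cases "0 < w")
    case True
    then have "1 < l f" "0 < \<phi> a"
      using l_eq[OF f(1)] f wa by (auto simp: zero_less_mult_iff)
    then show ?thesis
      by simp
  next
    case False
    then have "w < 0"
      using w0 by simp
    then have "l f < 1" "\<phi> a < 0"
      using l_eq[OF f(1)] f wa by (auto simp: zero_less_mult_iff mult_neg_pos)
    then show ?thesis
      by (simp add: mult_neg_neg)
  qed
  have "f \<in> ?Q" if f: "f \<in> F" for f
  proof -
    have fP: "f \<in> P" "f \<in> H"
      using f F(2) PH by auto
    consider "f \<notin> S" | "f \<in> P \<inter> S - ?K" | "f \<in> P \<inter> ?K"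
      using fP by blast
    then have "iv a * f * a \<in> P"
    proof cases
      case 1
      have "\<bar>l f - 1\<bar> * \<bar>\<phi> a\<bar> \<le> \<bar>l f - 1\<bar> * e"
        using ae by (intro mult_left_mono) auto
      then have "\<bar>(l f - 1) * \<phi> a\<bar> < \<tau> f"
        using e(2)[OF f 1] by (simp add: abs_mult)
      then have "0 < \<tau> (iv a * f * a)"
        unfolding \<tau>_conj[OF aA(1) fP(2)] by linarith
      then show ?thesis
        using \<tau>_pos cm fP by blast
    next
      case 2
      then have "\<tau> f = 0" "0 < \<kappa> f" "f \<in> S"
        using S_eq ohomD(3)[OF q(1)] by auto
      then have "0 < \<tau> (iv a * f * a)"
        unfolding \<tau>_conj[OF aA(1) fP(2)] using sgn by simp
      then show ?thesis
        using \<tau>_pos cm fP by blast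
    next
      case 3
      then show ?thesis
        unfolding a_def using period[OF b(1)] by blast
    qed
    then show ?thesis
      using fP by blast
  qed
  then have QP: "?Q = P"
    using F(3)[OF cone_conj[OF c normal_in_triv aA(2)]] by blast
  have "\<kappa> s \<noteq> 0" "\<kappa> (iv s) = - \<kappa> s" "iv s \<in> S"
    using sK s qhomD(3)[OF q(2)] hm_iv[OF ohomD(2,1)[OF q(1)] s] subgrp_iv[OF sS s] by auto
  then obtain u where u: "u \<in> S" "0 < \<kappa> u"
    using s by (cases "0 < \<kappa> s") (auto intro: that)
  have uu: "iv u \<in> S" "iv u \<in> H" "\<tau> (iv u) = 0"
    using subgrp_iv[OF sS u(1)] S_eq by auto
  have "(l (iv u) - 1) * \<phi> a = - ((l u - 1) * \<phi> a) / l u"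
    using l_iv[OF SsubH[OF u(1)]] lS(1)[OF u(1)] by (simp add: field_simps)
  then have neg: "(l (iv u) - 1) * \<phi> a < 0"
    using sgn[OF u] lS(1)[OF u(1)] by (simp add: divide_neg_pos)
  \<comment> \<open>The element \<open>d * iv u\<close> is positive at the base point 0, where only
    \<open>\<phi> d\<close> counts, but at \<open>\<phi> a\<close> the displacement of
    \<open>iv u\<close> is negative and larger in size. So the conjugated order differs from
    \<open>P\<close> after all.\<close>
  obtain d where d: "d \<in> A" "0 < \<phi> d" "\<phi> d < - ((l (iv u) - 1) * \<phi> a)"
    using dense[of 0 "- ((l (iv u) - 1) * \<phi> a)"] neg by auto
  have g: "d * iv u \<in> H" "\<tau> (d * iv u) = \<phi> d" "l (d * iv u) = l (iv u)"
    using subgrp_mult[OF sH AH[OF d(1)] uu(2)] \<tau>_mult[OF AH[OF d(1)] uu(2)] l_mult[OF AH[OF d(1)] uu(2)]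
      uu(3) \<tau>_A[OF d(1)] l_A[OF d(1)] by auto
  have "d * iv u \<in> P"
    using \<tau>_pos[OF g(1)] g(2) d(2) by simp
  moreover have "\<tau> (iv a * (d * iv u) * a) < 0"
    unfolding \<tau>_conj[OF aA(1) g(1)] g(2,3) using d(3) by linarith
  then have "d * iv u \<notin> ?Q"
    using \<tau>_nonneg by force
  ultimately show False
    using QP by blast
qed

lemma dense_normal: "tararin T m \<Longrightarrow> T m = S \<Longrightarrow> normal_in H S"
  using normal_if_trivial_scale trivial_scale by blast

end

text \<open>If \<open>H\<close> acts trivially on \<open>A\<close> modulo \<open>S\<close> and \<open>B/A\<close> has rank one, then \<open>B\<close> is commutative modulo
  \<open>A \<inter> S\<close>. The elements of \<open>B\<close> whose powers are bounded form a normal subgroup of \<open>H\<close>, so their convex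
  hull is proper; hence they are the elements of \<open>B \<inter> S\<close>.\<close>

lemma (in normal_quot) climb_step:
  assumes tr: "\<And>h a. h \<in> H \<Longrightarrow> a \<in> A \<Longrightarrow> \<phi> (h * a * iv h) = \<phi> a"
    and B: "subgrp B" "A \<subseteq> B" "B \<subseteq> H" "normal_in H B" and q: "qhom B A \<theta>"
  shows "normal_in H (B \<inter> S)" "\<exists>\<psi>. ohom B (B \<inter> S) (P \<inter> B - S) \<psi>"
proof -
  define D' where "D' = A \<inter> S"
  define R where "R = P - S"
  have cR: "cone H S R"
    unfolding R_def by (rule cS)
  have sD: "subgrp D'"
    unfolding D'_def by (rule subgrp_Int[OF A(1) sS])
  have nD: "normal_in H D'"
    unfolding D'_def by (rule D)
  have DS: "d \<in> S" if "d \<in> D'" for d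
    using that by (simp add: D'_def)
  have DH: "d \<in> H" if "d \<in> D'" for d
    using DS[OF that] SsubH by blast
  have BH: "x \<in> H" if "x \<in> B" for x
    using that B(3) by blast
  have comA: "h * a * iv h * iv a \<in> D'" if h: "h \<in> H" and a: "a \<in> A" for h a
  proof -
    have m: "h * a * iv h \<in> A" "iv a \<in> A"
      using normal_inD[OF A(3) h a] subgrp_iv[OF A(1) a] by auto
    have "\<phi> (h * a * iv h * iv a) = 0"
      using hm_mult[OF hA m] hm_iv[OF hA A(1) a] tr[OF h a] by simp
    then show ?thesis
      using zero_iff[OF subgrp_mult[OF A(1) m]] subgrp_mult[OF A(1) m] by (simp add: D'_def)
  qed
  have comB: "x * y * iv x * iv y \<in> D'" if xy: "x \<in> B" "y \<in> B" for x y
  proof -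
    have m: "x * y * iv x * iv y \<in> A"
      using xy qhomD(1,2)[OF q] by (simp add: qhomD(3)[OF q] hm_mult[of B] hm_iv[of B] subgrp_mult subgrp_iv)
    have "\<phi> (x * y * iv x * iv y) = 0"
      using central_commutator[OF q hA tr[OF BH] xy] .
    then show ?thesis
      using zero_iff[OF m] m by (simp add: D'_def)
  qed
  define lt where "lt u v \<longleftrightarrow> iv u * v \<in> R" for u v
  define le where "le u v \<longleftrightarrow> iv u * v \<in> R \<or> iv u * v \<in> S" for u v
  have lt_trans: "lt u w" if "lt u v" "lt v w" for u v w
  proof -
    have "iv u * v * (iv v * w) \<in> R"
      using that cone_mult[OF cR] by (simp add: lt_def)
    then show ?thesis
      by (simp add: lt_def mult.assoc)
  qed
  have le_trans: "le u w" if "le u v" "le v w" for u v w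
  proof -
    have "iv u * v * (iv v * w) \<in> R \<or> iv u * v * (iv v * w) \<in> S"
      using that cone_mult[OF cR] cone_NP[OF cR] cone_PN[OF cR] subgrp_mult[OF sS] by (auto simp: le_def)
    then show ?thesis
      by (simp add: le_def mult.assoc)
  qed
  have le_lt_trans: "lt u w" if "le u v" "lt v w" for u v w
  proof -
    have "iv u * v * (iv v * w) \<in> R"
      using that cone_mult[OF cR] cone_NP[OF cR] by (auto simp: le_def lt_def)
    then show ?thesis
      by (simp add: lt_def mult.assoc)
  qed
  have left: "lt (g * u) (g * v) \<longleftrightarrow> lt u v" "le (g * u) (g * v) \<longleftrightarrow> le u v" for g u v
    by (simp_all add: lt_def le_def mult.assoc)
  have lt_irrefl: "\<not> lt u u" for u
    using cone_disj[OF cR, of 1] subgrp_one[OF sS] by (auto simp: lt_def)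
  have nlt: "le v u" if "\<not> lt u v" "u \<in> H" "v \<in> H" for u v
  proof -
    have "iv u * v \<in> H"
      using that sH by (auto intro: subgrp_mult subgrp_iv)
    then show ?thesis
      using that(1) cone_total[OF cR, of "iv u * v"] subgrp_iv[OF sS, of "iv u * v"] by (auto simp: le_def lt_def)
  qed
  \<comment> \<open>A factor from \<open>D'\<close> can be moved past \<open>v\<close> by normality,
    and then it disappears in the coset of \<open>S\<close>. So comparisons may be made in
    \<open>H\<close> modulo \<open>D'\<close>, although \<open>S\<close> is not normal.\<close>
  have Dl: "lt u (d * v) \<longleftrightarrow> lt u v" "le u (d * v) \<longleftrightarrow> le u v" if d: "d \<in> D'" and uv: "u \<in> H" "v \<in> H" for d u v
  proof -
    have s: "iv v * d * v \<in> S" "iv v * iv d * v \<in> S"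
      using DS[OF normal_inD2[OF nD sH uv(2) d]] DS[OF normal_inD2[OF nD sH uv(2) subgrp_iv[OF sD d]]] .
    have e: "iv u * (d * v) = iv u * v * (iv v * d * v)" "iv u * v = iv u * (d * v) * (iv v * iv d * v)"
      by (simp_all add: mult.assoc)
    have a: "iv u * (d * v) \<in> R" if "iv u * v \<in> R"
      unfolding e(1) using cone_PN[OF cR s(1) that] .
    have b: "iv u * v \<in> R" if "iv u * (d * v) \<in> R"
      unfolding e(2) using cone_PN[OF cR s(2) that] .
    have a': "iv u * (d * v) \<in> S" if "iv u * v \<in> S"
      unfolding e(1) using subgrp_mult[OF sS that s(1)] .
    have b': "iv u * v \<in> S" if "iv u * (d * v) \<in> S"
      unfolding e(2) using subgrp_mult[OF sS that s(2)] .
    show "lt u (d * v) \<longleftrightarrow> lt u v" "le u (d * v) \<longleftrightarrow> le u v"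
      using a b a' b' unfolding lt_def le_def by blast+
  qed
  have Dr: "lt (d * u) v \<longleftrightarrow> lt u v" if d: "d \<in> D'" and uv: "u \<in> H" "v \<in> H" for d u v
  proof -
    have "lt (d * u) v \<longleftrightarrow> lt (d * u) (d * (iv d * v))"
      by simp
    also have "\<dots> \<longleftrightarrow> lt u v"
      unfolding left using Dl(1)[OF subgrp_iv[OF sD d] uv] .
    finally show ?thesis .
  qed
  have swapA: "lt u (h * a) \<longleftrightarrow> lt u (a * h)" "le u (h * a) \<longleftrightarrow> le u (a * h)"
    if u: "u \<in> H" and h: "h \<in> H" and a: "a \<in> A" for u h a
  proof -
    have e: "h * a = (h * a * iv h * iv a) * (a * h)"
      by (simp add: mult.assoc)
    show "lt u (h * a) \<longleftrightarrow> lt u (a * h)"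
      by (subst e) (rule Dl(1)[OF comA[OF h a] u subgrp_mult[OF sH AH[OF a] h]])
    show "le u (h * a) \<longleftrightarrow> le u (a * h)"
      by (subst e) (rule Dl(2)[OF comA[OF h a] u subgrp_mult[OF sH AH[OF a] h]])
  qed
  obtain p where p: "p \<in> A" "p \<in> P" "p \<notin> S" "0 < \<phi> p"
    by (rule pos_ex)
  have pR: "p \<in> R" and pH: "p \<in> H"
    using p AH by (auto simp: R_def)
  have pA: "p ^ n \<in> A" and pnH: "p ^ n \<in> H" for n
    using subgrp_pow[OF A(1) p(1)] AH by auto
  have cof: "\<exists>n. lt h (p ^ n)" if h: "h \<in> H" for h
  proof -
    obtain n where n: "iv h * p ^ n \<in> P"
      using cofinal[OF p(1,4) h] by blast
    have "iv h * p ^ n * p \<in> R"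
    proof (cases "iv h * p ^ n \<in> S")
      case True
      then show ?thesis
        using cone_NP[OF cR _ pR] by blast
    next
      case False
      then show ?thesis
        using n cone_mult[OF cR _ pR] by (simp add: R_def)
    qed
    then show ?thesis
      unfolding lt_def by (intro exI[of _ "Suc n"]) (simp add: power_Suc2 mult.assoc del: power_Suc)
  qed
  have powB: "\<exists>d\<in>D'. (x * y) ^ k = d * (x ^ k * y ^ k)" if xy: "x \<in> B" "y \<in> B" for x y k
  proof (induction k)
    case 0
    then show ?case
      using subgrp_one[OF sD] by (intro bexI[of _ 1]) auto
  next
    case (Suc k)
    then obtain d where d: "d \<in> D'" "(x * y) ^ k = d * (x ^ k * y ^ k)"
      by blast
    have xk: "x ^ k \<in> B"
      using subgrp_pow[OF B(1) xy(1)] .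
    define e1 where "e1 = (x * y) * d * iv (x * y)"
    define e2 where "e2 = x * (y * x ^ k * iv y * iv (x ^ k)) * iv x"
    have "e1 \<in> D'"
      unfolding e1_def using normal_inD[OF nD BH[OF subgrp_mult[OF B(1) xy]] d(1)] .
    moreover have "e2 \<in> D'"
      unfolding e2_def using normal_inD[OF nD BH[OF xy(1)] comB[OF xy(2) xk]] .
    moreover have "(x * y) ^ Suc k = (e1 * e2) * (x ^ Suc k * y ^ Suc k)"
      by (simp add: d(2) e1_def e2_def mult.assoc)
    ultimately show ?case
      using subgrp_mult[OF sD] by blast
  qed
  \<comment> \<open>Bounded from above by a fixed power of \<open>p\<close>; since powers of
    \<open>p\<close> are cofinal, the choice of \<open>p\<close> is immaterial.\<close>
  define U where "U x \<longleftrightarrow> (\<exists>M. \<forall>k. lt (x ^ k) (p ^ M))" for x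
  have U_mult: "U (x * y)" if xy: "x \<in> B" "y \<in> B" and Uxy: "U x" "U y" for x y
  proof -
    obtain M where M: "\<And>k. lt (x ^ k) (p ^ M)"
      using Uxy(1) unfolding U_def by blast
    obtain M' where M': "\<And>k. lt (y ^ k) (p ^ M')"
      using Uxy(2) unfolding U_def by blast
    have "lt ((x * y) ^ k) (p ^ (M' + M))" for k
    proof -
      have H: "x ^ k \<in> H" "y ^ k \<in> H" "x ^ k * y ^ k \<in> H"
        using xy BH sH by (auto intro: subgrp_pow subgrp_mult)
      obtain d where d: "d \<in> D'" "(x * y) ^ k = d * (x ^ k * y ^ k)"
        using powB[OF xy] by blast
      have "lt (x ^ k * y ^ k) (x ^ k * p ^ M')"
        using M' left by blast
      then have "lt (x ^ k * y ^ k) (p ^ M' * x ^ k)"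
        using swapA(1)[OF H(3,1) pA] by blast
      moreover have "lt (p ^ M' * x ^ k) (p ^ M' * p ^ M)"
        using M left by blast
      ultimately have "lt (x ^ k * y ^ k) (p ^ (M' + M))"
        unfolding power_add by (rule lt_trans)
      then show ?thesis
        unfolding d(2) using Dr[OF d(1) H(3) pnH] by blast
    qed
    then show ?thesis
      unfolding U_def by blast
  qed
  have U_conj: "U (h * x * iv h)" if h: "h \<in> H" and x: "x \<in> B" and Ux: "U x" for h x
  proof -
    obtain M where M: "\<And>k. lt (x ^ k) (p ^ M)"
      using Ux unfolding U_def by blast
    obtain a where a: "lt h (p ^ a)"
      using cof[OF h] by blast
    obtain b where b: "lt (iv h) (p ^ b)"
      using cof[OF subgrp_iv[OF sH h]] by blast
    have "lt ((h * x * iv h) ^ k) (p ^ (b + (M + a)))" for k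
    proof -
      have H: "x ^ k \<in> H" "h * x ^ k * iv h \<in> H" "h * x ^ k \<in> H"
        using x h BH sH by (auto intro: subgrp_pow subgrp_mult subgrp_iv)
      have "lt (h * x ^ k * iv h) (h * x ^ k * p ^ b)"
        using b left by blast
      then have "lt (h * x ^ k * iv h) (p ^ b * (h * x ^ k))"
        using swapA(1)[OF H(2,3) pA] by blast
      moreover have "lt (p ^ b * (h * x ^ k)) (p ^ b * (h * p ^ M))"
        using M left by blast
      moreover have "lt (p ^ b * (h * p ^ M)) (p ^ b * (p ^ M * p ^ a))"
      proof -
        have "lt (p ^ M * h) (p ^ M * p ^ a)"
          using a left by blast
        moreover have "h * p ^ M = (h * p ^ M * iv h * iv (p ^ M)) * (p ^ M * h)"
          by (simp add: mult.assoc)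
        ultimately have "lt (h * p ^ M) (p ^ M * p ^ a)"
          using Dr[OF comA[OF h pA[of M]] subgrp_mult[OF sH pnH h] subgrp_mult[OF sH pnH pnH]] by metis
        then show ?thesis
          using left by blast
      qed
      ultimately have "lt (h * x ^ k * iv h) (p ^ b * (p ^ M * p ^ a))"
        using lt_trans by blast
      then show ?thesis
        unfolding conj_power power_add .
    qed
    then show ?thesis
      unfolding U_def by blast
  qed
  define E where "E = {x\<in>B. U x \<and> U (iv x)}"
  have U1: "U 1"
    unfolding U_def by (rule exI[of _ 1]) (simp add: lt_def pR)
  have sE: "subgrp E"
    unfolding subgrp_def
  proof (intro conjI ballI)
    show "1 \<in> E"
      using subgrp_one[OF B(1)] U1 by (simp add: E_def)
    show "x * y \<in> E" if "x \<in> E" "y \<in> E" for x y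
      using that U_mult[of x y] U_mult[of "iv y" "iv x"] subgrp_mult[OF B(1)] subgrp_iv[OF B(1)] by (simp add: E_def)
    show "iv x \<in> E" if "x \<in> E" for x
      using that subgrp_iv[OF B(1)] by (simp add: E_def)
  qed
  have nE: "normal_in H E"
    unfolding normal_in_def
  proof (intro ballI)
    fix h x assume h: "h \<in> H" and x: "x \<in> E"
    have xB: "x \<in> B" "iv x \<in> B" "U x" "U (iv x)"
      using x subgrp_iv[OF B(1)] by (auto simp: E_def)
    have "iv (h * x * iv h) = h * iv x * iv h"
      by (simp add: mult.assoc)
    then show "h * x * iv h \<in> E"
      using normal_inD[OF B(4) h xB(1)] U_conj[OF h xB(1,3)] U_conj[OF h xB(2,4)] unfolding E_def by simp
  qed
  have EH: "E \<subseteq> H"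
    using BH by (auto simp: E_def)
  have US: "U s" if "s \<in> S" for s
    unfolding U_def
  proof (intro exI[of _ 1] allI)
    fix k
    show "lt (s ^ k) (p ^ 1)"
      using cone_NP[OF cR subgrp_iv[OF sS subgrp_pow[OF sS that]] pR] by (simp add: lt_def)
  qed
  have SE: "B \<inter> S \<subseteq> E"
    using US subgrp_iv[OF sS] by (auto simp: E_def)
  \<comment> \<open>Otherwise the hull of \<open>E\<close> would be \<open>H\<close>, and
    \<open>E\<close> would contain some \<open>y\<close> above \<open>p\<close>. As \<open>p\<close>
    commutes with everything modulo \<open>D'\<close>, this gives \<open>p ^ k \<le> y ^ k\<close>
    for all \<open>k\<close>, which exceeds any bound.\<close>
  have ES: "E \<subseteq> S"
  proof (rule ccontr)
    assume "\<not> E \<subseteq> S"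
    then obtain x where x: "x \<in> E" "x \<notin> S"
      by blast
    then have "x \<in> R \<or> iv x \<in> R"
      using cone_total[OF cR, of x] EH by blast
    then obtain z where z: "z \<in> E" "z \<in> P" "z \<notin> S"
      using x subgrp_iv[OF sE] unfolding R_def by blast
    note K = chull_cvx[OF c sE EH nE z(1,2)]
    have "chull H P E = H"
      using max[OF K(1)] K(2) z by blast
    then obtain y where y: "y \<in> E" "iv p * y \<in> P"
      using pH unfolding chull_def by blast
    have yB: "y \<in> B" "y \<in> H" "U y"
      using y(1) EH by (auto simp: E_def)
    have py: "le p y"
      using y(2) by (auto simp: le_def R_def)
    have "le (p ^ k) (y ^ k)" for k
    proof (induction k)
      case 0
      then show ?case
        by (simp add: le_def subgrp_one[OF sS])
    next
      case (Suc k)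
      have H: "p ^ Suc k \<in> H" "y ^ k \<in> H"
        using pnH[of "Suc k"] subgrp_pow[OF sH yB(2)] by auto
      have "le (p * p ^ k) (p * y ^ k)"
        using Suc left by blast
      then have "le (p ^ Suc k) (y ^ k * p)"
        using swapA(2)[OF H p(1)] by simp
      moreover have "le (y ^ k * p) (y ^ k * y)"
        using py left by blast
      ultimately show ?case
        using le_trans unfolding power_Suc2 by blast
    qed
    moreover obtain M where "\<And>k. lt (y ^ k) (p ^ M)"
      using yB(3) unfolding U_def by blast
    ultimately have "lt (p ^ M) (p ^ M)"
      using le_lt_trans by blast
    then show False
      using lt_irrefl by blast
  qed
  have E_eq: "E = B \<inter> S"
    using ES SE by (auto simp: E_def)
  then show nBS: "normal_in H (B \<inter> S)"
    using nE by simp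
  have RB: "R \<inter> B = P \<inter> B - S" and SB: "S \<inter> B = B \<inter> S"
    by (auto simp: R_def)
  have cB: "cone B (B \<inter> S) (P \<inter> B - S)"
    using cone_restrict[OF cR B(1,3)] unfolding RB SB .
  show "\<exists>\<psi>. ohom B (B \<inter> S) (P \<inter> B - S) \<psi>"
  proof (rule hoelder[OF cB normal_in_mono[OF nBS B(3)]])
    fix x y assume x: "x \<in> P \<inter> B - S" and y: "y \<in> B"
    have xB: "x \<in> B" "x \<in> R" "x \<in> H"
      using x BH by (auto simp: R_def)
    have xk: "x ^ k \<in> H" for k
      using subgrp_pow[OF sH xB(3)] .
    \<comment> \<open>If no power of \<open>x\<close> passes \<open>y\<close>, these powers are
      bounded, and those of \<open>iv x\<close> lie below \<open>p\<close>. So \<open>x\<close> lies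
      in \<open>E\<close>, which is inside \<open>S\<close>.\<close>
    have "\<exists>n. lt y (x ^ n)"
    proof (rule ccontr)
      assume n: "\<nexists>n. lt y (x ^ n)"
      obtain M where M: "lt y (p ^ M)"
        using cof[OF BH[OF y]] by blast
      have "lt (x ^ k) (p ^ M)" for k
        using nlt[of y "x ^ k"] n BH[OF y] xk le_lt_trans[OF _ M] by blast
      then have "U x"
        unfolding U_def by blast
      moreover have "lt (iv x ^ k) (p ^ 1)" for k
      proof (cases "k = 0")
        case True
        then show ?thesis
          using pR by (simp add: lt_def)
      next
        case False
        then have "x ^ k \<in> R"
          using cone_pow[OF cR xB(2)] by simp
        then show ?thesis
          using cone_mult[OF cR _ pR] by (simp add: lt_def iv_power[symmetric])
      qed
      then have "U (iv x)"
        unfolding U_def by blast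
      ultimately have "x \<in> S"
        using xB(1) ES by (auto simp: E_def)
      then show False
        using x by blast
    qed
    then obtain n where n: "iv y * x ^ n \<in> R"
      unfolding lt_def by blast
    moreover have "iv y * x ^ n \<in> B"
      using xB(1) y B(1) by (auto intro: subgrp_mult subgrp_iv subgrp_pow)
    ultimately show "\<exists>n. iv y * x ^ n \<in> P \<inter> B - S"
      unfolding R_def by blast
  qed
qed

text \<open>\<open>St j\<close> says that \<open>A j\<close> fits \<open>normal_quot\<close>. At
  \<open>j = n\<close> it is the claim, since \<open>A n = H\<close>; at a smaller \<open>j\<close>,
  a nontrivial scale makes the values of \<phi> dense and ends the climb at once.\<close>

lemma (in max_cvx) convex_normal:
  assumes r: "rseries G X n" and nX: "\<And>i. i \<le> n \<Longrightarrow> normal_in G (X i)" and HG: "H \<subseteq> G"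
    and T: "tararin T m" "T m = S"
  shows "normal_in H S"
proof -
  define A where "A j = H \<inter> X j" for j
  have sA: "subgrp (A j)" and nA: "normal_in H (A j)" if "j \<le> n" for j
    using subgrp_Int[OF sH rseries_sg[OF r that]] normal_in_Int[OF normal_in_self[OF sH] normal_in_mono[OF nX[OF that] HG]]
    by (simp_all add: A_def)
  have AH: "A j \<subseteq> H" for j
    by (auto simp: A_def)
  have An: "A n = H"
    using r HG by (auto simp: A_def rseries_def)
  have A0: "A 0 \<subseteq> S"
    using r subgrp_one[OF sS] by (auto simp: A_def rseries_def)
  have qA: "\<exists>\<theta>. qhom (A (Suc j)) (A j) \<theta>" if jn: "j < n" for j
  proof -
    obtain \<theta> where q: "qhom (X (Suc j)) (X j) \<theta>"
      using rseries_qhom[OF r jn] by blast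
    have "X j \<inter> A (Suc j) = A j"
      using rseries_step[OF r jn] by (auto simp: A_def)
    then show ?thesis
      using qhom_restrict[OF q sA[of "Suc j"]] jn by (auto simp: A_def)
  qed
  define St where "St j \<longleftrightarrow> \<not> A j \<subseteq> S \<and> normal_in H (A j \<inter> S) \<and> (\<exists>\<phi>. ohom (A j) (A j \<inter> S) (P \<inter> A j - S) \<phi>)" for j
  have climb: "normal_in H S" if "j \<le> n" "St j" for j
    using that
  proof (induction j rule: inc_induct)
    case base
    moreover have "H \<inter> S = S"
      using SsubH by blast
    ultimately show ?case
      by (simp add: St_def An)
  next
    case (step j)
    obtain \<phi> where st: "\<not> A j \<subseteq> S" "normal_in H (A j \<inter> S)" "ohom (A j) (A j \<inter> S) (P \<inter> A j - S) \<phi>"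
      using step(4) by (auto simp: St_def)
    have j: "j \<le> n" "Suc j \<le> n"
      using step(2) by auto
    interpret Q: normal_quot H P S "A j" \<phi>
      by unfold_locales (use st sA[OF j(1)] nA[OF j(1)] AH in auto)
    obtain l where l: "\<And>h. h \<in> H \<Longrightarrow> 0 < l h" "\<And>h a. h \<in> H \<Longrightarrow> a \<in> A j \<Longrightarrow> \<phi> (h * a * iv h) = l h * \<phi> a"
      "\<And>g h. g \<in> H \<Longrightarrow> h \<in> H \<Longrightarrow> l (g * h) = l g * l h" "\<And>a. a \<in> A j \<Longrightarrow> l a = 1"
      using Q.scale by blast
    show ?case
    proof (cases "\<forall>h\<in>H. l h = 1")
      case True
      obtain \<theta> where q: "qhom (A (Suc j)) (A j) \<theta>"
        using qA step(2) by blast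
      have sub: "A j \<subseteq> A (Suc j)"
        using qhomD(3)[OF q] by blast
      have tr: "\<phi> (h * a * iv h) = \<phi> a" if "h \<in> H" "a \<in> A j" for h a
        using l(2)[OF that] True that by simp
      have "St (Suc j)"
        unfolding St_def using Q.climb_step[OF tr sA[OF j(2)] sub AH nA[OF j(2)] q] sub st(1) by blast
      then show ?thesis
        using step(3) by blast
    next
      case False
      then obtain h where h: "h \<in> H" "l h \<noteq> 1"
        by blast
      have ls: "l (iv h) = inverse (l h)" "l (h ^ k) = l h ^ k" if "h \<in> H" for h k
        using mult_hom_simps(2,3)[of H l, OF sH] l(1,3) that by blast+
      obtain g where g: "g \<in> H" "l g < 1"
      proof (cases "l h < 1")
        case False
        then have "l (iv h) < 1"
          using ls(1)[OF h(1)] h(2) by (simp add: inverse_less_1_iff)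
        then show ?thesis
          using that subgrp_iv[OF sH h(1)] by blast
      qed (use h that in blast)
      obtain p where p: "p \<in> A j" "0 < \<phi> p"
        by (rule Q.pos_ex) blast
      \<comment> \<open>Conjugation by powers of the contracting element \<open>g\<close> shrinks
        the value of \<open>p\<close> geometrically.\<close>
      have small: "\<exists>a\<in>A j. 0 < \<phi> a \<and> \<phi> a < e" if e: "0 < e" for e
      proof -
        have "0 < e / \<phi> p"
          using e p by simp
        then obtain k where k: "l g ^ k < e / \<phi> p"
          using real_arch_pow_inv g(2) by blast
        have gk: "g ^ k \<in> H"
          using subgrp_pow[OF sH g(1)] .
        have "\<phi> (g ^ k * p * iv (g ^ k)) = l g ^ k * \<phi> p"
          using l(2)[OF gk p(1)] ls(2)[OF g(1)] by simp
        moreover have "l g ^ k * \<phi> p < e"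
          using k p by (simp add: field_simps)
        moreover have "0 < l g ^ k * \<phi> p"
          using l(1)[OF g(1)] p by simp
        ultimately show ?thesis
          using normal_inD[OF nA[OF j(1)] gk p(1)] by (intro bexI[of _ "g ^ k * p * iv (g ^ k)"]) auto
      qed
      interpret dense_quot H P S "A j" \<phi> l
        by unfold_locales (use l small in auto)
      show ?thesis
        using dense_normal[OF T] .
    qed
  qed
  obtain j where j: "j < n" "A j \<subseteq> S" "\<not> A (Suc j) \<subseteq> S"
  proof -
    have "\<not> A n \<subseteq> S"
      using An SH SsubH by blast
    then obtain j where "j < n" "\<forall>i\<le>j. A i \<subseteq> S" "\<not> A (Suc j) \<subseteq> S"
      using ex_least_nat_less[of "\<lambda>i. \<not> A i \<subseteq> S" n] A0 by auto
    then show ?thesis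
      using that by blast
  qed
  have jn: "j \<le> n" "Suc j \<le> n"
    using j(1) by auto
  obtain \<theta> where q: "qhom (A (Suc j)) (A j) \<theta>"
    using qA[OF j(1)] by blast
  \<comment> \<open>An element of \<open>S\<close> in the new layer would, by rank one and closure
    under roots, pull the whole of \<open>A (Suc j)\<close> into \<open>S\<close>.\<close>
  have e: "A (Suc j) \<inter> S = A j"
  proof
    show "A (Suc j) \<inter> S \<subseteq> A j"
    proof (rule ccontr)
      assume "\<not> A (Suc j) \<inter> S \<subseteq> A j"
      then obtain x where x: "x \<in> A (Suc j)" "x \<in> S" "\<theta> x \<noteq> 0"
        using qhomD(3)[OF q] by blast
      have "y \<in> S" if y: "y \<in> A (Suc j)" for y
      proof -
        obtain k :: nat and i :: int where k: "0 < k" "y ^ k * ipow x (- i) \<in> A j"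
          using qhom_ratio[OF q x(1,3) y] by blast
        then have "y ^ k \<in> S"
          using j(2) subgrp_cancel_right[OF sS subgrp_zp[OF sS x(2)]] by blast
        then show ?thesis
          using cvx_pow[OF c S _ k(1)] y AH by blast
      qed
      then show False
        using j(3) by blast
    qed
    show "A j \<subseteq> A (Suc j) \<inter> S"
      using j(2) qhomD(3)[OF q] by blast
  qed
  have cc: "cone (A (Suc j)) (A (Suc j) \<inter> S) (P \<inter> A (Suc j) - S)"
  proof -
    have "S \<inter> A (Suc j) = A (Suc j) \<inter> S" "(P - S) \<inter> A (Suc j) = P \<inter> A (Suc j) - S"
      by auto
    then show ?thesis
      using cone_restrict[OF cS sA[OF jn(2)] AH] by simp
  qed
  obtain \<phi> where "ohom (A (Suc j)) (A (Suc j) \<inter> S) (P \<inter> A (Suc j) - S) \<phi>"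
    using qhom_oriented[OF _ cc, of \<theta>] q unfolding e by blast
  then have "St (Suc j)"
    unfolding St_def using j(3) nA[OF jn(1)] e by auto
  then show ?thesis
    using climb[OF jn(2)] by blast
qed

section \<open>Isolated orders come from Tararin chains\<close>

lemma cvx_lift:
  assumes "cone H N P" and S: "cvx H N P S" and C: "cvx H S (P - S) C"
  shows "cvx H N P C"
proof -
  note sC = cvx_sg[OF C] and SC = cvx_sub(1)[OF C]
  have "x \<in> C" if xy: "x \<in> P" "y \<in> P" "x * y \<in> C" for x y
  proof (cases "x \<in> S \<or> y \<in> S")
    case True
    then show ?thesis
      using SC xy(3) subgrp_cancel_right[OF sC, of y x] by blast
  next
    case False
    then show ?thesis
      using C xy unfolding cvx_def by blast
  qed
  then show ?thesis
    using C cvx_sub[OF S] unfolding cvx_def by blast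
qed

text \<open>The exponential of a real homomorphism is a positive character.\<close>

lemma tararin_hom_trivial:
  assumes T: "tararin T (Suc k)" and h: "hm (T (Suc k)) \<theta>" and x: "x \<in> T k"
  shows "\<theta> x = 0"
proof -
  have "exp (\<theta> x) = 1"
    by (rule tararin_character[OF T, of "\<lambda>x. exp (\<theta> x)" k]) (use h x in \<open>auto simp: hm_def exp_add\<close>)
  then show ?thesis
    by simp
qed

lemma tararin_extend:
  assumes T: "tararin T (Suc k)" and q: "qhom H (T (Suc k)) \<kappa>" and ne: "H \<noteq> T (Suc k)" and n: "normal_in H (T k)"
    and t: "t \<in> H" "\<And>x. x \<in> T (Suc k) \<Longrightarrow> x \<notin> T k \<Longrightarrow> \<exists>p>0. \<exists>q>0. (t * x * iv t) ^ p * x ^ q \<in> T k"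
  shows "tararin (T(Suc (Suc k) := H)) (Suc (Suc k))"
proof -
  let ?T = "T(Suc (Suc k) := H)"
  have 1: "(\<exists>\<phi>. qhom (?T (Suc j)) (?T j) \<phi>) \<and> ?T (Suc j) \<noteq> ?T j" if "j < Suc (Suc k)" for j
  proof (cases "j = Suc k")
    case True
    then show ?thesis
      using q ne by auto
  next
    case False
    then show ?thesis
      using that T by (simp add: tararin_def)
  qed
  have 2: "normal_in (?T (Suc (Suc j))) (?T j) \<and>
    (\<exists>t\<in>?T (Suc (Suc j)). \<forall>x\<in>?T (Suc j) - ?T j. \<exists>p>0. \<exists>q>0. (t * x * iv t) ^ p * x ^ q \<in> ?T j)"
    if "Suc j < Suc (Suc k)" for j
  proof (cases "j = k")
    case True
    then show ?thesis
      using n t by auto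
  next
    case False
    then have j: "j < k"
      using that by simp
    then have e: "?T j = T j" "?T (Suc j) = T (Suc j)" "?T (Suc (Suc j)) = T (Suc (Suc j))"
      by auto
    show ?thesis
      unfolding e using T j by (auto simp: tararin_def)
  qed
  have "?T 0 = {1}"
    using tararin_zero[OF T] by simp
  then show ?thesis
    unfolding tararin_def using 1 2 by blast
qed

text \<open>The induction removes the largest proper convex subgroup \<open>S\<close>, so only the
  new top jump and its action on the jump below remain to be examined.\<close>

theorem isolated_tararin:
  assumes r: "rseries G X n" and nX: "\<And>i. i \<le> n \<Longrightarrow> normal_in G (X i)"
  shows "H \<subseteq> G \<Longrightarrow> isolated H {1} P \<Longrightarrow> \<exists>T m. tararin T m \<and> T m = H"
proof (induction "card {S. cvx H {1} P S}" arbitrary: H P rule: less_induct)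
  case less
  note HG = less(2) and i = less(3)
  note c = isolated_cone[OF i]
  note fc = rseries_finite_convex[OF r HG c]
  show ?case
  proof (cases "H = {1}")
    case True
    then show ?thesis
      by (intro exI[of _ "\<lambda>_. {1}"] exI[of _ 0]) (simp add: tararin_def)
  next
    case False
    obtain S where mx: "cvx H {1} P S" "S \<noteq> H" "\<And>D. cvx H {1} P D \<Longrightarrow> D \<subseteq> S \<or> D = H"
      using max_convex[OF c fc False] by blast
    interpret max_cvx H P S
      by unfold_locales (use i mx in auto)
    have SH': "S \<subseteq> H"
      using cvx_sub(2)[OF mx(1)] .
    note iS = isolated_below[OF i mx(1)]
    have "{D. cvx S {1} (P \<inter> S) D} \<subset> {D. cvx H {1} P D}"
    proof
      show "{D. cvx S {1} (P \<inter> S) D} \<subseteq> {D. cvx H {1} P D}"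
        using cvx_trans[OF c mx(1)] by blast
      have "H \<notin> {D. cvx S {1} (P \<inter> S) D}"
        using mx(2) SH' cvx_sub(2)[of S "{1}" "P \<inter> S" H] by blast
      then show "{D. cvx S {1} (P \<inter> S) D} \<noteq> {D. cvx H {1} P D}"
        using cvx_self[OF c] by blast
    qed
    then have "card {D. cvx S {1} (P \<inter> S) D} < card {D. cvx H {1} P D}"
      using psubset_card_mono[OF fc] by blast
    moreover have "S \<subseteq> G"
      using SH' HG by blast
    ultimately obtain T m where T: "tararin T m" "T m = S"
      using less(1) iS by blast
    have nS: "normal_in H S"
      by (rule convex_normal[OF r nX HG T])
    have "\<exists>\<kappa>. ohom H S (P - S) \<kappa> \<and> \<kappa> ` H \<subseteq> \<rat>"
    proof (rule isolated_simple_rank_one[OF isolated_above[OF i mx(1)] nS])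
      fix C assume C: "cvx H S (P - S) C"
      then show "C = S \<or> C = H"
        using mx(3)[OF cvx_lift[OF c mx(1) C]] cvx_sub(1)[OF C] by blast
    qed
    then obtain \<kappa> where k: "ohom H S (P - S) \<kappa>" "\<kappa> ` H \<subseteq> \<rat>"
      by blast
    then have q: "qhom H S \<kappa>"
      by (simp add: ohom_def qhom_def)
    show ?thesis
    proof (cases m)
      case 0
      then have "S = {1}"
        using T tararin_zero by metis
      then have "tararin (\<lambda>i. if i = 0 then {1} else H) 1"
        using q False by (auto simp: tararin_def)
      then show ?thesis
        by (intro exI[of _ "\<lambda>i. if i = 0 then {1} else H"] exI[of _ 1]) simp
    next
      case (Suc j)
      define N where "N = T j"
      have T': "tararin T (Suc j)" "T (Suc j) = S"
        using T Suc by auto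
      obtain \<phi>0 where q0: "qhom S N \<phi>0"
        using tararin_qhom[OF T'(1)] unfolding T'(2) N_def by blast
      have NS: "N \<subseteq> S"
        using qhomD(3)[OF q0] by blast
      \<comment> \<open>\<open>N\<close> is the kernel of one real homomorphism of \<open>S\<close>
        and lies in the kernel of all of them. This description is invariant under conjugation by
        \<open>H\<close>, which normalizes \<open>S\<close>.\<close>
      have triv: "\<theta> x = 0" if "hm S \<theta>" "x \<in> N" for \<theta> x
        using tararin_hom_trivial[OF T'(1), of \<theta> x] that unfolding T'(2) N_def by blast
      have hmc: "hm S (\<lambda>x. \<phi> (h * x * iv h))" if "hm S \<phi>" "h \<in> H" for \<phi> :: "'a \<Rightarrow> real" and h
        unfolding hm_def
      proof (intro ballI)
        fix x y assume xy: "x \<in> S" "y \<in> S"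
        have e: "h * (x * y) * iv h = (h * x * iv h) * (h * y * iv h)"
          by (simp add: mult.assoc)
        show "\<phi> (h * (x * y) * iv h) = \<phi> (h * x * iv h) + \<phi> (h * y * iv h)"
          unfolding e using hm_mult[OF that(1) normal_inD[OF nS that(2) xy(1)] normal_inD[OF nS that(2) xy(2)]] .
      qed
      have nN: "normal_in H N"
        unfolding normal_in_def
      proof (intro ballI)
        fix h x assume h: "h \<in> H" and x: "x \<in> N"
        have "\<phi>0 (h * x * iv h) = 0"
          using triv[OF hmc[OF qhomD(2)[OF q0] h] x] .
        then show "h * x * iv h \<in> N"
          using qhomD(3)[OF q0] normal_inD[OF nS h] x NS by blast
      qed
      have vN: "cvx H {1} P N"
        using cvx_trans[OF c mx(1)] tararin_convex[OF T'(1), unfolded T'(2), OF cB] unfolding N_def by blast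
      have iN: "isolated H N (P - N)"
        by (rule isolated_above[OF i vN])
      have vS: "cvx H N (P - N) S"
        using mx(1) NS unfolding cvx_def by blast
      have cSN: "cone S N ((P - N) \<inter> S)"
        by (rule cvx_cone_below[OF isolated_cone[OF iN] vS])
      obtain \<phi> where p: "ohom S N ((P - N) \<inter> S) \<phi>" "qhom S N \<phi>"
        using qhom_oriented[OF q0 cSN] .
      have e: "P - N - S = P - S"
        using NS by blast
      obtain b where b: "b \<in> P - S"
        using cone_total[OF cS] mx(2) SH' by blast
      obtain a0 where a0: "a0 \<in> (P - N) \<inter> S"
        using cone_total[OF cSN] tararin_strict[OF T'(1)] NS unfolding T'(2) N_def[symmetric] by blast
      \<comment> \<open>If every conjugation kept the jump \<open>S/N\<close> positive,
        \<open>lex_not_isolated\<close> would contradict isolation of the quotient order.\<close>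
      have "\<exists>t\<in>H. \<exists>a\<in>(P - N) \<inter> S. t * a * iv t \<notin> P - N"
      proof (rule ccontr)
        assume n: "\<not> ?thesis"
        show False
        proof (rule lex_not_isolated[OF iN vS nN p(1) _ q])
          show "ohom H S (P - N - S) \<kappa>"
            unfolding e by (rule k(1))
          show "b \<in> P - N - S" "a0 \<in> (P - N) \<inter> S"
            using b a0 unfolding e by auto
        qed (use n in blast)
      qed
      then obtain t a where t: "t \<in> H" and a: "a \<in> (P - N) \<inter> S" "t * a * iv t \<notin> P - N"
        by blast
      define \<theta> where "\<theta> x = \<phi> (t * x * iv t)" for x
      have h\<theta>: "hm S \<theta>"
        unfolding \<theta>_def by (rule hmc[OF qhomD(2)[OF p(2)] t])
      have aS: "a \<in> S" "0 < \<phi> a"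
        using a(1) ohomD(3)[OF p(1)] by blast+
      have ta: "t * a * iv t \<in> S"
        by (rule normal_inD[OF nS t aS(1)])
      have aN: "t * a * iv t \<notin> N"
        using normal_in_conj_iff[OF nN sH t, of a] a(1) by blast
      have \<theta>a: "\<theta> a < 0"
        using ohomD(3)[OF p(1), of "t * a * iv t"] ohomD(4)[OF p(1), of "t * a * iv t"] ta aN a(2)
        unfolding \<theta>_def by (meson IntI linorder_neqE_linordered_idom Int_iff)
      \<comment> \<open>The conjugated homomorphism kills \<open>N\<close>, so it is a multiple of
        \<phi>; the negative sign at \<open>a\<close> therefore holds throughout, and one
        \<open>t\<close> serves for all \<open>x\<close>.\<close>
      define w where "w = \<theta> a / \<phi> a"
      have w: "w < 0"
        unfolding w_def using \<theta>a aS by (simp add: divide_neg_pos)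
      have \<theta>w: "\<theta> x = w * \<phi> x" if "x \<in> S" for x
        using hm_vanishing[OF p(2) aS(1) _ h\<theta> triv[OF h\<theta>] that] aS(2) by (simp add: w_def)
      have neg: "\<exists>p>0. \<exists>q>0. (t * x * iv t) ^ p * x ^ q \<in> N" if x: "x \<in> S" "x \<notin> N" for x
      proof -
        have tx: "t * x * iv t \<in> S"
          by (rule normal_inD[OF nS t x(1)])
        have rat: "\<theta> x \<in> \<rat>" "\<phi> x \<in> \<rat>"
          unfolding \<theta>_def using qhomD(4)[OF p(2)] tx x(1) by auto
        have "\<phi> x \<noteq> 0"
          using x qhomD(3)[OF p(2)] by blast
        then consider "0 < \<phi> x" "\<theta> x < 0" | "\<phi> x < 0" "0 < \<theta> x"
          using \<theta>w[OF x(1)] w by (auto simp: mult_neg_pos mult_neg_neg neq_iff)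
        then obtain m n :: nat where mn: "0 < m" "0 < n" "real m * \<theta> x + real n * \<phi> x = 0"
        proof cases
          case 1
          show ?thesis
            by (rule rats_opposite[OF rat(2,1) 1]) (use that in \<open>simp add: add.commute\<close>)
        next
          case 2
          show ?thesis
            by (rule rats_opposite[OF rat(1,2) 2(2,1)]) (use that in simp)
        qed
        have "\<phi> ((t * x * iv t) ^ m * x ^ n) = real m * \<theta> x + real n * \<phi> x"
          using hm_mult[OF qhomD(2)[OF p(2)] subgrp_pow[OF sS tx] subgrp_pow[OF sS x(1)]]
            hm_pow[OF qhomD(2)[OF p(2)] sS tx] hm_pow[OF qhomD(2)[OF p(2)] sS x(1)]
          unfolding \<theta>_def by simp
        then have "(t * x * iv t) ^ m * x ^ n \<in> N"
          using mn(3) qhomD(3)[OF p(2)] subgrp_mult[OF sS subgrp_pow[OF sS tx] subgrp_pow[OF sS x(1)]] by simp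
        then show ?thesis
          using mn by blast
      qed
      have "tararin (T(Suc (Suc j) := H)) (Suc (Suc j))"
      proof (rule tararin_extend[OF T'(1)])
        show "qhom H (T (Suc j)) \<kappa>" "H \<noteq> T (Suc j)" "normal_in H (T j)"
          using q mx(2) nN unfolding T'(2) N_def by auto
        show "t \<in> H"
          by (rule t)
        show "\<exists>p>0. \<exists>q>0. (t * x * iv t) ^ p * x ^ q \<in> T j" if "x \<in> T (Suc j)" "x \<notin> T j" for x
          using neg[of x] that unfolding T'(2) N_def .
      qed
      then show ?thesis
        by (intro exI[of _ "T(Suc (Suc j) := H)"] exI[of _ "Suc (Suc j)"]) simp
    qed
  qed
qed

theorem finite_or_no_isolated:
  assumes G: "subgrp G" and C: "Ccone G P0" and fin: "finite {Q. Ccone G Q}"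
  shows "countable G" "finite {Q. cone G {1} Q} \<or> (\<forall>P. \<not> isolated G {1} P)"
proof -
  obtain n X where X: "rseries G X n" "\<And>i. i \<le> n \<Longrightarrow> normal_in G (X i)"
    using conrad_series[OF G C fin order.refl normal_in_self[OF G]] by blast
  show "countable G"
    by (rule rseries_countable[OF X(1)])
  have "finite {Q. cone G {1} Q}" if i: "isolated G {1} P" for P
  proof -
    obtain T m where "tararin T m" "T m = G"
      using isolated_tararin[OF X order.refl i] by blast
    then show ?thesis
      using tararin_finite by blast
  qed
  then show "finite {Q. cone G {1} Q} \<or> (\<forall>P. \<not> isolated G {1} P)"
    by blast
qed

section \<open>Perfect subsets of a countable power of two points\<close>

lemma enumerate_rank:
  fixes S :: "nat set"
  assumes S: "infinite S"
  shows "card (S \<inter> {..<enumerate S k}) = k"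
proof -
  have "S \<inter> {..<enumerate S k} = enumerate S ` {..<k}"
  proof (intro subset_antisym subsetI)
    fix n assume n: "n \<in> S \<inter> {..<enumerate S k}"
    then obtain j where "n = enumerate S j"
      using enumerate_Ex[OF S, of n] by auto
    then show "n \<in> enumerate S ` {..<k}"
      using n enumerate_mono_iff[OF S] by auto
  next
    fix n assume "n \<in> enumerate S ` {..<k}"
    then show "n \<in> S \<inter> {..<enumerate S k}"
      using enumerate_in_set[OF S] enumerate_mono_iff[OF S] by auto
  qed
  moreover have "inj_on (enumerate S) {..<k}"
    using inj_enumerate[OF S] inj_on_subset by blast
  ultimately show ?thesis
    using card_image[of "enumerate S" "{..<k}"] by simp
qed

lemma enumerate_unique:
  fixes S :: "nat set"
  assumes S: "infinite S" and n: "n \<in> S" "card (S \<inter> {..<n}) = k"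
  shows "enumerate S k = n"
proof -
  obtain j where j: "n = enumerate S j"
    using enumerate_Ex[OF S n(1)] by auto
  then have "j = k"
    using enumerate_rank[OF S, of j] n(2) by simp
  then show ?thesis
    using j by simp
qed

definition ternary :: "(nat \<Rightarrow> bool) \<Rightarrow> real" where
  "ternary s = (\<Sum>n. (if s n then 2 else 0) / 3 ^ Suc n)"

lemma ternary_tail:
  "summable (\<lambda>n. 2 / 3 ^ Suc (n + k) :: real)" "(\<Sum>n. 2 / 3 ^ Suc (n + k) :: real) = 1 / 3 ^ k"
proof -
  have "(\<lambda>n. (2 / 3 ^ Suc k) * (1 / 3) ^ n :: real) sums (2 / 3 ^ Suc k * (1 / (1 - 1 / 3)))"
    by (intro sums_mult geometric_sums) simp
  moreover have "(2 / 3 ^ Suc k) * (1 / 3) ^ n = (2 / 3 ^ Suc (n + k) :: real)" for n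
    by (simp add: power_add power_one_over)
  ultimately have "(\<lambda>n. 2 / 3 ^ Suc (n + k) :: real) sums (1 / 3 ^ k)"
    by simp
  then show "summable (\<lambda>n. 2 / 3 ^ Suc (n + k) :: real)" "(\<Sum>n. 2 / 3 ^ Suc (n + k) :: real) = 1 / 3 ^ k"
    by (auto simp: sums_iff)
qed

lemma ternary_summable: "summable (\<lambda>n. (if s n then 2 else 0) / 3 ^ Suc n :: real)"
  by (rule summable_comparison_test[OF _ ternary_tail(1)[of 0]]) auto

lemma ternary_close:
  assumes "\<And>n. n < k \<Longrightarrow> s n = t n"
  shows "\<bar>ternary s - ternary t\<bar> \<le> 1 / 3 ^ k"
proof -
  define d where "d n = (if s n then 2 else 0) / 3 ^ Suc n - (if t n then 2 else 0 :: real) / 3 ^ Suc n" for n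
  have sd: "summable d"
    unfolding d_def by (rule summable_diff[OF ternary_summable ternary_summable])
  have "ternary s - ternary t = suminf d"
    unfolding ternary_def d_def by (rule suminf_diff[OF ternary_summable ternary_summable])
  also have "\<dots> = (\<Sum>n. d (n + k)) + (\<Sum>i<k. d i)"
    by (rule suminf_split_initial_segment[OF sd])
  also have "(\<Sum>i<k. d i) = 0"
    by (rule sum.neutral) (use assms in \<open>auto simp: d_def\<close>)
  finally have e: "ternary s - ternary t = (\<Sum>n. d (n + k))"
    by simp
  have b: "\<bar>d (n + k)\<bar> \<le> 2 / 3 ^ Suc (n + k)" for n
    by (simp add: d_def)
  have "norm (\<Sum>n. d (n + k)) \<le> (\<Sum>n. 2 / 3 ^ Suc (n + k) :: real)"
    by (rule norm_suminf_le) (use b ternary_tail(1) in auto)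
  then show ?thesis
    unfolding e ternary_tail(2) by simp
qed

text \<open>The first differing digit contributes \<open>2 / 3 ^ Suc k\<close>, whereas all later
  digits together contribute at most half of that. The auxiliary \<open>s'\<close> separates the two
  contributions.\<close>

lemma ternary_inj:
  assumes ne: "s \<noteq> t"
  shows "ternary s \<noteq> ternary t"
proof -
  define k where "k = (LEAST n. s n \<noteq> t n)"
  have ex: "\<exists>n. s n \<noteq> t n"
    using ne by auto
  then have k: "s k \<noteq> t k"
    unfolding k_def by (rule LeastI_ex)
  have lt: "s n = t n" if "n < k" for n
    using not_less_Least[of n "\<lambda>n. s n \<noteq> t n"] that unfolding k_def by blast
  define s' where "s' = s(k := t k)"
  have "\<bar>ternary s' - ternary t\<bar> \<le> 1 / 3 ^ Suc k"
    using lt by (intro ternary_close) (auto simp: s'_def less_Suc_eq)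
  moreover have "\<bar>ternary s - ternary s'\<bar> = 2 * (1 / 3 ^ Suc k)"
  proof -
    have "ternary s - ternary s' = (\<Sum>n. (if s n then 2 else 0) / 3 ^ Suc n - (if s' n then 2 else 0 :: real) / 3 ^ Suc n)"
      unfolding ternary_def by (rule suminf_diff[OF ternary_summable ternary_summable])
    also have "\<dots> = (\<Sum>n\<in>{k}. (if s n then 2 else 0) / 3 ^ Suc n - (if s' n then 2 else 0 :: real) / 3 ^ Suc n)"
      by (rule suminf_finite) (auto simp: s'_def)
    finally show ?thesis
      using k by (auto simp: s'_def)
  qed
  moreover have "(0::real) < 1 / 3 ^ Suc k"
    by simp
  ultimately show ?thesis
    by (intro notI) linarith
qed

lemma cantor_set_ternary: "cantor_set = range ternary"
proof (intro subset_antisym subsetI)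
  fix x assume "x \<in> cantor_set"
  then obtain a :: "nat \<Rightarrow> nat" where a: "\<And>n. a n \<in> {0, 2}" "x = (\<Sum>n. real (a n) / 3 ^ Suc n)"
    by (auto simp: cantor_set_def)
  have "real (a n) / 3 ^ Suc n = (if a n = 2 then 2 else 0) / 3 ^ Suc n" for n
    using a(1)[of n] by auto
  then have "x = ternary (\<lambda>n. a n = 2)"
    unfolding a(2) ternary_def by simp
  then show "x \<in> range ternary"
    by blast
next
  fix x assume "x \<in> range ternary"
  then obtain s where s: "x = ternary s"
    by blast
  have "real (if s n then 2 else 0) / 3 ^ Suc n = (if s n then 2 else 0) / 3 ^ Suc n" for n
    by simp
  then have "x = (\<Sum>n. real (if s n then 2 else 0) / 3 ^ Suc n)"
    unfolding s ternary_def by presburger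
  then show "x \<in> cantor_set"
    unfolding cantor_set_def by (intro CollectI exI[of _ "\<lambda>n. if s n then 2 else 0"]) auto
qed

lemma openin_coordinate:
  assumes "i \<in> I"
  shows "openin (product_topology (\<lambda>_. discrete_topology (UNIV :: bool set)) I)
    {x \<in> topspace (product_topology (\<lambda>_. discrete_topology (UNIV :: bool set)) I). x i = v}"
proof -
  have "continuous_map (product_topology (\<lambda>_. discrete_topology (UNIV :: bool set)) I) (discrete_topology UNIV) (\<lambda>x. x i)"
    using continuous_map_product_projection[OF assms, of "\<lambda>_. discrete_topology (UNIV :: bool set)"] .
  from openin_continuous_map_preimage[OF this, of "{v}"] show ?thesis
    by simp
qed

text \<open>A point \<open>x\<close> of a perfect set \<open>X\<close> is coded by the values of \<open>x\<close> at the coordinates at which \<open>X\<close>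
  branches along \<open>x\<close>.\<close>

theorem perfect_homeomorphic_cantor_set:
  fixes X :: "('i \<Rightarrow> bool) set" and I :: "'i set"
  defines "TT \<equiv> product_topology (\<lambda>_. discrete_topology (UNIV :: bool set)) I"
  assumes I: "countable I" and cl: "closedin TT X" and ne: "X \<noteq> {}"
    and perfect: "\<And>x F. x \<in> X \<Longrightarrow> finite F \<Longrightarrow> F \<subseteq> I \<Longrightarrow> \<exists>y\<in>X. y \<noteq> x \<and> (\<forall>i\<in>F. y i = x i)"
  shows "subtopology TT X homeomorphic_space subtopology euclideanreal cantor_set"
proof -
  have XP: "X \<subseteq> topspace TT"
    using cl closedin_subset by blast
  have tP: "topspace TT = I \<rightarrow>\<^sub>E UNIV"
    by (simp add: TT_def)
  have ext: "x = y" if "x \<in> X" "y \<in> X" "\<And>i. i \<in> I \<Longrightarrow> x i = y i" for x y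
    using that(1,2) XP unfolding tP by (intro PiE_ext[of x I "\<lambda>_. UNIV" y] that(3)) auto
  have Ine: "I \<noteq> {}"
  proof
    assume "I = {}"
    then show False
      using ne perfect[of _ "{}"] ext by blast
  qed
  define e where "e = from_nat_into I"
  have eI: "range e = I"
    unfolding e_def by (rule range_from_nat_into[OF Ine I])
  have eI': "e n \<in> I" for n
    using eI by blast
  define agree where "agree n x y \<longleftrightarrow> (\<forall>k<n. y (e k) = x (e k))" for n :: nat and x y :: "'i \<Rightarrow> bool"
  have agree_sym: "agree n x y \<Longrightarrow> agree n y x" for n x y
    by (auto simp: agree_def)
  have agree_trans: "agree n x y \<Longrightarrow> agree n y z \<Longrightarrow> agree n x z" for n x y z
    by (auto simp: agree_def)
  have agree_mono: "agree n x y \<Longrightarrow> m \<le> n \<Longrightarrow> agree m x y" for m n x y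
    by (auto simp: agree_def)
  \<comment> \<open>The branching levels along \<open>x\<close>: some point of \<open>X\<close>
    follows \<open>x\<close> up to \<open>n\<close> and departs there. Which levels below
    \<open>n\<close> branch depends only on the coordinates below \<open>n\<close>.\<close>
  define B where "B x = {n. \<exists>y\<in>X. agree n x y \<and> y (e n) \<noteq> x (e n)}" for x
  have first: "\<exists>n\<ge>N. agree n x y \<and> y (e n) \<noteq> x (e n)" if xy: "x \<in> X" "y \<in> X" "y \<noteq> x" "agree N x y" for x y N
  proof -
    define n where "n = (LEAST n. y (e n) \<noteq> x (e n))"
    have "\<exists>n. y (e n) \<noteq> x (e n)"
      using ext[OF xy(2,1)] xy(3) eI by (metis imageE)
    then have n: "y (e n) \<noteq> x (e n)"
      unfolding n_def by (rule LeastI_ex)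
    have "agree n x y"
      using not_less_Least[of _ "\<lambda>n. y (e n) \<noteq> x (e n)"] unfolding n_def agree_def by blast
    moreover have "N \<le> n"
      using n xy(4) unfolding agree_def by (meson not_le)
    ultimately show ?thesis
      using n by blast
  qed
  have Binf: "infinite (B x)" if x: "x \<in> X" for x
    unfolding infinite_nat_iff_unbounded_le
  proof
    fix N
    obtain y where y: "y \<in> X" "y \<noteq> x" "\<forall>i\<in>e ` {..<N}. y i = x i"
      using perfect[OF x, of "e ` {..<N}"] eI' by blast
    then have "agree N x y"
      by (auto simp: agree_def)
    then show "\<exists>n\<ge>N. n \<in> B x"
      using first[OF x y(1,2)] y(1) unfolding B_def by blast
  qed
  have Bagree: "B x \<inter> {..<n} = B y \<inter> {..<n}" if a: "agree n x y" for x y n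
  proof -
    have "m \<in> B y" if "m \<in> B x" "m < n" "agree n x y" for m x y
    proof -
      obtain z where z: "z \<in> X" "agree m x z" "z (e m) \<noteq> x (e m)"
        using \<open>m \<in> B x\<close> by (auto simp: B_def)
      have "agree m y z"
        using agree_trans[OF agree_mono[OF agree_sym[OF that(3)]] z(2)] that(2) by simp
      moreover have "y (e m) = x (e m)"
        using that(2,3) by (simp add: agree_def)
      ultimately show ?thesis
        using z by (auto simp: B_def)
    qed
    then show ?thesis
      using a agree_sym[OF a] by blast
  qed
  define b where "b x k = enumerate (B x) k" for x k
  define f where "f x k = x (e (b x k))" for x k
  have bB: "b x k \<in> B x" if "x \<in> X" for x k
    unfolding b_def using enumerate_in_set[OF Binf[OF that]] .
  have b_mono: "j \<le> k \<Longrightarrow> b x j \<le> b x k" if "x \<in> X" for x j k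
    unfolding b_def using enumerate_mono_le_iff[OF Binf[OF that]] by simp
  have b_eq: "b y k = b x k" if xy: "x \<in> X" "y \<in> X" "agree (b x k) x y" "b x k \<in> B y" for x y k
    unfolding b_def
  proof (rule enumerate_unique[OF Binf[OF xy(2)]])
    show "enumerate (B x) k \<in> B y"
      using xy(4) by (simp add: b_def)
    show "card (B y \<inter> {..<enumerate (B x) k}) = k"
      using Bagree[OF xy(3)] enumerate_rank[OF Binf[OF xy(1)], of k] by (simp add: b_def)
  qed
  have f_eq: "f y k = f x k" if xy: "x \<in> X" "y \<in> X" "agree (Suc (b x k)) x y" for x y k
  proof -
    have "b x k \<in> B y"
      using Bagree[OF xy(3)] bB[OF xy(1), of k] by blast
    then have "b y k = b x k"
      using b_eq[OF xy(1,2) agree_mono[OF xy(3)]] by simp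
    then show ?thesis
      using xy(3) by (simp add: f_def agree_def)
  qed
  have f_inj: "f x \<noteq> f y" if xy: "x \<in> X" "y \<in> X" "x \<noteq> y" for x y
  proof -
    obtain n where n: "agree n x y" "y (e n) \<noteq> x (e n)"
      using first[OF xy(1,2), of 0] xy(3) by (auto simp: agree_def)
    \<comment> \<open>The first difference is a branching level of both points, preceded by the same
      branching levels; so it has the same index in both codes.\<close>
    have nB: "n \<in> B x" "n \<in> B y"
      unfolding B_def using xy(1,2) n agree_sym[OF n(1)]
      by (auto intro: bexI[of _ x] bexI[of _ y] simp del: not_ex)
    define k where "k = card (B x \<inter> {..<n})"
    have bx: "b x k = n"
      unfolding b_def by (rule enumerate_unique[OF Binf[OF xy(1)] nB(1)]) (simp add: k_def)
    then have "b y k = n"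
      using b_eq[OF xy(1,2)] n(1) nB(2) by simp
    then have "f x k \<noteq> f y k"
      using bx n(2) by (simp add: f_def)
    then show ?thesis
      by metis
  qed
  \<comment> \<open>Departing from \<open>x\<close> at its \<open>k\<close>-th branching level
    changes the code at \<open>k\<close> and preserves it before \<open>k\<close>, so every finite
    prefix is realized.\<close>
  have f_dense: "\<exists>x\<in>X. \<forall>i<k. f x i = s i" for s k
  proof (induction k)
    case 0
    then show ?case
      using ne by auto
  next
    case (Suc k)
    then obtain x where x: "x \<in> X" "\<And>i. i < k \<Longrightarrow> f x i = s i"
      by blast
    show ?case
    proof (cases "f x k = s k")
      case True
      then show ?thesis
        using x by (auto simp: less_Suc_eq)
    next
      case False
      obtain y where y: "y \<in> X" "agree (b x k) x y" "y (e (b x k)) \<noteq> x (e (b x k))"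
        using bB[OF x(1), of k] by (auto simp: B_def)
      have "f y i = s i" if i: "i < k" for i
      proof -
        have "b x i < b x k"
          unfolding b_def using enumerate_mono[OF i Binf[OF x(1)]] .
        then have "f y i = f x i"
          using f_eq[OF x(1) y(1)] agree_mono[OF y(2)] by simp
        then show ?thesis
          using x(2)[OF i] by simp
      qed
      moreover have "f y k = s k"
      proof -
        have "b x k \<in> B y"
          unfolding B_def using x(1) agree_sym[OF y(2)] y(3) by (intro CollectI bexI[of _ x]) auto
        then have "b y k = b x k"
          using b_eq[OF x(1) y(1,2)] by simp
        then show ?thesis
          using y(3) False by (auto simp: f_def)
      qed
      ultimately show ?thesis
        using y(1) by (auto simp: less_Suc_eq)
    qed
  qed
  define h where "h x = ternary (f x)" for x
  have op: "openin TT {y \<in> topspace TT. agree n x y}" for n x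
  proof (induction n)
    case 0
    then show ?case
      by (simp add: agree_def)
  next
    case (Suc n)
    have e: "{y \<in> topspace TT. agree (Suc n) x y} = {y \<in> topspace TT. agree n x y} \<inter> {y \<in> topspace TT. y (e n) = x (e n)}"
      by (auto simp: agree_def less_Suc_eq)
    show ?case
      unfolding e by (rule openin_Int[OF Suc openin_coordinate[OF eI', folded TT_def]])
  qed
  have small: "\<exists>k. 1 / 3 ^ k < \<epsilon>" if "0 < \<epsilon>" for \<epsilon> :: real
    using real_arch_pow_inv[OF that, of "1 / 3"] by (auto simp: power_one_over)
  have top: "topspace (subtopology TT X) = X"
    using XP by auto
  have cont: "continuous_map (subtopology TT X) euclideanreal h"
    unfolding continuous_map_eq_topcontinuous_at topcontinuous_at_def
  proof (intro ballI conjI allI impI)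
    fix x V assume xt: "x \<in> topspace (subtopology TT X)" and V: "openin euclideanreal V \<and> h x \<in> V"
    have x: "x \<in> X"
      using xt top by blast
    obtain \<epsilon> where \<epsilon>: "0 < \<epsilon>" "\<And>r. \<bar>r - h x\<bar> < \<epsilon> \<Longrightarrow> r \<in> V"
      using V unfolding open_openin[symmetric] open_dist dist_real_def by blast
    obtain k where k: "1 / 3 ^ k < \<epsilon>"
      using small[OF \<epsilon>(1)] by blast
    let ?U = "{y \<in> topspace TT. agree (Suc (b x k)) x y} \<inter> X"
    have "openin (subtopology TT X) ?U"
      using op by (auto simp: openin_subtopology)
    moreover have "x \<in> ?U"
      using x XP by (auto simp: agree_def)
    moreover have "h y \<in> V" if y: "y \<in> ?U" for y
    proof -
      have "f y i = f x i" if "i < k" for i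
      proof (rule f_eq[OF x])
        have "Suc (b x i) \<le> Suc (b x k)"
          using b_mono[OF x, of i k] that by simp
        moreover have "agree (Suc (b x k)) x y"
          using y by blast
        ultimately show "agree (Suc (b x i)) x y"
          by (rule agree_mono[rotated])
        show "y \<in> X"
          using y by blast
      qed
      then have "\<bar>h y - h x\<bar> \<le> 1 / 3 ^ k"
        unfolding h_def by (intro ternary_close)
      then show ?thesis
        using k by (intro \<epsilon>(2)) linarith
    qed
    ultimately show "\<exists>U. openin (subtopology TT X) U \<and> x \<in> U \<and> (\<forall>y\<in>U. h y \<in> V)"
      by blast
  qed auto
  have "compact_space TT"
    unfolding TT_def by (simp add: compact_space_product_topology compact_space_discrete_topology)
  then have comp: "compact_space (subtopology TT X)"
    using closedin_compact_space[OF _ cl] compact_space_subtopology by blast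
  have img: "h ` X = cantor_set"
  proof
    show "h ` X \<subseteq> cantor_set"
      unfolding cantor_set_ternary h_def by blast
    have "compactin (subtopology TT X) X"
      using comp unfolding compact_space_def top .
    then have "compactin euclideanreal (h ` X)"
      by (rule image_compactin[OF _ cont])
    then have clos: "closed (h ` X)"
      by (simp add: compact_imp_closed)
    show "cantor_set \<subseteq> h ` X"
    proof
      fix v assume "v \<in> cantor_set"
      then obtain s where s: "v = ternary s"
        unfolding cantor_set_ternary by blast
      \<comment> \<open>Prefixes approximate \<open>v\<close>, and the image of the compact set
        \<open>X\<close> is closed, so density already gives surjectivity.\<close>
      have "v \<in> closure (h ` X)"
        unfolding closure_approachable
      proof (intro allI impI)
        fix \<epsilon> :: real assume "0 < \<epsilon>"
        then obtain k where k: "1 / 3 ^ k < \<epsilon>"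
          using small by blast
        obtain x where x: "x \<in> X" "\<forall>i<k. f x i = s i"
          using f_dense by blast
        have "\<bar>h x - v\<bar> \<le> 1 / 3 ^ k"
          unfolding h_def s using x(2) by (intro ternary_close) auto
        then show "\<exists>y\<in>h ` X. dist y v < \<epsilon>"
          using x(1) k by (intro bexI[of _ "h x"]) (auto simp: dist_real_def)
      qed
      then show "v \<in> h ` X"
        using clos by simp
    qed
  qed
  have "homeomorphic_map (subtopology TT X) (subtopology euclideanreal cantor_set) h"
  proof (rule continuous_imp_homeomorphic_map)
    show "continuous_map (subtopology TT X) (subtopology euclideanreal cantor_set) h"
      using cont img by (auto simp: continuous_map_in_subtopology top)
    show "Hausdorff_space (subtopology euclideanreal cantor_set)"
      by (simp add: Hausdorff_space_subtopology)
    show "inj_on h (topspace (subtopology TT X))"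
      unfolding top h_def by (rule inj_onI) (use f_inj ternary_inj in blast)
    show "h ` topspace (subtopology TT X) = topspace (subtopology euclideanreal cantor_set)"
      unfolding top img by simp
  qed (rule comp)
  then show ?thesis
    by (rule homeomorphic_map_imp_homeomorphic_space)
qed

section \<open>Orders of a group as cones of permutations\<close>

text \<open>A group embeds into the permutations of its type, which form an instance of \<^class>\<open>grp\<close>; this
  makes the preceding results, stated without carriers, available for groups given by records.\<close>

typedef 'a perm = "{f :: 'a \<Rightarrow> 'a. bij f}"
  by (rule exI[of _ id]) simp

setup_lifting type_definition_perm

instantiation perm :: (type) grp
begin

lift_definition one_perm :: "'a perm" is id
  by simp

lift_definition times_perm :: "'a perm \<Rightarrow> 'a perm \<Rightarrow> 'a perm" is "(\<circ>)"
  by (rule bij_comp)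

lift_definition iv_perm :: "'a perm \<Rightarrow> 'a perm" is "inv_into UNIV"
  by (rule bij_imp_bij_inv)

instance
  by standard (transfer; auto simp: bij_def fun_eq_iff)+

end

context group
begin

text \<open>Extended by the identity outside the carrier, so that it is a bijection of the whole
  type; evaluation at the unit recovers \<open>g\<close>.\<close>

definition translation :: "'a \<Rightarrow> 'a \<Rightarrow> 'a" where
  "translation g x = (if x \<in> carrier G then g \<otimes> x else x)"

lemma translation_comp: "g \<in> carrier G \<Longrightarrow> h \<in> carrier G \<Longrightarrow> translation g \<circ> translation h = translation (g \<otimes> h)"
  by (auto simp: translation_def fun_eq_iff m_assoc)

lemma translation_one: "translation \<one> = id"
  by (auto simp: translation_def fun_eq_iff)

lemma translation_at_one: "g \<in> carrier G \<Longrightarrow> translation g \<one> = g"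
  by (simp add: translation_def)

lemma translation_bij: "g \<in> carrier G \<Longrightarrow> bij (translation g)"
  by (rule o_bij[of "translation (inv g)"]) (simp_all add: translation_comp translation_one)

definition emb :: "'a \<Rightarrow> 'a perm" where
  "emb g = Abs_perm (translation g)"

lemma Rep_emb: "g \<in> carrier G \<Longrightarrow> Rep_perm (emb g) = translation g"
  by (simp add: emb_def Abs_perm_inverse translation_bij)

lemma emb_mult:
  assumes "g \<in> carrier G" "h \<in> carrier G"
  shows "emb (g \<otimes> h) = emb g * emb h"
  using assms Rep_emb[OF m_closed[OF assms]]
  by (simp add: times_perm.rep_eq Rep_emb translation_comp flip: Rep_perm_inject)

lemma emb_one: "emb \<one> = 1"
  using Rep_emb[OF one_closed] by (simp add: one_perm.rep_eq translation_one flip: Rep_perm_inject)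

lemma emb_inv: "g \<in> carrier G \<Longrightarrow> emb (inv g) = iv (emb g)"
  using emb_mult[of g "inv g"] by (simp add: emb_one) (metis iv_mult_cancel mult_1_right)

lemma emb_inj: "g \<in> carrier G \<Longrightarrow> h \<in> carrier G \<Longrightarrow> emb g = emb h \<longleftrightarrow> g = h"
  using Rep_emb[of g] Rep_emb[of h] translation_at_one[of g] translation_at_one[of h] by metis

lemma emb_pow: "g \<in> carrier G \<Longrightarrow> emb (g [^] (n::nat)) = emb g ^ n"
  by (induction n) (simp_all add: emb_one emb_mult power_commutes)

definition E :: "'a perm set" where
  "E = emb ` carrier G"

lemma subgrp_E: "subgrp E"
  unfolding subgrp_def
proof (intro conjI ballI)
  show "1 \<in> E"
    using imageI[OF one_closed, of emb] by (simp add: E_def emb_one)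
  fix x assume "x \<in> E"
  then obtain g where g: "g \<in> carrier G" "x = emb g"
    by (auto simp: E_def)
  show "iv x \<in> E"
    using imageI[OF inv_closed[OF g(1)], of emb] by (simp add: E_def emb_inv g)
  fix y assume "y \<in> E"
  then obtain h where h: "h \<in> carrier G" "y = emb h"
    by (auto simp: E_def)
  show "x * y \<in> E"
    using imageI[OF m_closed[OF g(1) h(1)], of emb] by (simp add: E_def emb_mult g h)
qed

definition rel_of :: "'a perm set \<Rightarrow> 'a rel" where
  "rel_of P = {(g, h). g \<in> carrier G \<and> h \<in> carrier G \<and> (g = h \<or> iv (emb g) * emb h \<in> P)}"

definition cone_of :: "'a rel \<Rightarrow> 'a perm set" where
  "cone_of r = {emb g | g. g \<in> carrier G \<and> strictly r \<one> g}"

lemma cone_of_iff: "g \<in> carrier G \<Longrightarrow> emb g \<in> cone_of r \<longleftrightarrow> strictly r \<one> g"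
  unfolding cone_of_def using emb_inj by blast

lemma left_ordering_D:
  assumes "left_ordering G r"
  shows "\<And>g h. (g, h) \<in> r \<Longrightarrow> g \<in> carrier G \<and> h \<in> carrier G"
    "\<And>g. g \<in> carrier G \<Longrightarrow> (g, g) \<in> r" "\<And>g h k. (g, h) \<in> r \<Longrightarrow> (h, k) \<in> r \<Longrightarrow> (g, k) \<in> r"
    "\<And>g h. (g, h) \<in> r \<Longrightarrow> (h, g) \<in> r \<Longrightarrow> g = h"
    "\<And>g h. g \<in> carrier G \<Longrightarrow> h \<in> carrier G \<Longrightarrow> (g, h) \<in> r \<or> (h, g) \<in> r"
    "\<And>f g h. f \<in> carrier G \<Longrightarrow> (g, h) \<in> r \<Longrightarrow> (f \<otimes> g, f \<otimes> h) \<in> r"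
proof -
  have po: "r \<subseteq> carrier G \<times> carrier G" "refl_on (carrier G) r" "trans r" "antisym r" "total_on (carrier G) r"
    using assms by (auto simp: left_ordering_def partial_order_on_def preorder_on_def)
  show 1: "\<And>g h. (g, h) \<in> r \<Longrightarrow> g \<in> carrier G \<and> h \<in> carrier G"
    using po(1) by blast
  show 2: "\<And>g. g \<in> carrier G \<Longrightarrow> (g, g) \<in> r"
    using po(2) by (auto simp: refl_on_def)
  show "\<And>g h k. (g, h) \<in> r \<Longrightarrow> (h, k) \<in> r \<Longrightarrow> (g, k) \<in> r"
    using po(3) by (auto dest: transD)
  show "\<And>g h. (g, h) \<in> r \<Longrightarrow> (h, g) \<in> r \<Longrightarrow> g = h"
    using po(4) by (auto dest: antisymD)
  show "\<And>g h. g \<in> carrier G \<Longrightarrow> h \<in> carrier G \<Longrightarrow> (g, h) \<in> r \<or> (h, g) \<in> r"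
    using po(5) 2 unfolding total_on_def by metis
  show "\<And>f g h. f \<in> carrier G \<Longrightarrow> (g, h) \<in> r \<Longrightarrow> (f \<otimes> g, f \<otimes> h) \<in> r"
    using assms 1 unfolding left_ordering_def by blast
qed

lemma cone_cone_of:
  assumes r: "left_ordering G r"
  shows "cone E {1} (cone_of r)"
proof (rule coneI)
  note D = left_ordering_D[OF r]
  show "subgrp E" "subgrp {1 :: 'a perm}" "{1} \<subseteq> E"
    using subgrp_E subgrp_triv subgrp_one[OF subgrp_E] by auto
  show "cone_of r \<subseteq> E"
    by (auto simp: cone_of_def E_def)
  show "x \<notin> {1}" if "x \<in> cone_of r" for x
  proof -
    have "emb \<one> \<notin> cone_of r"
      using cone_of_iff[OF one_closed] by (simp add: strictly_def)
    then show ?thesis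
      using that by (auto simp: emb_one)
  qed
  show "x * y \<in> cone_of r" if xy: "x \<in> cone_of r" "y \<in> cone_of r" for x y
  proof -
    obtain g h where g: "g \<in> carrier G" "x = emb g" "strictly r \<one> g"
      and h: "h \<in> carrier G" "y = emb h" "strictly r \<one> h"
      using xy by (auto simp: cone_of_def)
    have "(g \<otimes> \<one>, g \<otimes> h) \<in> r"
      using D(6)[OF g(1)] h(3) by (simp add: strictly_def)
    then have 1: "(g, g \<otimes> h) \<in> r"
      using g by simp
    then have "(\<one>, g \<otimes> h) \<in> r"
      using D(3) g(3) by (auto simp: strictly_def)
    moreover have "\<one> \<noteq> g \<otimes> h"
      using D(4)[OF 1] g(3) by (auto simp: strictly_def)
    ultimately have "strictly r \<one> (g \<otimes> h)"
      by (simp add: strictly_def)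
    then show ?thesis
      using g h cone_of_iff[OF m_closed[OF g(1) h(1)]] by (simp add: emb_mult)
  qed
  show "x \<in> cone_of r \<or> x \<in> {1} \<or> iv x \<in> cone_of r" if x: "x \<in> E" for x
  proof -
    obtain g where g: "g \<in> carrier G" "x = emb g"
      using x by (auto simp: E_def)
    have e: "iv x = emb (inv g)"
      using g by (simp add: emb_inv)
    consider "(\<one>, g) \<in> r" | "(g, \<one>) \<in> r"
      using D(5)[OF one_closed g(1)] by blast
    then show ?thesis
    proof cases
      case 1
      then show ?thesis
        using g cone_of_iff[OF g(1)] emb_one by (cases "g = \<one>") (auto simp: strictly_def)
    next
      case 2
      then have "(inv g \<otimes> g, inv g \<otimes> \<one>) \<in> r"
        using D(6) g by blast
      then have "(\<one>, inv g) \<in> r"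
        using g by simp
      moreover have "\<one> \<noteq> inv g" if "g \<noteq> \<one>"
        using that g(1) by (metis inv_inv inv_one)
      ultimately have "g \<noteq> \<one> \<Longrightarrow> iv x \<in> cone_of r"
        unfolding e using cone_of_iff[OF inv_closed[OF g(1)]] by (simp only: strictly_def) blast
      then show ?thesis
        using g(2) emb_one by blast
    qed
  qed
qed

lemma rel_of_less:
  assumes c: "cone E {1} P" and g: "g \<in> carrier G" and h: "h \<in> carrier G"
  shows "strictly (rel_of P) g h \<longleftrightarrow> iv (emb g) * emb h \<in> P"
proof -
  have "g \<noteq> h" if "iv (emb g) * emb h \<in> P"
    using cone_disj[OF c that] by auto
  then show ?thesis
    using g h by (auto simp: strictly_def rel_of_def)
qed

lemma rel_of_pos:
  assumes c: "cone E {1} P" and g: "g \<in> carrier G"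
  shows "strictly (rel_of P) \<one> g \<longleftrightarrow> emb g \<in> P"
  using rel_of_less[OF c one_closed g] by (simp add: emb_one)

lemma rel_of_left_ordering:
  assumes c: "cone E {1} P"
  shows "left_ordering G (rel_of P)"
proof -
  have EI: "emb g \<in> E" if "g \<in> carrier G" for g
    using that by (simp add: E_def)
  have tr: "iv x * z \<in> P" if "iv x * y \<in> P" "iv y * z \<in> P" for x y z :: "'a perm"
    using cone_mult[OF c that] by (simp add: mult.assoc)
  have "trans (rel_of P)"
    by (rule transI) (auto simp: rel_of_def intro: tr)
  moreover have "antisym (rel_of P)"
  proof (rule antisymI)
    fix g h assume gh: "(g, h) \<in> rel_of P" "(h, g) \<in> rel_of P"
    show "g = h"
    proof (rule ccontr)
      assume "g \<noteq> h"
      then have "iv (emb g) * emb h \<in> P" "iv (emb h) * emb g \<in> P"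
        using gh by (auto simp: rel_of_def)
      then show False
        using cone_iv[OF c, of "iv (emb g) * emb h"] by simp
    qed
  qed
  moreover have "total_on (carrier G) (rel_of P)"
    unfolding total_on_def
  proof (intro ballI impI)
    fix g h assume gh: "g \<in> carrier G" "h \<in> carrier G" "g \<noteq> h"
    have "iv (emb g) * emb h \<in> E"
      using gh EI subgrp_E by (auto intro: subgrp_mult subgrp_iv)
    moreover have "iv (emb g) * emb h \<noteq> 1"
      using gh by (simp add: iv_mult_eq_one emb_inj)
    ultimately have "iv (emb g) * emb h \<in> P \<or> iv (emb h) * emb g \<in> P"
      using cone_total[OF c, of "iv (emb g) * emb h"] by simp
    then show "(g, h) \<in> rel_of P \<or> (h, g) \<in> rel_of P"
      using gh by (auto simp: rel_of_def)
  qed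
  moreover have "rel_of P \<subseteq> carrier G \<times> carrier G" "refl_on (carrier G) (rel_of P)"
    by (auto simp: rel_of_def refl_on_def)
  moreover have "(f \<otimes> g, f \<otimes> h) \<in> rel_of P" if "f \<in> carrier G" "(g, h) \<in> rel_of P" for f g h
    using that by (auto simp: rel_of_def emb_mult mult.assoc)
  ultimately show ?thesis
    unfolding left_ordering_def partial_order_on_def preorder_on_def by blast
qed

lemma rel_of_inj:
  assumes "cone E {1} P" "cone E {1} Q" "rel_of P = rel_of Q"
  shows "P = Q"
proof -
  have "emb g \<in> P \<longleftrightarrow> emb g \<in> Q" if "g \<in> carrier G" for g
    using rel_of_pos[OF assms(1) that] rel_of_pos[OF assms(2) that] assms(3) by simp
  then show ?thesis
    using cone_sub(2)[OF assms(1)] cone_sub(2)[OF assms(2)] unfolding E_def by blast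
qed

lemma Ccone_cone_of:
  assumes r: "C_ordering G r"
  shows "Ccone E (cone_of r)"
  unfolding Ccone_def
proof (intro conjI ballI)
  have l: "left_ordering G r"
    using r by (simp add: C_ordering_def)
  show "cone E {1} (cone_of r)"
    by (rule cone_cone_of[OF l])
  fix x y assume xy: "x \<in> cone_of r" "y \<in> cone_of r"
  obtain f g where f: "f \<in> carrier G" "x = emb f" "strictly r \<one> f"
    and g: "g \<in> carrier G" "y = emb g" "strictly r \<one> g"
    using xy by (auto simp: cone_of_def)
  obtain n :: nat where n: "1 \<le> n" "strictly r g (f \<otimes> g [^] n)"
    using r f g unfolding C_ordering_def by blast
  let ?k = "f \<otimes> g [^] n"
  have k: "?k \<in> carrier G"
    using f g by simp
  have "(inv g \<otimes> g, inv g \<otimes> ?k) \<in> r"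
    using left_ordering_D(6)[OF l inv_closed[OF g(1)]] n(2) by (simp add: strictly_def)
  then have "(\<one>, inv g \<otimes> ?k) \<in> r"
    using g by simp
  moreover have "\<one> \<noteq> inv g \<otimes> ?k"
  proof
    assume "\<one> = inv g \<otimes> ?k"
    then have "g \<otimes> \<one> = g \<otimes> (inv g \<otimes> ?k)"
      by simp
    also have "\<dots> = ?k"
      using g(1) k by (simp flip: m_assoc)
    finally show False
      using n(2) g(1) by (simp add: strictly_def)
  qed
  ultimately have "strictly r \<one> (inv g \<otimes> ?k)"
    by (simp add: strictly_def)
  then have "emb (inv g \<otimes> ?k) \<in> cone_of r"
    using cone_of_iff[of "inv g \<otimes> ?k"] g k by simp
  then show "\<exists>n\<ge>1. iv y * x * y ^ n \<in> cone_of r"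
    using n(1) f(1,2) g(1,2) by (intro exI[of _ n]) (simp add: emb_mult emb_inv emb_pow mult.assoc)
qed

lemma rel_of_C_ordering:
  assumes C: "Ccone E P"
  shows "C_ordering G (rel_of P)"
  unfolding C_ordering_def
proof (intro conjI ballI impI)
  note c = Ccone_cone[OF C]
  show "left_ordering G (rel_of P)"
    by (rule rel_of_left_ordering[OF c])
  fix f g assume fg: "f \<in> carrier G" "g \<in> carrier G" "strictly (rel_of P) \<one> f \<and> strictly (rel_of P) \<one> g"
  then have "emb f \<in> P" "emb g \<in> P"
    using rel_of_pos[OF c] by auto
  then obtain n :: nat where n: "1 \<le> n" "iv (emb g) * emb f * emb g ^ n \<in> P"
    using C unfolding Ccone_def by blast
  have k: "g [^] n \<in> carrier G" "f \<otimes> g [^] n \<in> carrier G"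
    using fg by auto
  have e: "emb (f \<otimes> g [^] n) = emb f * emb g ^ n"
    using emb_mult[OF fg(1) k(1)] emb_pow[OF fg(2)] by simp
  have "iv (emb g) * emb (f \<otimes> g [^] n) \<in> P"
    unfolding e using n(2) by (simp only: mult.assoc)
  then have "strictly (rel_of P) g (f \<otimes> g [^] n)"
    using rel_of_less[OF c fg(2) k(2)] by blast
  then show "\<exists>n::nat. n \<ge> 1 \<and> strictly (rel_of P) g (f \<otimes> g [^] n)"
    using n(1) by blast
qed

definition char :: "'a perm set \<Rightarrow> 'a \<Rightarrow> bool" where
  "char P = (\<lambda>g\<in>carrier G. emb g \<in> P)"

lemma pos_char_image: "pos_char G ` {r. left_ordering G r} = char ` {P. cone E {1} P}"
proof (intro subset_antisym subsetI)
  fix x assume "x \<in> pos_char G ` {r. left_ordering G r}"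
  then obtain r where r: "left_ordering G r" "x = pos_char G r"
    by blast
  have "x = char (cone_of r)"
    unfolding r(2) pos_char_def char_def by (rule restrict_ext) (simp add: cone_of_iff)
  then show "x \<in> char ` {P. cone E {1} P}"
    using cone_cone_of[OF r(1)] by blast
next
  fix x assume "x \<in> char ` {P. cone E {1} P}"
  then obtain P where P: "cone E {1} P" "x = char P"
    by blast
  have "x = pos_char G (rel_of P)"
    unfolding P(2) pos_char_def char_def by (rule restrict_ext) (simp add: rel_of_pos[OF P(1)])
  then show "x \<in> pos_char G ` {r. left_ordering G r}"
    using rel_of_left_ordering[OF P(1)] by blast
qed

text \<open>Each condition involves finitely many coordinates, which makes the set closed in the
  product. That \<open>g\<close> and \<open>inv g\<close> are not both positive follows from closure
  under products and the value at the unit.\<close>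

lemma char_image_iff:
  "x \<in> char ` {P. cone E {1} P} \<longleftrightarrow> x \<in> carrier G \<rightarrow>\<^sub>E UNIV \<and> \<not> x \<one> \<and>
     (\<forall>g\<in>carrier G. x g \<longrightarrow> (\<forall>h\<in>carrier G. x h \<longrightarrow> x (g \<otimes> h))) \<and> (\<forall>g\<in>carrier G - {\<one>}. x g \<or> x (inv g))"
  (is "?L \<longleftrightarrow> ?R")
proof
  assume ?L
  then obtain P where c: "cone E {1} P" and x: "x = char P"
    by blast
  have "emb g \<in> P \<or> emb (inv g) \<in> P" if "g \<in> carrier G" "g \<noteq> \<one>" for g
  proof -
    have "emb g \<noteq> 1"
      using that emb_inj[OF that(1) one_closed] by (simp add: emb_one)
    then show ?thesis
      using cone_total[OF c, of "emb g"] that by (simp add: E_def emb_inv)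
  qed
  moreover have "emb \<one> \<notin> P"
    using cone_disj[OF c, of "emb \<one>"] by (auto simp: emb_one)
  moreover have "emb (g \<otimes> h) \<in> P" if "g \<in> carrier G" "h \<in> carrier G" "emb g \<in> P" "emb h \<in> P" for g h
    using cone_mult[OF c that(3,4)] that(1,2) by (simp add: emb_mult)
  ultimately show ?R
    unfolding x char_def by auto
next
  assume R: ?R
  define P where "P = {emb g | g. g \<in> carrier G \<and> x g}"
  have iff: "emb g \<in> P \<longleftrightarrow> x g" if "g \<in> carrier G" for g
    unfolding P_def using emb_inj that by blast
  have "cone E {1} P"
  proof (rule coneI)
    show "subgrp E" "subgrp {1 :: 'a perm}" "{1} \<subseteq> E"
      using subgrp_E subgrp_triv subgrp_one[OF subgrp_E] by auto
    show "P \<subseteq> E"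
      by (auto simp: P_def E_def)
    show "y \<notin> {1}" if "y \<in> P" for y
      using that iff[OF one_closed] R by (auto simp: emb_one)
    show "y * z \<in> P" if yz: "y \<in> P" "z \<in> P" for y z
    proof -
      obtain g h where gh: "g \<in> carrier G" "y = emb g" "x g" "h \<in> carrier G" "z = emb h" "x h"
        using yz unfolding P_def by blast
      then have "x (g \<otimes> h)"
        using R by blast
      then show ?thesis
        using iff[OF m_closed[OF gh(1,4)]] gh by (simp add: emb_mult)
    qed
    show "y \<in> P \<or> y \<in> {1} \<or> iv y \<in> P" if y: "y \<in> E" for y
    proof -
      obtain g where g: "g \<in> carrier G" "y = emb g"
        using y by (auto simp: E_def)
      have "g = \<one> \<or> x g \<or> x (inv g)"
        using R g by blast
      then show ?thesis
        using iff[OF g(1)] iff[OF inv_closed[OF g(1)]] g emb_one emb_inv[OF g(1)] by auto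
    qed
  qed
  moreover have "x = char P"
    unfolding char_def using R iff by (intro extensionalityI[of _ "carrier G"]) (auto simp: PiE_def)
  ultimately show ?L
    by blast
qed

lemma closedin_char_image:
  "closedin (product_topology (\<lambda>_. discrete_topology (UNIV :: bool set)) (carrier G)) (char ` {P. cone E {1} P})"
  (is "closedin ?T ?X")
proof -
  let ?C = "\<lambda>i v. {x \<in> topspace ?T. x i = v}"
  have op: "openin ?T (?C i v)" if "i \<in> carrier G" for i v
    using openin_coordinate[OF that] .
  let ?U = "?C \<one> True \<union> (\<Union>g\<in>carrier G. \<Union>h\<in>carrier G. ?C g True \<inter> ?C h True \<inter> ?C (g \<otimes> h) False) \<union>
    (\<Union>g\<in>carrier G - {\<one>}. ?C g False \<inter> ?C (inv g) False)"
  have un: "openin ?T (\<Union>i\<in>A. f i)" if "\<And>i. i \<in> A \<Longrightarrow> openin ?T (f i)" for A and f :: "'a \<Rightarrow> ('a \<Rightarrow> bool) set"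
    using that by (intro openin_Union) auto
  have o: "openin ?T ?U"
    by (intro openin_Un un openin_Int op) auto
  have tT: "topspace ?T = carrier G \<rightarrow>\<^sub>E UNIV"
    by simp
  have U: "x \<in> ?U \<longleftrightarrow> x \<in> topspace ?T \<and> (x \<one> \<or>
      (\<exists>g\<in>carrier G. \<exists>h\<in>carrier G. x g \<and> x h \<and> \<not> x (g \<otimes> h)) \<or> (\<exists>g\<in>carrier G - {\<one>}. \<not> x g \<and> \<not> x (inv g)))" for x
    unfolding tT by auto
  have "?X = topspace ?T - ?U"
  proof (intro Set.set_eqI)
    fix x
    show "x \<in> ?X \<longleftrightarrow> x \<in> topspace ?T - ?U"
      unfolding char_image_iff Diff_iff U
      unfolding tT by (simp cong: conj_cong)
  qed
  then show ?thesis
    using closedin_diff[OF closedin_topspace o] by (simp only:)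
qed

text \<open>Agreement on \<open>F\<close> must be enforced by positive elements alone. A negative
  \<open>g\<close> is handled by its inverse, since a cone that contains \<open>iv g\<close>
  excludes \<open>g\<close>.\<close>

lemma char_image_perfect:
  assumes ni: "\<And>P. \<not> isolated E {1} P" and x: "x \<in> char ` {P. cone E {1} P}" and F: "finite F" "F \<subseteq> carrier G"
  shows "\<exists>y\<in>char ` {P. cone E {1} P}. y \<noteq> x \<and> (\<forall>g\<in>F. y g = x g)"
proof -
  obtain P where c: "cone E {1} P" and xP: "x = char P"
    using x by blast
  define F' where "F' = (emb ` F \<union> (\<lambda>g. iv (emb g)) ` F) \<inter> P"
  have "finite F'" "F' \<subseteq> P"
    using F by (auto simp: F'_def)
  then obtain Q where Q: "cone E {1} Q" "F' \<subseteq> Q" "Q \<noteq> P"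
    using ni[of P] c unfolding isolated_def by blast
  have "emb g \<in> Q \<longleftrightarrow> emb g \<in> P" if g: "g \<in> F" for g
  proof -
    have "emb g \<in> E"
      using g F by (auto simp: E_def)
    then consider "emb g \<in> P" | "emb g = 1" | "iv (emb g) \<in> P"
      using cone_total[OF c] by blast
    then show ?thesis
    proof cases
      case 1
      then show ?thesis
        using g Q(2) by (auto simp: F'_def)
    next
      case 2
      then show ?thesis
        using cone_disj[OF c, of 1] cone_disj[OF Q(1), of 1] by auto
    next
      case 3
      then have "iv (emb g) \<in> Q"
        using g Q(2) by (auto simp: F'_def)
      then show ?thesis
        using 3 cone_iv[OF c] cone_iv[OF Q(1)] by blast
    qed
  qed
  then have "\<forall>g\<in>F. char Q g = x g"
    unfolding xP char_def using F(2) by auto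
  moreover have "char Q \<noteq> x"
  proof
    assume e: "char Q = x"
    have "emb g \<in> Q \<longleftrightarrow> emb g \<in> P" if "g \<in> carrier G" for g
      using fun_cong[OF e, of g] that unfolding xP char_def by simp
    then have "Q = P"
      using cone_sub(2)[OF c] cone_sub(2)[OF Q(1)] unfolding E_def by blast
    then show False
      using Q(3) by blast
  qed
  ultimately show ?thesis
    using Q(1) by blast
qed

end

theorem theoremD:
  fixes G :: "('a, 'b) monoid_scheme"
  assumes "group G"
    and "\<exists>r. C_ordering G r"
    and "finite {r. C_ordering G r}"
  shows "finite (topspace (LO_space G)) \<or>
         LO_space G homeomorphic_space subtopology euclideanreal cantor_set"
proof -
  interpret group G
    by (rule assms(1))
  obtain r where r: "C_ordering G r"
    using assms(2) by blast
  note C = Ccone_cone_of[OF r]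
  \<comment> \<open>Distinct cones give distinct relations, so the finiteness hypothesis on
    relations passes to Conradian cones.\<close>
  have "inj_on rel_of {P. Ccone E P}"
    using rel_of_inj Ccone_cone by (intro inj_onI) blast
  then have "finite {P. Ccone E P}"
    by (rule inj_on_finite[OF _ _ assms(3)]) (use rel_of_C_ordering in blast)
  note main = finite_or_no_isolated[OF subgrp_E C this]
  let ?X = "char ` {P. cone E {1} P}"
  have LO: "LO_space G = subtopology (product_topology (\<lambda>_. discrete_topology (UNIV :: bool set)) (carrier G)) ?X"
    unfolding LO_space_def pos_char_image ..
  from main(2) show ?thesis
  proof
    assume "finite {Q. cone E {1} Q}"
    then have "finite (topspace (LO_space G))"
      unfolding LO by simp
    then show ?thesis
      by blast
  next
    assume ni: "\<forall>P. \<not> isolated E {1} P"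
    have "inj_on emb (carrier G)"
      using emb_inj by (intro inj_onI) blast
    then have "countable (carrier G)"
      using main(1) unfolding E_def by (rule countable_image_inj_on[rotated])
    moreover have "?X \<noteq> {}"
      using Ccone_cone[OF C] by blast
    ultimately have "LO_space G homeomorphic_space subtopology euclideanreal cantor_set"
      unfolding LO using closedin_char_image char_image_perfect ni
      by (intro perfect_homeomorphic_cantor_set) blast+
    then show ?thesis
      by blast
  qed
qed

end
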